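(* Let $R$ be a polynomial ring over a field, let $M$ be a finitely generated graded $R$-module, and let $I\subset R$ be an ideal generated by homogeneous elements $x_1,\dots,x_m$ which form an almost regular $M$-sequence and which also form a regular $R$-sequence. Then $$\operatorname{reg}(IM)\le \operatorname{reg}(M)+\operatorname{reg}(I).$$
   Context: $K$ is a field and $R$ is a polynomial ring over $K$ in finitely many variables with the standard grading. For a finitely generated graded $R$-module $M$ and $i\ge 0$ let $t_i(M)=\max\{j : \operatorname{Tor}_i^R(M,K)_j\neq 0\}$, with $t_i(M)=-\infty$ if $\operatorname{Tor}_i^R(M,K)=0$. The Castelnuovo-Mumford regularity of $M$ is $\operatorname{reg}(M)=\sup\{t_i(M)-i : i\ge 0\}$ (so $\operatorname{reg}(0)=-\infty$). A homogeneous element $x\in R$ of degree $d$ is almost regular on $M$ if the multiplication map $x\colon M_{i-d}\to M_i$ is injective for all $i\gg 0$. A sequence $x_1,\dots,x_m$ of homogeneous elements of $R$ is an almost regular $M$-sequence if $x_i$ is almost regular on $M/(x_1,\dots,x_{i-1})M$ for $i=1,\dots,m$. A regular $R$-sequence is a sequence such that $x_i$ is a non-zerodivisor on $R/(x_1,\dots,x_{i-1})$ for all $i$ and $(x_1,\dots,x_m)\neq R$. *)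

theory Defs
  imports Complex_Main "HOL-Library.Extended_Real"
begin

section \<open>Polynomial rings over a field\<close>

text \<open>
  A polynomial ring in \<open>n\<close> variables over the field \<open>'k\<close> (\<open>n = 0\<close> is allowed) is a commutative
  ring \<open>'r\<close> with a ring homomorphism \<open>emb\<close> from \<open>'k\<close> and elements \<open>X 0, \<dots>, X (n - 1)\<close>
  whose monomials, indexed without repetition by the exponent vectors, form a \<open>'k\<close>-basis of \<open>'r\<close>.
\<close>

definition exponents :: "nat \<Rightarrow> (nat \<Rightarrow> nat) set" where
  "exponents n = {\<alpha>. \<forall>i\<ge>n. \<alpha> i = 0}"

definition monomial :: "nat \<Rightarrow> (nat \<Rightarrow> 'r::comm_ring_1) \<Rightarrow> (nat \<Rightarrow> nat) \<Rightarrow> 'r" where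
  "monomial n X \<alpha> = (\<Prod>i<n. X i ^ \<alpha> i)"

text \<open>
  Data of a graded free resolution of a module on \<open>'n\<close> by free modules of finite rank:
  \<open>degs F i\<close> lists the degrees of the basis elements of the free module \<open>F\<^sub>i\<close>;
  \<open>mat F i\<close> is the matrix of \<open>F\<^sub>i\<^sub>+\<^sub>1 \<rightarrow> F\<^sub>i\<close>, sending the \<open>l\<close>-th basis element to the element with
  coordinates \<open>mat F i k l\<close>; \<open>aug F k\<close> is the image in \<open>'n\<close> of the \<open>k\<close>-th basis element of \<open>F\<^sub>0\<close>.
\<close>

record ('r, 'n) free_res =
  degs :: "nat \<Rightarrow> int list"
  mat :: "nat \<Rightarrow> nat \<Rightarrow> nat \<Rightarrow> 'r"
  aug :: "nat \<Rightarrow> 'n"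

text \<open>
  For an \<open>'r\<close>-module on \<open>'m\<close>, the tensor product with the free module \<open>F\<^sub>i\<close> is the direct sum of
  \<open>length (degs F i)\<close> copies of the module; its elements are functions on \<open>nat\<close> that vanish from
  that length on.  The following is the differential induced by \<open>F\<^sub>i\<^sub>+\<^sub>1 \<rightarrow> F\<^sub>i\<close>.  With the
  multiplication of \<open>'r\<close> as scalar multiplication it is the differential of the resolution itself.
\<close>

definition free_tuples :: "int list \<Rightarrow> (nat \<Rightarrow> 'm::zero) set" where
  "free_tuples a = {u. \<forall>k\<ge>length a. u k = 0}"

definition res_diff ::
  "('r \<Rightarrow> 'm \<Rightarrow> 'm::ab_group_add) \<Rightarrow> ('r, 'n) free_res \<Rightarrow> nat \<Rightarrow> (nat \<Rightarrow> 'm) \<Rightarrow> (nat \<Rightarrow> 'm)" where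
  "res_diff smult F i u =
     (\<lambda>k. if k < length (degs F i)
          then \<Sum>l<length (degs F (Suc i)). smult (mat F i k l) (u l) else 0)"

definition res_aug ::
  "('r \<Rightarrow> 'n \<Rightarrow> 'n::ab_group_add) \<Rightarrow> ('r, 'n) free_res \<Rightarrow> (nat \<Rightarrow> 'r) \<Rightarrow> 'n" where
  "res_aug nmult F u = (\<Sum>k<length (degs F 0). nmult (u k) (aug F k))"

text \<open>
  Throughout, a grading \<open>G\<close> gives the components \<open>G j\<close>, \<open>j \<in> \<int>\<close>.  A basis element of degree \<open>a\<close>
  contributes the summand \<open>M(-a)\<close> to the tensor product, hence the shift.
\<close>

definition graded_tuples :: "(int \<Rightarrow> 'm::zero set) \<Rightarrow> int list \<Rightarrow> int \<Rightarrow> (nat \<Rightarrow> 'm) set" where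
  "graded_tuples G a j = {u \<in> free_tuples a. \<forall>k<length a. u k \<in> G (j - a ! k)}"

definition tor_cycles ::
  "('r \<Rightarrow> 'm \<Rightarrow> 'm::ab_group_add) \<Rightarrow> (int \<Rightarrow> 'm set) \<Rightarrow> ('r, 'n) free_res
     \<Rightarrow> nat \<Rightarrow> int \<Rightarrow> (nat \<Rightarrow> 'm) set" where
  "tor_cycles smult G F i j =
     {u \<in> graded_tuples G (degs F i) j. i = 0 \<or> res_diff smult F (i - 1) u = (\<lambda>_. 0)}"

definition tor_boundaries ::
  "('r \<Rightarrow> 'm \<Rightarrow> 'm::ab_group_add) \<Rightarrow> (int \<Rightarrow> 'm set) \<Rightarrow> ('r, 'n) free_res
     \<Rightarrow> nat \<Rightarrow> int \<Rightarrow> (nat \<Rightarrow> 'm) set" where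
  "tor_boundaries smult G F i j = res_diff smult F i ` graded_tuples G (degs F (Suc i)) j"

text \<open>The degree \<open>j\<close> part of the \<open>i\<close>-th homology, as a set of cosets.\<close>

definition tor_homology ::
  "('r \<Rightarrow> 'm \<Rightarrow> 'm::ab_group_add) \<Rightarrow> (int \<Rightarrow> 'm set) \<Rightarrow> ('r, 'n) free_res
     \<Rightarrow> nat \<Rightarrow> int \<Rightarrow> (nat \<Rightarrow> 'm) set set" where
  "tor_homology smult G F i j =
     tor_cycles smult G F i j //
       {(u, v). u \<in> tor_cycles smult G F i j \<and> v \<in> tor_cycles smult G F i j \<and>
                (\<lambda>k. u k - v k) \<in> tor_boundaries smult G F i j}"

definition finitely_generated :: "('r::comm_ring_1 \<Rightarrow> 'm::ab_group_add \<Rightarrow> 'm) \<Rightarrow> bool" where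
  "finitely_generated smult \<longleftrightarrow> (\<exists>S. finite S \<and> module.span smult S = UNIV)"

abbreviation ideal_gen :: "'r::comm_ring_1 set \<Rightarrow> 'r set" where
  "ideal_gen \<equiv> module.span (*)"

text \<open>The submodule \<open>IM\<close> of a module \<open>M\<close>.\<close>

definition ideal_mult ::
  "('r::comm_ring_1 \<Rightarrow> 'm::ab_group_add \<Rightarrow> 'm) \<Rightarrow> 'r set \<Rightarrow> 'm set" where
  "ideal_mult smult I = module.span smult {smult a u |a u. a \<in> I}"

text \<open>
  Injectivity of multiplication on a quotient by a submodule is expressed on representatives,
  here and for almost regular sequences below.
\<close>

definition regular_sequence :: "'r::comm_ring_1 list \<Rightarrow> bool" where
  "regular_sequence xs \<longleftrightarrow>
     (\<forall>i<length xs. \<forall>a. xs ! i * a \<in> ideal_gen (set (take i xs)) \<longrightarrow>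
                         a \<in> ideal_gen (set (take i xs))) \<and>
     ideal_gen (set xs) \<noteq> UNIV"

locale polynomial_ring =
  fixes emb :: "'k::field \<Rightarrow> 'r::comm_ring_1" and n :: nat and X :: "nat \<Rightarrow> 'r"
  assumes emb_one: "emb 1 = 1"
    and emb_add: "emb (a + b) = emb a + emb b"
    and emb_mult: "emb (a * b) = emb a * emb b"
    and monomial_inj: "inj_on (monomial n X) (exponents n)"
    and monomials_independent: "\<not> module.dependent (\<lambda>c r. emb c * r) (monomial n X ` exponents n)"
    and monomials_span: "module.span (\<lambda>c r. emb c * r) (monomial n X ` exponents n) = UNIV"
begin

text \<open>The components \<open>R\<^sub>d\<close> of the standard grading; they vanish for \<open>d < 0\<close>.\<close>

definition homog :: "int \<Rightarrow> 'r set" where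
  "homog d = module.span (\<lambda>c r. emb c * r)
     {monomial n X \<alpha> |\<alpha>. \<alpha> \<in> exponents n \<and> int (\<Sum>i<n. \<alpha> i) = d}"

text \<open>The grading of an \<open>R\<close>-module whose carrier is the whole type \<open>'m\<close>.\<close>

definition graded_module ::
  "('r \<Rightarrow> 'm::ab_group_add \<Rightarrow> 'm) \<Rightarrow> (int \<Rightarrow> 'm set) \<Rightarrow> bool" where
  "graded_module smult G \<longleftrightarrow>
     module smult \<and>
     (\<forall>j. 0 \<in> G j \<and> (\<forall>u\<in>G j. \<forall>v\<in>G j. u - v \<in> G j)) \<and>
     (\<forall>d j. \<forall>r\<in>homog d. \<forall>u\<in>G j. smult r u \<in> G (d + j)) \<and>
     (\<forall>u. \<exists>!f. (\<forall>j. f j \<in> G j) \<and> finite {j. f j \<noteq> 0} \<and> u = (\<Sum>j | f j \<noteq> 0. f j))"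

text \<open>Graded free resolutions \<open>\<dots> \<rightarrow> F\<^sub>1 \<rightarrow> F\<^sub>0 \<rightarrow> N \<rightarrow> 0\<close> with all maps homogeneous of degree 0.\<close>

definition graded_free_resolution ::
  "('r \<Rightarrow> 'n::ab_group_add \<Rightarrow> 'n) \<Rightarrow> (int \<Rightarrow> 'n set) \<Rightarrow> ('r, 'n) free_res \<Rightarrow> bool" where
  "graded_free_resolution nmult H F \<longleftrightarrow>
     (\<forall>i. \<forall>k<length (degs F i). \<forall>l<length (degs F (Suc i)).
        mat F i k l \<in> homog (degs F (Suc i) ! l - degs F i ! k)) \<and>
     (\<forall>k<length (degs F 0). aug F k \<in> H (degs F 0 ! k)) \<and>
     res_aug nmult F ` free_tuples (degs F 0) = UNIV \<and>
     {u \<in> free_tuples (degs F 0). res_aug nmult F u = 0}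
       = res_diff (*) F 0 ` free_tuples (degs F (Suc 0)) \<and>
     (\<forall>i. {u \<in> free_tuples (degs F (Suc i)). res_diff (*) F i u = (\<lambda>_. 0)}
       = res_diff (*) F (Suc i) ` free_tuples (degs F (Suc (Suc i))))"

text \<open>
  \<open>Tor\<^sub>i(M, N)\<^sub>j\<close>, as the \<open>i\<close>-th left derived functor of \<open>M \<otimes> \<box>\<close> at \<open>N\<close>.  As usual it is computed from
  an arbitrarily chosen resolution of \<open>N\<close>, and is independent of the choice up to isomorphism.
\<close>

definition chosen_resolution ::
  "('r \<Rightarrow> 'n::ab_group_add \<Rightarrow> 'n) \<Rightarrow> (int \<Rightarrow> 'n set) \<Rightarrow> ('r, 'n) free_res" where
  "chosen_resolution nmult H = (SOME F. graded_free_resolution nmult H F)"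

definition Tor ::
  "('r \<Rightarrow> 'm::ab_group_add \<Rightarrow> 'm) \<Rightarrow> (int \<Rightarrow> 'm set) \<Rightarrow>
   ('r \<Rightarrow> 'n::ab_group_add \<Rightarrow> 'n) \<Rightarrow> (int \<Rightarrow> 'n set) \<Rightarrow> nat \<Rightarrow> int \<Rightarrow> (nat \<Rightarrow> 'm) set set" where
  "Tor smult G nmult H i j = tor_homology smult G (chosen_resolution nmult H) i j"

text \<open>A group of cosets is zero iff its only element is the coset of 0, i.e. the set of boundaries.\<close>

definition Tor_nonzero ::
  "('r \<Rightarrow> 'm::ab_group_add \<Rightarrow> 'm) \<Rightarrow> (int \<Rightarrow> 'm set) \<Rightarrow>
   ('r \<Rightarrow> 'n::ab_group_add \<Rightarrow> 'n) \<Rightarrow> (int \<Rightarrow> 'n set) \<Rightarrow> nat \<Rightarrow> int \<Rightarrow> bool" where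
  "Tor_nonzero smult G nmult H i j \<longleftrightarrow>
     Tor smult G nmult H i j \<noteq> {tor_boundaries smult G (chosen_resolution nmult H) i j}"

text \<open>The field as the graded \<open>R\<close>-module \<open>R/(X\<^sub>0, \<dots>, X\<^sub>n\<^sub>-\<^sub>1)\<close>, concentrated in degree 0.\<close>

definition const_coeff :: "'r \<Rightarrow> 'k" where
  "const_coeff r = (THE c. r - emb c \<in> ideal_gen (X ` {..<n}))"

definition K_scale :: "'r \<Rightarrow> 'k \<Rightarrow> 'k" where
  "K_scale r c = const_coeff r * c"

definition K_grading :: "int \<Rightarrow> 'k set" where
  "K_grading j = (if j = 0 then UNIV else {0})"

text \<open>
  The invariants \<open>t\<^sub>i\<close> and the regularity of the graded submodule of \<open>'m\<close> with components \<open>G j\<close>.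
  For finitely generated modules the supremum defining \<open>t\<^sub>i\<close> is a maximum, or \<open>Sup {} = -\<infinity>\<close>.
\<close>

definition tor_max_degree :: "('r \<Rightarrow> 'm::ab_group_add \<Rightarrow> 'm) \<Rightarrow> (int \<Rightarrow> 'm set) \<Rightarrow> nat \<Rightarrow> ereal" where
  "tor_max_degree smult G i = Sup {ereal (of_int j) |j. Tor_nonzero smult G K_scale K_grading i j}"

definition reg :: "('r \<Rightarrow> 'm::ab_group_add \<Rightarrow> 'm) \<Rightarrow> (int \<Rightarrow> 'm set) \<Rightarrow> ereal" where
  "reg smult G = (SUP i. tor_max_degree smult G i - ereal (real i))"

text \<open>The homogeneous element \<open>x\<close> is almost regular on \<open>M/N\<close>, for a graded submodule \<open>N\<close> of \<open>M\<close>.\<close>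

definition almost_regular_mod ::
  "('r \<Rightarrow> 'm::ab_group_add \<Rightarrow> 'm) \<Rightarrow> (int \<Rightarrow> 'm set) \<Rightarrow> 'm set \<Rightarrow> 'r \<Rightarrow> bool" where
  "almost_regular_mod smult G N x \<longleftrightarrow>
     (\<exists>d. x \<in> homog d \<and>
        (\<exists>i0. \<forall>i\<ge>i0. \<forall>u\<in>G (i - d). smult x u \<in> N \<longrightarrow> u \<in> N))"

definition almost_regular_sequence ::
  "('r \<Rightarrow> 'm::ab_group_add \<Rightarrow> 'm) \<Rightarrow> (int \<Rightarrow> 'm set) \<Rightarrow> 'r list \<Rightarrow> bool" where
  "almost_regular_sequence smult G xs \<longleftrightarrow>
     (\<forall>i<length xs.
        almost_regular_mod smult G (ideal_mult smult (ideal_gen (set (take i xs)))) (xs ! i))"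

end

end

theory Submission
  imports Defs "HOL-Library.Function_Algebras"
begin

text \<open>
Let \<open>d\<^sub>1, \<dots>, d\<^sub>m\<close> be the degrees of \<open>x\<^sub>1, \<dots>, x\<^sub>m\<close>, which are positive because a regular sequence generates
a proper ideal, and assume \<open>m \<ge> 1\<close>. The number \<open>c = (d\<^sub>1 - 1) + \<dots> + (d\<^sub>m - 1) + 1\<close> separates the two sides:
almost regularity on \<open>M\<close> gives \<open>reg (IM) \<le> reg M + c\<close>, and regularity on \<open>R\<close> gives \<open>c \<le> reg I\<close>.

\<^bold>\<open>Upper bound.\<close> Let \<open>N\<close> be a graded submodule and let \<open>x\<close> of degree \<open>d \<ge> 1\<close> be almost regular on \<open>P = M/N\<close>.
The annihilator \<open>0 :\<^sub>P x\<close> vanishes in high degrees. If it is nonzero, an element \<open>u\<close> of its top degree \<open>e\<close> is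
killed by all variables. On the Koszul complex of the variables, which has one generator, of degree \<open>n\<close>,
in homological degree \<open>n\<close> and nothing beyond, \<open>u\<close> gives a nonzero class in \<open>Tor\<^sub>n(P, K)\<^sub>e\<^sub>+\<^sub>n\<close>. So \<open>e \<le> reg P\<close>
(\<open>colon_vanishes_above_reg\<close>), and a module that vanishes above degree \<open>e\<close> has regularity at most \<open>e\<close>
(\<open>tor_vanishes_concentrated\<close>). The long exact sequences of \<open>0 \<rightarrow> 0 :\<^sub>P x \<rightarrow> P \<rightarrow> xP(d) \<rightarrow> 0\<close> and
\<open>0 \<rightarrow> xP \<rightarrow> P \<rightarrow> P/xP \<rightarrow> 0\<close> now give \<open>reg (P/xP) \<le> reg P + d - 1\<close> (\<open>reg_bound_almost_regular\<close>). Iterating along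
the sequence and passing from \<open>M/IM\<close> to \<open>IM\<close> yields the bound (\<open>reg_bound_ideal_mult\<close>).

\<^bold>\<open>Lower bound.\<close> If \<open>x\<close> of degree \<open>d \<ge> 1\<close> is a nonzerodivisor on \<open>R/J\<close>, the connecting map
\<open>Tor\<^sub>i\<^sub>+\<^sub>1(R/(J + xR), K)\<^sub>j\<^sub>+\<^sub>d \<rightarrow> Tor\<^sub>i(R/J, K)\<^sub>j\<close> is surjective, since \<open>x\<close> lies in the maximal ideal and so acts as
zero on \<open>Tor(\<box>, K)\<close> (\<open>maximal_ideal_kills_tor\<close>, \<open>tor_vanishes_regular_quotient\<close>). Starting at
\<open>Tor\<^sub>0(R, K)\<^sub>0 = K\<close> one reaches \<open>Tor\<^sub>m(R/I, K) \<noteq> 0\<close> in degree \<open>d\<^sub>1 + \<dots> + d\<^sub>m\<close>; hence \<open>Tor\<^sub>m\<^sub>-\<^sub>1(I, K)\<close> is nonzero in this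
degree, which gives \<open>c \<le> reg I\<close> (\<open>reg_regular_ideal\<close>).

Both halves are computed on the Koszul complex, whereas \<open>Tor\<close> is defined by an arbitrary resolution of \<open>K\<close>.
The Koszul complex is a resolution because it is an iterated mapping cone over multiplications by
nonzerodivisors (\<open>cone_resolution\<close>, \<open>koszul_resolution\<close>), and any two resolutions give the same vanishing of
\<open>Tor\<close> by the comparison theorem (\<open>tor_vanishes_independent\<close>). Quotient modules are never formed: a
subquotient \<open>A/B\<close> of \<open>M\<close> is treated through representatives, and \<open>tor_vanishes\<close> says that a homology group
with coefficients in \<open>A/B\<close> is zero.
\<close>

lemma module_ring: "module ((*) :: 'r::comm_ring_1 \<Rightarrow> 'r \<Rightarrow> 'r)"
  by unfold_locales (simp_all add: algebra_simps)

lemma ideal_gen_mult: "a \<in> ideal_gen S \<Longrightarrow> r * a \<in> ideal_gen S"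
  using module.span_scale[OF module_ring] by blast

lemma ideal_gen_1: "1 \<in> ideal_gen S \<Longrightarrow> ideal_gen S = (UNIV :: 'r::comm_ring_1 set)"
  using ideal_gen_mult[of 1 S] by auto

context polynomial_ring
begin

section \<open>Coefficients of polynomials\<close>

lemma vector_space_emb: "vector_space (\<lambda>c r. emb c * r)"
  by unfold_locales (simp_all add: emb_one emb_add emb_mult algebra_simps)

lemma emb_zero: "emb 0 = 0"
  using emb_add[of 0 0] by simp

lemma emb_minus: "emb (- c) = - emb c"
  using emb_add[of c "- c"] by (simp add: emb_zero eq_neg_iff_add_eq_0 add.commute)

definition coeff :: "'r \<Rightarrow> (nat \<Rightarrow> nat) \<Rightarrow> 'k" where
  "coeff r \<alpha> = (if \<alpha> \<in> exponents n
     then module.representation (\<lambda>c r. emb c * r) (monomial n X ` exponents n) r (monomial n X \<alpha>)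
     else 0)"

lemma coeff_add: "coeff (r + s) \<alpha> = coeff r \<alpha> + coeff s \<alpha>"
proof -
  interpret vector_space "\<lambda>c r. emb c * r" by (rule vector_space_emb)
  show ?thesis
    unfolding coeff_def using representation_add[OF monomials_independent, of s r]
    by (simp add: monomials_span)
qed

lemma coeff_scale: "coeff (emb c * r) \<alpha> = c * coeff r \<alpha>"
proof -
  interpret vector_space "\<lambda>c r. emb c * r" by (rule vector_space_emb)
  show ?thesis
    unfolding coeff_def using representation_scale[OF monomials_independent, of r c]
    by (simp add: monomials_span)
qed

lemma coeff_zero: "coeff 0 \<alpha> = 0"
  using coeff_scale[of 0 0 \<alpha>] by simp

lemma coeff_minus: "coeff (- r) \<alpha> = - coeff r \<alpha>"
  using coeff_scale[of "- 1" r \<alpha>] by (simp add: emb_minus emb_one)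

lemma coeff_diff: "coeff (r - s) \<alpha> = coeff r \<alpha> - coeff s \<alpha>"
  using coeff_add[of r "- s" \<alpha>] by (simp add: coeff_minus)

lemma coeff_sum: "coeff (\<Sum>i\<in>A. f i) \<alpha> = (\<Sum>i\<in>A. coeff (f i) \<alpha>)"
  by (induction A rule: infinite_finite_induct) (auto simp: coeff_zero coeff_add)

lemma coeff_monomial:
  assumes "\<beta> \<in> exponents n"
  shows "coeff (monomial n X \<beta>) \<alpha> = (if \<alpha> = \<beta> then 1 else 0)"
proof -
  interpret vector_space "\<lambda>c r. emb c * r" by (rule vector_space_emb)
  show ?thesis
    unfolding coeff_def
    using representation_basis[OF monomials_independent, of "monomial n X \<beta>"] assms
      inj_onD[OF monomial_inj, of \<alpha> \<beta>]
    by auto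
qed

lemma coeff_nonzero_exponent: "coeff r \<alpha> \<noteq> 0 \<Longrightarrow> \<alpha> \<in> exponents n"
  by (auto simp: coeff_def split: if_splits)

lemma finite_coeff: "finite {\<alpha>. coeff r \<alpha> \<noteq> 0}"
proof -
  interpret vector_space "\<lambda>c r. emb c * r" by (rule vector_space_emb)
  have "finite (monomial n X ` {\<alpha>. coeff r \<alpha> \<noteq> 0})"
    by (rule finite_subset[OF _ finite_representation[of "monomial n X ` exponents n" r]])
      (auto simp: coeff_def split: if_splits)
  moreover have "inj_on (monomial n X) {\<alpha>. coeff r \<alpha> \<noteq> 0}"
    using monomial_inj by (rule inj_on_subset) (auto dest: coeff_nonzero_exponent)
  ultimately show ?thesis
    by (rule finite_imageD)
qed

lemma poly_expansion: "(\<Sum>\<alpha> | coeff r \<alpha> \<noteq> 0. emb (coeff r \<alpha>) * monomial n X \<alpha>) = r"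
proof -
  interpret vector_space "\<lambda>c r. emb c * r" by (rule vector_space_emb)
  let ?B = "monomial n X ` exponents n"
  have "bij_betw (monomial n X) {\<alpha>. coeff r \<alpha> \<noteq> 0} {b. representation ?B r b \<noteq> 0}"
    unfolding bij_betw_def
  proof
    show "inj_on (monomial n X) {\<alpha>. coeff r \<alpha> \<noteq> 0}"
      using monomial_inj by (rule inj_on_subset) (auto dest: coeff_nonzero_exponent)
    show "monomial n X ` {\<alpha>. coeff r \<alpha> \<noteq> 0} = {b. representation ?B r b \<noteq> 0}"
      using representation_ne_zero[of ?B r]
      by (fastforce simp: coeff_def split: if_splits)
  qed
  then have "(\<Sum>\<alpha> | coeff r \<alpha> \<noteq> 0. emb (representation ?B r (monomial n X \<alpha>)) * monomial n X \<alpha>)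
      = (\<Sum>b | representation ?B r b \<noteq> 0. emb (representation ?B r b) * b)"
    by (rule sum.reindex_bij_betw)
  also have "\<dots> = r"
    by (rule sum_nonzero_representation_eq[OF monomials_independent]) (simp add: monomials_span)
  finally have eq: "(\<Sum>\<alpha> | coeff r \<alpha> \<noteq> 0.
      emb (representation ?B r (monomial n X \<alpha>)) * monomial n X \<alpha>) = r" .
  have coeff_eq: "(\<Sum>\<alpha> | coeff r \<alpha> \<noteq> 0. emb (coeff r \<alpha>) * monomial n X \<alpha>)
      = (\<Sum>\<alpha> | coeff r \<alpha> \<noteq> 0. emb (representation ?B r (monomial n X \<alpha>)) * monomial n X \<alpha>)"
    by (rule sum.cong) (auto simp: coeff_def split: if_splits)
  show ?thesis
    unfolding coeff_eq eq ..
qed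

lemma poly_eqI: "(\<And>\<alpha>. coeff r \<alpha> = coeff s \<alpha>) \<Longrightarrow> r = s"
  using poly_expansion[of r] poly_expansion[of s] by presburger

lemma poly_induct [case_names monomial add zero]:
  assumes "\<And>c \<alpha>. \<alpha> \<in> exponents n \<Longrightarrow> P (emb c * monomial n X \<alpha>)"
    and "\<And>r s. P r \<Longrightarrow> P s \<Longrightarrow> P (r + s)" and "P 0"
  shows "P r"
proof -
  have "P (\<Sum>\<alpha>\<in>A. emb (coeff r \<alpha>) * monomial n X \<alpha>)" if "finite A" "A \<subseteq> exponents n" for A
    using that by (induction A) (auto intro: assms)
  then have "P (\<Sum>\<alpha> | coeff r \<alpha> \<noteq> 0. emb (coeff r \<alpha>) * monomial n X \<alpha>)"
    using finite_coeff[of r] by (auto dest: coeff_nonzero_exponent)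
  then show ?thesis
    using poly_expansion[of r] by simp
qed

lemma monomial_upd: "k < n \<Longrightarrow> monomial n X (\<alpha>(k := Suc (\<alpha> k))) = X k * monomial n X \<alpha>"
proof -
  assume k: "k < n"
  have "monomial n X \<beta> = X k ^ \<beta> k * (\<Prod>i\<in>{..<n} - {k}. X i ^ \<beta> i)" for \<beta>
    unfolding monomial_def using k by (subst prod.remove[of _ k]) auto
  note this[of "\<alpha>(k := Suc (\<alpha> k))"] this[of \<alpha>]
  moreover have "(\<Prod>i\<in>{..<n} - {k}. X i ^ (\<alpha>(k := Suc (\<alpha> k))) i) = (\<Prod>i\<in>{..<n} - {k}. X i ^ \<alpha> i)"
    by (rule prod.cong) auto
  ultimately show ?thesis
    by (simp add: mult.assoc)
qed

lemma monomial_dec: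
  assumes "k < n" "0 < \<alpha> k"
  shows "monomial n X \<alpha> = X k * monomial n X (\<alpha>(k := \<alpha> k - 1))"
  using monomial_upd[OF assms(1), of "\<alpha>(k := \<alpha> k - 1)"] assms(2) by simp

lemma exponents_upd: "k < n \<Longrightarrow> \<alpha>(k := a) \<in> exponents n \<longleftrightarrow> \<alpha> \<in> exponents n"
  by (auto simp: exponents_def)

lemma coeff_X_mult:
  assumes k: "k < n"
  shows "coeff (X k * r) \<alpha> = (if \<alpha> k = 0 then 0 else coeff r (\<alpha>(k := \<alpha> k - 1)))"
proof (induction r rule: poly_induct)
  case (monomial c \<beta>)
  have *: "X k * (emb c * monomial n X \<beta>) = emb c * monomial n X (\<beta>(k := Suc (\<beta> k)))"
    using monomial_upd[OF k] by (simp add: mult.left_commute)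
  have "\<alpha> = \<beta>(k := Suc (\<beta> k)) \<longleftrightarrow> \<alpha> k \<noteq> 0 \<and> \<alpha>(k := \<alpha> k - 1) = \<beta>"
    by (auto simp: fun_eq_iff)
  then show ?case
    unfolding * coeff_scale using monomial k
    by (auto simp: coeff_monomial exponents_upd)
qed (simp_all add: distrib_left coeff_add coeff_zero fun_upd_def)

lemma exponents_add: "\<alpha> \<in> exponents n \<Longrightarrow> \<beta> \<in> exponents n \<Longrightarrow> (\<lambda>i. \<alpha> i + \<beta> i) \<in> exponents n"
  by (auto simp: exponents_def)

lemma monomial_mult: "monomial n X \<alpha> * monomial n X \<beta> = monomial n X (\<lambda>i. \<alpha> i + \<beta> i)"
  by (simp add: monomial_def power_add prod.distrib)

section \<open>The standard grading\<close>

lemma homog_iff: "r \<in> homog d \<longleftrightarrow> (\<forall>\<alpha>. coeff r \<alpha> \<noteq> 0 \<longrightarrow> int (\<Sum>i<n. \<alpha> i) = d)"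
proof
  interpret vector_space "\<lambda>c r. emb c * r" by (rule vector_space_emb)
  assume "r \<in> homog d"
  then have "r \<in> span {monomial n X \<alpha> |\<alpha>. \<alpha> \<in> exponents n \<and> int (\<Sum>i<n. \<alpha> i) = d}"
    by (simp add: homog_def)
  then show "\<forall>\<alpha>. coeff r \<alpha> \<noteq> 0 \<longrightarrow> int (\<Sum>i<n. \<alpha> i) = d"
  proof (induction rule: span_induct_alt)
    case base
    then show ?case by (simp add: coeff_zero)
  next
    case (step c x y)
    then show ?case by (auto simp: coeff_add coeff_scale coeff_monomial split: if_splits)
  qed
next
  interpret vector_space "\<lambda>c r. emb c * r" by (rule vector_space_emb)
  assume *: "\<forall>\<alpha>. coeff r \<alpha> \<noteq> 0 \<longrightarrow> int (\<Sum>i<n. \<alpha> i) = d"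
  have "(\<Sum>\<alpha> | coeff r \<alpha> \<noteq> 0. emb (coeff r \<alpha>) * monomial n X \<alpha>) \<in> homog d"
    unfolding homog_def
    by (intro span_sum span_scale span_base) (use * in \<open>auto dest: coeff_nonzero_exponent\<close>)
  then show "r \<in> homog d"
    using poly_expansion[of r] by simp
qed

lemma zero_in_homog: "0 \<in> homog d"
  by (simp add: homog_iff coeff_zero)

lemma homog_add: "r \<in> homog d \<Longrightarrow> s \<in> homog d \<Longrightarrow> r + s \<in> homog d"
  by (auto simp: homog_iff coeff_add) (metis add.right_neutral)

lemma homog_minus: "r \<in> homog d \<Longrightarrow> - r \<in> homog d"
  by (auto simp: homog_iff coeff_minus)

lemma homog_diff: "r \<in> homog d \<Longrightarrow> s \<in> homog d \<Longrightarrow> r - s \<in> homog d"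
  using homog_add[of r d "- s"] homog_minus by simp

lemma homog_sum: "(\<And>i. i \<in> A \<Longrightarrow> f i \<in> homog d) \<Longrightarrow> sum f A \<in> homog d"
  by (induction A rule: infinite_finite_induct) (auto simp: zero_in_homog homog_add)

lemma homog_emb_mult: "r \<in> homog d \<Longrightarrow> emb c * r \<in> homog d"
  by (auto simp: homog_iff coeff_scale)

lemma monomial_homog: "\<alpha> \<in> exponents n \<Longrightarrow> monomial n X \<alpha> \<in> homog (int (\<Sum>i<n. \<alpha> i))"
  by (auto simp: homog_iff coeff_monomial split: if_splits)

lemma coeff_one: "coeff 1 \<alpha> = (if \<alpha> = (\<lambda>_. 0) then 1 else 0)"
  using coeff_monomial[of "\<lambda>_. 0" \<alpha>] by (simp add: monomial_def exponents_def)

lemma one_homog: "1 \<in> homog 0"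
  by (auto simp: homog_iff coeff_one split: if_splits)

lemma variable_homog: "k < n \<Longrightarrow> X k \<in> homog 1"
proof -
  assume k: "k < n"
  have "monomial n X (\<lambda>_. 0) = 1"
    by (simp add: monomial_def)
  then have "X k = monomial n X ((\<lambda>_. 0)(k := Suc 0))"
    using monomial_upd[OF k, of "\<lambda>_. 0"] by simp
  moreover have "(\<Sum>i<n. ((\<lambda>_. 0)(k := Suc 0)) i) = 1"
    using k by (subst sum.remove[of _ k]) auto
  ultimately show ?thesis
    using monomial_homog[of "(\<lambda>_. 0)(k := Suc 0)"] k by (simp add: exponents_def)
qed

lemma homog_mult:
  assumes "r \<in> homog d" "s \<in> homog e"
  shows "r * s \<in> homog (d + e)"
proof -
  have "emb a * monomial n X \<alpha> * (emb b * monomial n X \<beta>) \<in> homog (d + e)"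
    if "coeff r \<alpha> \<noteq> 0" "coeff s \<beta> \<noteq> 0" for a b \<alpha> \<beta>
  proof -
    have "emb a * monomial n X \<alpha> * (emb b * monomial n X \<beta>)
        = emb (a * b) * monomial n X (\<lambda>i. \<alpha> i + \<beta> i)"
      by (simp add: emb_mult monomial_mult[symmetric] mult_ac)
    moreover have "monomial n X (\<lambda>i. \<alpha> i + \<beta> i) \<in> homog (d + e)"
      using monomial_homog[OF exponents_add[of \<alpha> \<beta>]] that assms
      by (auto simp: homog_iff sum.distrib dest: coeff_nonzero_exponent)
    ultimately show ?thesis
      by (simp add: homog_emb_mult)
  qed
  then have "(\<Sum>\<alpha> | coeff r \<alpha> \<noteq> 0. emb (coeff r \<alpha>) * monomial n X \<alpha>)
      * (\<Sum>\<alpha> | coeff s \<alpha> \<noteq> 0. emb (coeff s \<alpha>) * monomial n X \<alpha>) \<in> homog (d + e)"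
    unfolding sum_product by (intro homog_sum) auto
  then show ?thesis
    using poly_expansion[of r] poly_expansion[of s] by simp
qed

lemma homog_negative: "r \<in> homog d \<Longrightarrow> d < 0 \<Longrightarrow> r = 0"
proof (rule poly_eqI)
  fix \<alpha>
  assume "r \<in> homog d" "d < 0"
  then show "coeff r \<alpha> = coeff 0 \<alpha>"
    unfolding homog_iff coeff_zero by (metis of_nat_0_le_iff not_le)
qed

lemma homog_zero_degree: "r \<in> homog 0 \<Longrightarrow> \<exists>c. r = emb c"
proof (rule exI, rule poly_eqI)
  fix \<alpha>
  assume r: "r \<in> homog 0"
  have "\<alpha> = (\<lambda>_. 0)" if \<alpha>: "coeff r \<alpha> \<noteq> 0"
  proof
    fix i
    have "(\<Sum>i<n. \<alpha> i) = 0"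
      using r \<alpha> by (simp only: homog_iff) (metis of_nat_eq_0_iff)
    then show "\<alpha> i = 0"
      using coeff_nonzero_exponent[OF \<alpha>] by (cases "i < n") (auto simp: exponents_def)
  qed
  then show "coeff r \<alpha> = coeff (emb (coeff r (\<lambda>_. 0))) \<alpha>"
    using coeff_scale[of "coeff r (\<lambda>_. 0)" 1 \<alpha>] by (auto simp: coeff_one)
qed

lemma ex_coeff:
  assumes "finite {\<alpha>. f \<alpha> \<noteq> 0}" "\<And>\<alpha>. f \<alpha> \<noteq> 0 \<Longrightarrow> \<alpha> \<in> exponents n"
  shows "\<exists>r. coeff r = f"
proof (rule exI, rule ext)
  fix \<beta>
  have "coeff (\<Sum>\<alpha> | f \<alpha> \<noteq> 0. emb (f \<alpha>) * monomial n X \<alpha>) \<beta>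
      = (\<Sum>\<alpha> | f \<alpha> \<noteq> 0. if \<beta> = \<alpha> then f \<alpha> else 0)"
    unfolding coeff_sum by (rule sum.cong) (use assms(2) in \<open>auto simp: coeff_scale coeff_monomial\<close>)
  also have "\<dots> = f \<beta>"
    using assms(1) by (simp add: sum.delta')
  finally show "coeff (\<Sum>\<alpha> | f \<alpha> \<noteq> 0. emb (f \<alpha>) * monomial n X \<alpha>) \<beta> = f \<beta>" .
qed

text \<open>
Coefficients determine everything: the component of degree \<open>j\<close> of a polynomial has the coefficients at
exponents of total degree \<open>j\<close>, and no other family of homogeneous polynomials has the right sum.
\<close>

lemma graded_module_ring: "graded_module (*) homog"
  unfolding graded_module_def
proof (intro conjI allI ballI)
  fix u :: 'r
  let ?deg = "\<lambda>\<alpha> :: nat \<Rightarrow> nat. int (\<Sum>i<n. \<alpha> i)"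
  have "\<exists>r. \<forall>\<alpha>. coeff r \<alpha> = (if ?deg \<alpha> = j then coeff u \<alpha> else 0)" for j
  proof -
    have "finite {\<alpha>. (if ?deg \<alpha> = j then coeff u \<alpha> else 0) \<noteq> 0}"
      by (rule finite_subset[OF _ finite_coeff[of u]]) auto
    then have "\<exists>r. coeff r = (\<lambda>\<alpha>. if ?deg \<alpha> = j then coeff u \<alpha> else 0)"
      by (rule ex_coeff) (metis coeff_nonzero_exponent)
    then show ?thesis
      by metis
  qed
  then obtain f where f: "\<And>j \<alpha>. coeff (f j) \<alpha> = (if ?deg \<alpha> = j then coeff u \<alpha> else 0)"
    by metis
  have fin: "finite {j. f j \<noteq> 0}"
  proof (rule finite_subset)
    show "{j. f j \<noteq> 0} \<subseteq> ?deg ` {\<alpha>. coeff u \<alpha> \<noteq> 0}"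
    proof
      fix j
      assume "j \<in> {j. f j \<noteq> 0}"
      then obtain \<alpha> where "coeff (f j) \<alpha> \<noteq> 0"
        using poly_eqI[of "f j" 0] coeff_zero by auto
      then show "j \<in> ?deg ` {\<alpha>. coeff u \<alpha> \<noteq> 0}"
        by (auto simp: f split: if_splits)
    qed
    show "finite (?deg ` {\<alpha>. coeff u \<alpha> \<noteq> 0})"
      using finite_coeff by blast
  qed
  show "\<exists>!f. (\<forall>j. f j \<in> homog j) \<and> finite {j. f j \<noteq> 0} \<and> u = (\<Sum>j | f j \<noteq> 0. f j)"
  proof (intro ex1I conjI allI)
    show "f j \<in> homog j" for j
      by (auto simp: homog_iff f split: if_splits)
    show "finite {j. f j \<noteq> 0}" by fact
    show "u = (\<Sum>j | f j \<noteq> 0. f j)"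
    proof (rule poly_eqI)
      fix \<alpha>
      have "(\<Sum>j | f j \<noteq> 0. coeff (f j) \<alpha>) = (\<Sum>j | f j \<noteq> 0. if ?deg \<alpha> = j then coeff u \<alpha> else 0)"
        by (simp add: f)
      also have "\<dots> = (if f (?deg \<alpha>) \<noteq> 0 then coeff u \<alpha> else 0)"
        using fin by (simp add: sum.delta')
      also have "\<dots> = coeff u \<alpha>"
        using f[of "?deg \<alpha>" \<alpha>] coeff_zero by auto
      finally show "coeff u \<alpha> = coeff (\<Sum>j | f j \<noteq> 0. f j) \<alpha>"
        by (simp add: coeff_sum)
    qed
    fix g
    assume g: "(\<forall>j. g j \<in> homog j) \<and> finite {j. g j \<noteq> 0} \<and> u = (\<Sum>j | g j \<noteq> 0. g j)"
    have gc: "coeff (g j) \<alpha> = (if ?deg \<alpha> = j then coeff (g j) \<alpha> else 0)" for j \<alpha>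
      using g by (auto simp: homog_iff)
    have "coeff u \<alpha> = coeff (g (?deg \<alpha>)) \<alpha>" for \<alpha>
    proof -
      have "coeff u \<alpha> = (\<Sum>j | g j \<noteq> 0. coeff (g j) \<alpha>)"
        using g coeff_sum by metis
      also have "\<dots> = (\<Sum>j | g j \<noteq> 0. if ?deg \<alpha> = j then coeff (g j) \<alpha> else 0)"
        by (rule sum.cong[OF refl]) (rule gc)
      also have "\<dots> = (if g (?deg \<alpha>) \<noteq> 0 then coeff (g (?deg \<alpha>)) \<alpha> else 0)"
        using g by (simp add: sum.delta')
      also have "\<dots> = coeff (g (?deg \<alpha>)) \<alpha>"
        using coeff_zero by auto
      finally show ?thesis .
    qed
    then show "g = f"
      using gc f by (intro ext poly_eqI) metis
  qed
qed (auto simp: module_ring zero_in_homog homog_diff homog_mult)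

section \<open>Ideals generated by variables\<close>

text \<open>
The ideal of the first \<open>k\<close> variables is a monomial ideal, so membership can be read off the support. This
makes both the regularity of the variables and the constant coefficient accessible.
\<close>

lemma X_ideal_iff:
  assumes k: "k \<le> n"
  shows "r \<in> ideal_gen (X ` {..<k}) \<longleftrightarrow> (\<forall>\<alpha>. coeff r \<alpha> \<noteq> 0 \<longrightarrow> (\<exists>i<k. 0 < \<alpha> i))"
proof
  assume "r \<in> ideal_gen (X ` {..<k})"
  then show "\<forall>\<alpha>. coeff r \<alpha> \<noteq> 0 \<longrightarrow> (\<exists>i<k. 0 < \<alpha> i)"
  proof (induction rule: module.span_induct_alt[OF module_ring, consumes 1, case_names base step])
    case base
    then show ?case by (simp add: coeff_zero)
  next
    case (step c x y)
    then obtain i where "i < k" "x = X i" by auto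
    then have "coeff (c * x) \<alpha> \<noteq> 0 \<Longrightarrow> \<exists>i<k. 0 < \<alpha> i" for \<alpha>
      using coeff_X_mult[of i c \<alpha>] k by (auto simp: mult.commute split: if_splits)
    then show ?case
      using step by (auto simp: coeff_add) (metis add.right_neutral)
  qed
next
  assume *: "\<forall>\<alpha>. coeff r \<alpha> \<noteq> 0 \<longrightarrow> (\<exists>i<k. 0 < \<alpha> i)"
  have "emb c * monomial n X \<alpha> \<in> ideal_gen (X ` {..<k})" if \<alpha>: "coeff r \<alpha> \<noteq> 0" for \<alpha> c
  proof -
    obtain i where i: "i < k" "0 < \<alpha> i" using * \<alpha> by blast
    then have "emb c * monomial n X \<alpha> = emb c * monomial n X (\<alpha>(i := \<alpha> i - 1)) * X i"
      using monomial_dec[of i \<alpha>] k by (simp add: mult_ac)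
    then show ?thesis
      using i by (simp add: ideal_gen_mult module.span_base[OF module_ring])
  qed
  then have "(\<Sum>\<alpha> | coeff r \<alpha> \<noteq> 0. emb (coeff r \<alpha>) * monomial n X \<alpha>) \<in> ideal_gen (X ` {..<k})"
    by (intro module.span_sum[OF module_ring]) auto
  then show "r \<in> ideal_gen (X ` {..<k})"
    using poly_expansion[of r] by simp
qed

lemma maximal_ideal_iff: "r \<in> ideal_gen (X ` {..<n}) \<longleftrightarrow> coeff r (\<lambda>_. 0) = 0"
proof -
  have "\<alpha> = (\<lambda>_. 0) \<longleftrightarrow> \<not> (\<exists>i<n. 0 < \<alpha> i)" if "\<alpha> \<in> exponents n" for \<alpha>
    using that by (auto simp: exponents_def fun_eq_iff) (metis leI)
  then show ?thesis
    unfolding X_ideal_iff[OF order_refl] using coeff_nonzero_exponent by blast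
qed

text \<open>
Multiplication by \<open>X k\<close> shifts the support in direction \<open>k\<close>, which does not affect divisibility of a monomial
by an earlier variable.
\<close>

lemma X_regular:
  assumes k: "k < n" and r: "X k * r \<in> ideal_gen (X ` {..<k})"
  shows "r \<in> ideal_gen (X ` {..<k})"
proof -
  have "\<exists>i<k. 0 < \<alpha> i" if "coeff r \<alpha> \<noteq> 0" for \<alpha>
  proof -
    have "coeff (X k * r) (\<alpha>(k := Suc (\<alpha> k))) = coeff r \<alpha>"
      using k by (simp add: coeff_X_mult)
    then have "coeff (X k * r) (\<alpha>(k := Suc (\<alpha> k))) \<noteq> 0"
      using that by simp
    then obtain i where "i < k" "0 < (\<alpha>(k := Suc (\<alpha> k))) i"
      using r X_ideal_iff[of k] k by (meson less_imp_le)
    then show ?thesis by auto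
  qed
  then show ?thesis
    using k by (simp add: X_ideal_iff)
qed

lemma homog_positive_in_maximal: "r \<in> homog d \<Longrightarrow> 0 < d \<Longrightarrow> r \<in> ideal_gen (X ` {..<n})"
  unfolding maximal_ideal_iff by (auto simp: homog_iff)

section \<open>The residue field as a graded module\<close>

lemma const_coeff_eq: "const_coeff r = coeff r (\<lambda>_. 0)"
  unfolding const_coeff_def maximal_ideal_iff
  using coeff_scale[of _ 1 "\<lambda>_. 0"] by (intro the_equality) (auto simp: coeff_diff coeff_one)

lemma const_coeff_emb: "const_coeff (emb c) = c"
  using coeff_scale[of c 1 "\<lambda>_. 0"] by (simp add: const_coeff_eq coeff_one)

lemma const_coeff_add: "const_coeff (r + s) = const_coeff r + const_coeff s"
  by (simp add: const_coeff_eq coeff_add)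

lemma const_coeff_zero_iff: "const_coeff r = 0 \<longleftrightarrow> r \<in> ideal_gen (X ` {..<n})"
  by (simp add: const_coeff_eq maximal_ideal_iff)

lemma const_coeff_mult: "const_coeff (r * s) = const_coeff r * const_coeff s"
proof -
  have *: "r - emb (const_coeff r) \<in> ideal_gen (X ` {..<n})" for r
    using const_coeff_emb[of "const_coeff r"]
    by (simp add: maximal_ideal_iff coeff_diff const_coeff_eq)
  have "s * (r - emb (const_coeff r)) + emb (const_coeff r) * (s - emb (const_coeff s))
      \<in> ideal_gen (X ` {..<n})"
    by (intro module.span_add[OF module_ring] ideal_gen_mult *)
  also have "s * (r - emb (const_coeff r)) + emb (const_coeff r) * (s - emb (const_coeff s))
      = r * s - emb (const_coeff r * const_coeff s)"
    by (simp add: algebra_simps emb_mult)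
  finally have "r * s - emb (const_coeff r * const_coeff s) \<in> ideal_gen (X ` {..<n})" .
  then show ?thesis
    using const_coeff_emb[of "const_coeff r * const_coeff s"]
    by (simp add: maximal_ideal_iff coeff_diff const_coeff_eq)
qed

lemma graded_module_K: "graded_module K_scale K_grading"
  unfolding graded_module_def
proof (intro conjI allI ballI)
  show "module K_scale"
    by unfold_locales
      (simp_all add: K_scale_def const_coeff_add const_coeff_mult algebra_simps
        const_coeff_emb[of 1, unfolded emb_one])
  show "K_scale r u \<in> K_grading (d + j)" if "r \<in> homog d" "u \<in> K_grading j" for d j r u
    using that by (auto simp: K_scale_def K_grading_def homog_iff const_coeff_eq split: if_splits)
  fix u :: 'k
  show "\<exists>!f. (\<forall>j. f j \<in> K_grading j) \<and> finite {j. f j \<noteq> 0} \<and> u = (\<Sum>j | f j \<noteq> 0. f j)"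
  proof (intro ex1I[of _ "\<lambda>j. if j = 0 then u else 0"] conjI allI)
    show "finite {j. (if j = 0 then u else 0) \<noteq> 0}"
      by (rule finite_subset[of _ "{0}"]) auto
    have "{j::int. (if j = 0 then u else 0) \<noteq> 0} = (if u = 0 then {} else {0})"
      by auto
    then show "u = (\<Sum>j::int | (if j = 0 then u else 0) \<noteq> 0. if j = 0 then u else 0)"
      by simp
    fix f :: "int \<Rightarrow> 'k"
    assume f: "(\<forall>j. f j \<in> K_grading j) \<and> finite {j. f j \<noteq> 0} \<and> u = (\<Sum>j | f j \<noteq> 0. f j)"
    then have *: "f j = 0" if "j \<noteq> 0" for j
      using that unfolding K_grading_def by (metis singletonD)
    then have "{j. f j \<noteq> 0} = (if f 0 = 0 then {} else {0})"
      by (metis (mono_tags, lifting) Collect_cong Collect_empty_eq singleton_conv)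
    then have "u = f 0"
      using f by auto
    then show "f = (\<lambda>j. if j = 0 then u else 0)"
      using * by auto
  qed (auto simp: K_grading_def)
qed (auto simp: K_grading_def)

section \<open>Homogeneous components\<close>

text \<open>
A graded submodule enters all homological arguments only through its components, so it is represented by
the family of these.
\<close>

definition graded_family :: "('r \<Rightarrow> 'm::ab_group_add \<Rightarrow> 'm) \<Rightarrow> (int \<Rightarrow> 'm set) \<Rightarrow> bool" where
  "graded_family smult A \<longleftrightarrow>
     (\<forall>j. 0 \<in> A j \<and> (\<forall>u\<in>A j. \<forall>v\<in>A j. u - v \<in> A j)) \<and>
     (\<forall>d j. \<forall>r\<in>homog d. \<forall>u\<in>A j. smult r u \<in> A (d + j))"

lemma graded_module_family: "graded_module smult G \<Longrightarrow> graded_family smult G"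
  by (simp add: graded_module_def graded_family_def)

lemma family_zero: "graded_family smult A \<Longrightarrow> 0 \<in> A j"
  by (simp add: graded_family_def)

lemma family_diff: "graded_family smult A \<Longrightarrow> u \<in> A j \<Longrightarrow> v \<in> A j \<Longrightarrow> u - v \<in> A j"
  by (simp add: graded_family_def)

lemma family_minus: "graded_family smult A \<Longrightarrow> u \<in> A j \<Longrightarrow> - u \<in> A j"
  using family_diff[of smult A 0 j u] family_zero[of smult A j] by simp

lemma family_add: "graded_family smult A \<Longrightarrow> u \<in> A j \<Longrightarrow> v \<in> A j \<Longrightarrow> u + v \<in> A j"
  using family_diff[of smult A u j "- v"] family_minus[of smult A v j] by simp

lemma family_smult:
  "graded_family smult A \<Longrightarrow> r \<in> homog d \<Longrightarrow> u \<in> A j \<Longrightarrow> i = d + j \<Longrightarrow> smult r u \<in> A i"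
  by (simp add: graded_family_def)

lemma family_sum: "graded_family smult A \<Longrightarrow> (\<And>l. l \<in> S \<Longrightarrow> f l \<in> A j) \<Longrightarrow> sum f S \<in> A j"
  by (induction S rule: infinite_finite_induct) (auto simp: family_zero family_add)

definition component :: "(int \<Rightarrow> 'm::ab_group_add set) \<Rightarrow> int \<Rightarrow> 'm \<Rightarrow> 'm" where
  "component G j u =
     (THE f. (\<forall>j. f j \<in> G j) \<and> finite {j. f j \<noteq> 0} \<and> u = (\<Sum>j | f j \<noteq> 0. f j)) j"

lemma component_decomposition:
  assumes "graded_module smult G"
  shows "component G j u \<in> G j" and "finite {j. component G j u \<noteq> 0}"
    and "(\<Sum>j | component G j u \<noteq> 0. component G j u) = u"
proof -
  let ?P = "\<lambda>f. (\<forall>j. f j \<in> G j) \<and> finite {j. f j \<noteq> 0} \<and> u = (\<Sum>j | f j \<noteq> 0. f j)"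
  have "\<exists>!f. ?P f"
    using assms by (simp add: graded_module_def)
  then have "?P (THE f. ?P f)"
    by (rule theI')
  moreover define f where "f = (THE f. ?P f)"
  ultimately have f: "?P f"
    by simp
  have "component G j u = f j" for j
    by (simp add: component_def f_def)
  with f show "component G j u \<in> G j" "finite {j. component G j u \<noteq> 0}"
    "(\<Sum>j | component G j u \<noteq> 0. component G j u) = u"
    by simp_all
qed

lemma component_eqI:
  assumes G: "graded_module smult G" and f: "\<And>j. f j \<in> G j" "finite S" "\<And>j. f j \<noteq> 0 \<Longrightarrow> j \<in> S"
    and u: "u = (\<Sum>j\<in>S. f j)"
  shows "component G j u = f j"
proof -
  let ?P = "\<lambda>f. (\<forall>j. f j \<in> G j) \<and> finite {j. f j \<noteq> 0} \<and> u = (\<Sum>j | f j \<noteq> 0. f j)"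
  have "\<exists>!f. ?P f"
    using G by (simp add: graded_module_def)
  moreover have "(\<Sum>j\<in>S. f j) = (\<Sum>j | f j \<noteq> 0. f j)"
    by (rule sum.mono_neutral_right) (use f in auto)
  moreover have "finite {j. f j \<noteq> 0}"
    by (rule finite_subset[OF _ f(2)]) (use f in auto)
  ultimately have "(THE f. ?P f) = f"
    using f u by (intro the1_equality) simp_all
  then show ?thesis
    by (simp add: component_def)
qed

lemma component_of_homog:
  assumes G: "graded_module smult G" and "u \<in> G i"
  shows "component G j u = (if j = i then u else 0)"
  by (rule component_eqI[OF G, where S = "{i}"])
    (use assms family_zero[OF graded_module_family[OF G]] in \<open>auto split: if_splits\<close>)

lemma component_add:
  assumes G: "graded_module smult G"
  shows "component G j (u + v) = component G j u + component G j v"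
proof (rule component_eqI[OF G])
  let ?S = "{j. component G j u \<noteq> 0} \<union> {j. component G j v \<noteq> 0}"
  note dec = component_decomposition[OF G]
  show "component G j u + component G j v \<in> G j" for j
    by (intro family_add[OF graded_module_family[OF G]] dec)
  show "finite ?S"
    using dec by simp
  show "component G j u + component G j v \<noteq> 0 \<Longrightarrow> j \<in> ?S" for j
    by auto
  have "(\<Sum>j\<in>?S. component G j w) = w" if "{j. component G j w \<noteq> 0} \<subseteq> ?S" for w
    by (subst (2) dec(3)[of w, symmetric], rule sum.mono_neutral_right) (use dec that in auto)
  from this[of u] this[of v] show "u + v = (\<Sum>j\<in>?S. component G j u + component G j v)"
    by (auto simp: sum.distrib)
qed

lemma component_zero: "graded_module smult G \<Longrightarrow> component G j 0 = 0"
  using component_add[of smult G j 0 0] by simp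

lemma component_sum:
  "graded_module smult G \<Longrightarrow> component G j (sum f S) = (\<Sum>l\<in>S. component G j (f l))"
  by (induction S rule: infinite_finite_induct) (simp_all add: component_zero component_add)

text \<open>
Components are compatible with products in which either factor is homogeneous: decomposing the other
factor decomposes the product. With the scalar homogeneous this serves the differentials of a resolution,
with the vector homogeneous its augmentation.
\<close>

lemma component_smult_homog_left:
  assumes G: "graded_module smult G" and r: "r \<in> homog d"
  shows "component G j (smult r u) = smult r (component G (j - d) u)"
proof -
  interpret module smult using G by (simp add: graded_module_def)
  have "smult r u = (\<Sum>i | component G i u \<noteq> 0. smult r (component G i u))"
    by (subst component_decomposition(3)[OF G, of u, symmetric]) (rule scale_sum_right)
  then have "component G j (smult r u)
      = (\<Sum>i | component G i u \<noteq> 0. component G j (smult r (component G i u)))"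
    by (simp add: component_sum[OF G])
  also have "\<dots> = (\<Sum>i | component G i u \<noteq> 0. if i = j - d then smult r (component G i u) else 0)"
  proof (rule sum.cong[OF refl])
    fix i
    have "smult r (component G i u) \<in> G (d + i)"
      using family_smult[OF graded_module_family[OF G] r] component_decomposition(1)[OF G] by blast
    from component_of_homog[OF G this, of j]
    show "component G j (smult r (component G i u))
        = (if i = j - d then smult r (component G i u) else 0)"
      by auto
  qed
  also have "\<dots> = smult r (component G (j - d) u)"
    using component_decomposition(2)[OF G, of u] by (simp add: sum.delta)
  finally show ?thesis .
qed

lemma component_smult_homog_right:
  assumes G: "graded_module smult G" and u: "u \<in> G a"
  shows "component G j (smult r u) = smult (component homog (j - a) r) u"
proof -
  interpret module smult using G by (simp add: graded_module_def)
  note R = graded_module_ring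
  have "smult r u = (\<Sum>i | component homog i r \<noteq> 0. smult (component homog i r) u)"
    by (subst component_decomposition(3)[OF R, of r, symmetric]) (rule scale_sum_left)
  then have "component G j (smult r u)
      = (\<Sum>i | component homog i r \<noteq> 0. component G j (smult (component homog i r) u))"
    by (simp add: component_sum[OF G])
  also have "\<dots> = (\<Sum>i | component homog i r \<noteq> 0. if i = j - a then smult (component homog i r) u else 0)"
  proof (rule sum.cong[OF refl])
    fix i
    have "smult (component homog i r) u \<in> G (i + a)"
      using family_smult[OF graded_module_family[OF G] component_decomposition(1)[OF R] u] by blast
    from component_of_homog[OF G this, of j]
    show "component G j (smult (component homog i r) u)
        = (if i = j - a then smult (component homog i r) u else 0)"
      by auto
  qed
  also have "\<dots> = smult (component homog (j - a) r) u"
    using component_decomposition(2)[OF R, of r] by (simp add: sum.delta)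
  finally show ?thesis .
qed

section \<open>Matrices acting on tuples\<close>

definition mat_act ::
  "('r \<Rightarrow> 'm \<Rightarrow> 'm::ab_group_add) \<Rightarrow> nat \<Rightarrow> nat \<Rightarrow> (nat \<Rightarrow> nat \<Rightarrow> 'r) \<Rightarrow> (nat \<Rightarrow> 'm) \<Rightarrow> nat \<Rightarrow> 'm" where
  "mat_act smult a b P u = (\<lambda>k. if k < a then \<Sum>l<b. smult (P k l) (u l) else 0)"

definition mat_prod :: "nat \<Rightarrow> (nat \<Rightarrow> nat \<Rightarrow> 'r) \<Rightarrow> (nat \<Rightarrow> nat \<Rightarrow> 'r) \<Rightarrow> nat \<Rightarrow> nat \<Rightarrow> 'r" where
  "mat_prod b P Q = (\<lambda>k l. \<Sum>m<b. P k m * Q m l)"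

text \<open>
Matrices are total functions, and only the entries inside the index range carry meaning; equations between
matrices are therefore restricted to this range.
\<close>

definition mat_eq :: "nat \<Rightarrow> nat \<Rightarrow> (nat \<Rightarrow> nat \<Rightarrow> 'r) \<Rightarrow> (nat \<Rightarrow> nat \<Rightarrow> 'r) \<Rightarrow> bool" where
  "mat_eq a b P Q \<longleftrightarrow> (\<forall>k<a. \<forall>l<b. P k l = Q k l)"

text \<open>
The matrices of the homogeneous maps of degree \<open>d\<close> from the free module with basis degrees \<open>b\<close> to the one
with basis degrees \<open>a\<close>.
\<close>

definition homog_matrix :: "int \<Rightarrow> int list \<Rightarrow> int list \<Rightarrow> (nat \<Rightarrow> nat \<Rightarrow> 'r) \<Rightarrow> bool" where
  "homog_matrix d a b P \<longleftrightarrow> (\<forall>k<length a. \<forall>l<length b. P k l \<in> homog (b ! l - a ! k + d))"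

abbreviation rk :: "('r, 'n) free_res \<Rightarrow> nat \<Rightarrow> nat" where
  "rk F i \<equiv> length (degs F i)"

lemma res_diff_mat_act: "res_diff smult F i = mat_act smult (rk F i) (rk F (Suc i)) (mat F i)"
  by (simp add: res_diff_def mat_act_def fun_eq_iff)

lemma mat_act_mat_act:
  assumes "module smult"
  shows "mat_act smult a b P (mat_act smult b c Q u) = mat_act smult a c (mat_prod b P Q) u"
proof (rule ext)
  interpret module smult by fact
  fix k
  have "(\<Sum>l<b. smult (P k l) (\<Sum>m<c. smult (Q l m) (u m)))
      = (\<Sum>m<c. smult (\<Sum>l<b. P k l * Q l m) (u m))"
    by (simp add: scale_sum_right scale_sum_left) (rule sum.swap)
  then show "mat_act smult a b P (mat_act smult b c Q u) k = mat_act smult a c (mat_prod b P Q) u k"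
    by (simp add: mat_act_def mat_prod_def)
qed

lemma mat_prod_assoc: "mat_prod c (mat_prod b P Q) S = mat_prod b P (mat_prod c Q S)"
  unfolding mat_prod_def
  by (intro ext) (simp add: sum_distrib_left sum_distrib_right mult.assoc sum.swap[of _ "{..<c}"])

lemma mat_act_cong:
  "mat_eq a b P Q \<Longrightarrow> mat_act smult a b P u = mat_act smult a b Q u"
  by (auto simp: mat_act_def mat_eq_def fun_eq_iff intro!: sum.cong)

lemma mat_act_diff:
  assumes "module smult"
  shows "mat_act smult a b P (u - v) = mat_act smult a b P u - mat_act smult a b P v"
proof -
  interpret module smult by fact
  show ?thesis
    by (auto simp: mat_act_def fun_eq_iff scale_right_diff_distrib sum_subtractf)
qed

lemma mat_act_add:
  assumes "module smult"
  shows "mat_act smult a b P (u + v) = mat_act smult a b P u + mat_act smult a b P v"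
proof -
  interpret module smult by fact
  show ?thesis
    by (auto simp: mat_act_def fun_eq_iff scale_right_distrib sum.distrib)
qed

lemma mat_act_matrix_diff:
  assumes "module smult"
  shows "mat_act smult a b (P - Q) u = mat_act smult a b P u - mat_act smult a b Q u"
proof -
  interpret module smult by fact
  show ?thesis
    by (auto simp: mat_act_def fun_eq_iff scale_left_diff_distrib sum_subtractf)
qed

lemma mat_act_matrix_zero: "module smult \<Longrightarrow> mat_act smult a b 0 u = 0"
  using mat_act_matrix_diff[of smult a b 0 0 u] by simp

lemma mat_act_zero: "module smult \<Longrightarrow> mat_act smult a b P 0 = 0"
  using mat_act_diff[of smult a b P 0 0] by simp

lemma mat_eq_prod:
  "mat_eq a b P P' \<Longrightarrow> mat_eq b c Q Q' \<Longrightarrow> mat_eq a c (mat_prod b P Q) (mat_prod b P' Q')"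
  by (auto simp: mat_eq_def mat_prod_def intro!: sum.cong)

lemma mat_eq_refl: "mat_eq a b P P"
  by (simp add: mat_eq_def)

lemma mat_eq_sym: "mat_eq a b P Q \<Longrightarrow> mat_eq a b Q P"
  by (simp add: mat_eq_def)

lemma mat_eq_trans [trans]: "mat_eq a b P Q \<Longrightarrow> mat_eq a b Q S \<Longrightarrow> mat_eq a b P S"
  by (simp add: mat_eq_def)

lemma mat_eq_diff: "mat_eq a b P P' \<Longrightarrow> mat_eq a b Q Q' \<Longrightarrow> mat_eq a b (P - Q) (P' - Q')"
  by (simp add: mat_eq_def)

lemma mat_prod_diff_right: "mat_prod b P (Q - S) = mat_prod b P Q - mat_prod b P S"
  by (auto simp: mat_prod_def fun_eq_iff right_diff_distrib sum_subtractf)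

lemma mat_prod_diff_left: "mat_prod b (P - Q) S = mat_prod b P S - mat_prod b Q S"
  by (auto simp: mat_prod_def fun_eq_iff left_diff_distrib sum_subtractf)

lemma mat_prod_zero_right: "mat_prod b P 0 = 0"
  by (simp add: mat_prod_def fun_eq_iff)

lemma homog_matrix_prod:
  assumes "homog_matrix d a b P" "homog_matrix e b c Q"
  shows "homog_matrix (d + e) a c (mat_prod (length b) P Q)"
  unfolding homog_matrix_def mat_prod_def
proof (intro allI impI homog_sum)
  fix k l m
  assume "k < length a" "l < length c" "m \<in> {..<length b}"
  then have "P k m * Q m l \<in> homog ((b ! m - a ! k + d) + (c ! l - b ! m + e))"
    using assms by (intro homog_mult) (auto simp: homog_matrix_def)
  then show "P k m * Q m l \<in> homog (c ! l - a ! k + (d + e))"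
    by (simp add: algebra_simps)
qed

lemma homog_matrix_diff:
  "homog_matrix d a b P \<Longrightarrow> homog_matrix d a b Q \<Longrightarrow> homog_matrix d a b (P - Q)"
  by (simp add: homog_matrix_def homog_diff)

lemma tuples_zero: "graded_family smult A \<Longrightarrow> 0 \<in> graded_tuples A a j"
  by (simp add: graded_tuples_def free_tuples_def family_zero)

lemma tuples_diff:
  "graded_family smult A \<Longrightarrow> u \<in> graded_tuples A a j \<Longrightarrow> v \<in> graded_tuples A a j
    \<Longrightarrow> u - v \<in> graded_tuples A a j"
  by (auto simp: graded_tuples_def free_tuples_def intro: family_diff)

lemma tuples_add:
  "graded_family smult A \<Longrightarrow> u \<in> graded_tuples A a j \<Longrightarrow> v \<in> graded_tuples A a j
    \<Longrightarrow> u + v \<in> graded_tuples A a j"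
  by (auto simp: graded_tuples_def free_tuples_def intro: family_add)

lemma tuples_mono: "(\<And>j. A j \<subseteq> B j) \<Longrightarrow> graded_tuples A a j \<subseteq> graded_tuples B a j"
  by (auto simp: graded_tuples_def)

lemma mat_act_graded:
  assumes "graded_family smult A" "homog_matrix d a b P" "u \<in> graded_tuples A b j"
  shows "mat_act smult (length a) (length b) P u \<in> graded_tuples A a (j + d)"
  unfolding graded_tuples_def mat_act_def free_tuples_def
  using assms
  by (auto intro!: family_sum[OF assms(1)] family_smult[OF assms(1)] simp: homog_matrix_def graded_tuples_def)

section \<open>Graded exactness of resolutions\<close>

text \<open>
At \<open>F\<^sub>0\<close> the augmentation takes the place of a differential. With this convention exactness of the augmented
complex is the same statement at all \<open>F\<^sub>i\<close>, and one lifting lemma serves all degrees.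
\<close>

definition res_cycle :: "('r \<Rightarrow> 'n::ab_group_add \<Rightarrow> 'n) \<Rightarrow> ('r, 'n) free_res \<Rightarrow> nat \<Rightarrow> (nat \<Rightarrow> 'r) \<Rightarrow> bool" where
  "res_cycle nmult F i u \<longleftrightarrow>
     (case i of 0 \<Rightarrow> res_aug nmult F u = 0 | Suc i' \<Rightarrow> res_diff (*) F i' u = 0)"

lemma resolution_exact:
  assumes "graded_free_resolution nmult H F" "u \<in> free_tuples (degs F i)"
  shows "res_cycle nmult F i u \<longleftrightarrow> (\<exists>v\<in>free_tuples (degs F (Suc i)). res_diff (*) F i v = u)"
proof (cases i)
  case 0
  have "{u \<in> free_tuples (degs F 0). res_aug nmult F u = 0}
       = res_diff (*) F 0 ` free_tuples (degs F (Suc 0))"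
    using assms(1) by (simp add: graded_free_resolution_def)
  then show ?thesis
    using assms(2) 0 by (simp add: res_cycle_def set_eq_iff image_iff) metis
next
  case (Suc i')
  have "{u \<in> free_tuples (degs F (Suc i')). res_diff (*) F i' u = (\<lambda>_. 0)}
       = res_diff (*) F (Suc i') ` free_tuples (degs F (Suc (Suc i')))"
    using assms(1) by (simp add: graded_free_resolution_def)
  then show ?thesis
    using assms(2) Suc by (simp add: res_cycle_def zero_fun_def set_eq_iff image_iff) metis
qed

definition tuple_component :: "int list \<Rightarrow> int \<Rightarrow> (nat \<Rightarrow> 'r) \<Rightarrow> nat \<Rightarrow> 'r" where
  "tuple_component a j u = (\<lambda>k. if k < length a then component homog (j - a ! k) (u k) else 0)"

lemma tuple_component_graded: "tuple_component a j u \<in> graded_tuples homog a j"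
  by (auto simp: tuple_component_def graded_tuples_def free_tuples_def
      intro: component_decomposition(1)[OF graded_module_ring])

lemma tuple_component_of_graded: "u \<in> graded_tuples homog a j \<Longrightarrow> tuple_component a j u = u"
  by (auto simp: tuple_component_def graded_tuples_def free_tuples_def fun_eq_iff
      component_of_homog[OF graded_module_ring])

lemma tuple_component_mat_act:
  assumes "homog_matrix 0 a b P"
  shows "tuple_component a j (mat_act (*) (length a) (length b) P u)
       = mat_act (*) (length a) (length b) P (tuple_component b j u)"
proof (rule ext)
  fix k
  have "component homog (j - a ! k) (P k l * u l) = P k l * component homog (j - b ! l) (u l)"
    if "k < length a" "l < length b" for l
    using component_smult_homog_left[OF graded_module_ring, of "P k l" "b ! l - a ! k"] assms that
    by (simp add: homog_matrix_def algebra_simps)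
  then show "tuple_component a j (mat_act (*) (length a) (length b) P u) k
       = mat_act (*) (length a) (length b) P (tuple_component b j u) k"
    by (simp add: tuple_component_def mat_act_def component_sum[OF graded_module_ring])
qed

lemma resolution_homog_matrix:
  "graded_free_resolution nmult H F \<Longrightarrow> homog_matrix 0 (degs F i) (degs F (Suc i)) (mat F i)"
  by (simp add: graded_free_resolution_def homog_matrix_def)

text \<open>
A homogeneous boundary is the boundary of a homogeneous tuple, because the differential, having degree 0,
commutes with taking components. This is what makes lifted maps and homotopies homogeneous.
\<close>

lemma resolution_exact_graded:
  assumes F: "graded_free_resolution nmult H F"
    and u: "u \<in> graded_tuples homog (degs F i) j" "res_cycle nmult F i u"
  shows "\<exists>v\<in>graded_tuples homog (degs F (Suc i)) j. res_diff (*) F i v = u"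
proof -
  have "u \<in> free_tuples (degs F i)"
    using u by (simp add: graded_tuples_def)
  then obtain v where v: "res_diff (*) F i v = u"
    using resolution_exact[OF F] u by blast
  have "res_diff (*) F i (tuple_component (degs F (Suc i)) j v) = tuple_component (degs F i) j u"
    unfolding v[symmetric] res_diff_mat_act
    by (rule tuple_component_mat_act[OF resolution_homog_matrix[OF F], symmetric])
  then show ?thesis
    using tuple_component_graded tuple_component_of_graded[OF u(1)] by auto
qed

lemma resolution_aug_surj_graded:
  assumes H: "graded_module nmult H" and F: "graded_free_resolution nmult H F" and c: "c \<in> H j"
  shows "\<exists>u\<in>graded_tuples homog (degs F 0) j. res_aug nmult F u = c"
proof -
  have "res_aug nmult F ` free_tuples (degs F 0) = UNIV"
    using F by (simp add: graded_free_resolution_def)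
  then obtain u where u: "res_aug nmult F u = c"
    by (metis UNIV_I imageE)
  have "nmult (tuple_component (degs F 0) j u k) (aug F k) = component H j (nmult (u k) (aug F k))"
    if "k < rk F 0" for k
  proof -
    have "aug F k \<in> H (degs F 0 ! k)"
      using F that by (simp add: graded_free_resolution_def)
    from component_smult_homog_right[OF H this] show ?thesis
      using that by (simp add: tuple_component_def)
  qed
  then have "res_aug nmult F (tuple_component (degs F 0) j u) = component H j (res_aug nmult F u)"
    by (simp add: res_aug_def component_sum[OF H])
  also have "\<dots> = c"
    unfolding u using component_of_homog[OF H c] by simp
  finally show ?thesis
    using tuple_component_graded by blast
qed

section \<open>Comparison of resolutions\<close>

text \<open>
The composite of the augmentation with a matrix into \<open>F\<^sub>0\<close>.
\<close>

definition aug_row :: "('r \<Rightarrow> 'n::ab_group_add \<Rightarrow> 'n) \<Rightarrow> ('r, 'n) free_res \<Rightarrow> (nat \<Rightarrow> nat \<Rightarrow> 'r) \<Rightarrow> nat \<Rightarrow> 'n" where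
  "aug_row nmult F P l = (\<Sum>k<rk F 0. nmult (P k l) (aug F k))"

text \<open>
All columns are cycles in the sense of \<open>res_cycle\<close>.
\<close>

definition cycle_matrix ::
  "('r \<Rightarrow> 'n::ab_group_add \<Rightarrow> 'n) \<Rightarrow> ('r, 'n) free_res \<Rightarrow> nat \<Rightarrow> nat \<Rightarrow> (nat \<Rightarrow> nat \<Rightarrow> 'r) \<Rightarrow> bool" where
  "cycle_matrix nmult F i b P \<longleftrightarrow>
     (case i of 0 \<Rightarrow> \<forall>l<b. aug_row nmult F P l = 0
      | Suc i' \<Rightarrow> mat_eq (rk F i') b (mat_prod (rk F i) (mat F i') P) 0)"

lemma aug_row_prod:
  assumes "module nmult"
  shows "aug_row nmult F (mat_prod b P Q) l = (\<Sum>m<b. nmult (Q m l) (aug_row nmult F P m))"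
proof -
  interpret module nmult by fact
  show ?thesis
    unfolding aug_row_def mat_prod_def
    by (simp add: scale_sum_right scale_sum_left mult.commute sum.swap[of _ "{..<b}"])
qed

lemma cycle_matrix_column:
  fixes P :: "nat \<Rightarrow> nat \<Rightarrow> 'r"
  assumes "cycle_matrix nmult F i b P" "l < b"
  shows "res_cycle nmult F i (\<lambda>k. if k < rk F i then P k l else 0)"
proof (cases i)
  case 0
  then show ?thesis
    using assms by (simp add: res_cycle_def cycle_matrix_def aug_row_def res_aug_def)
next
  case (Suc i')
  then show ?thesis
    using assms
    by (auto simp: res_cycle_def cycle_matrix_def res_diff_def mat_eq_def mat_prod_def fun_eq_iff)
qed

text \<open>
Free modules are projective: a map into cycles lifts through the differential, one basis element (column)
at a time. Each column of a homogeneous matrix is a homogeneous tuple, so the lift can be chosen of the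
same degree.
\<close>

lemma lift_matrix:
  assumes F: "graded_free_resolution nmult H F"
    and P: "homog_matrix d (degs F i) b P" "cycle_matrix nmult F i (length b) P"
  shows "\<exists>Q. homog_matrix d (degs F (Suc i)) b Q
    \<and> mat_eq (rk F i) (length b) (mat_prod (rk F (Suc i)) (mat F i) Q) P"
proof -
  have "\<exists>v\<in>graded_tuples homog (degs F (Suc i)) (b ! l + d).
      res_diff (*) F i v = (\<lambda>k. if k < rk F i then P k l else 0)" if l: "l < length b" for l
  proof (rule resolution_exact_graded[OF F])
    show "(\<lambda>k. if k < rk F i then P k l else 0) \<in> graded_tuples homog (degs F i) (b ! l + d)"
      using P(1) l by (auto simp: graded_tuples_def free_tuples_def homog_matrix_def algebra_simps)
  qed (use cycle_matrix_column[OF P(2) l] in simp)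
  then obtain q where q: "\<And>l. l < length b \<Longrightarrow> q l \<in> graded_tuples homog (degs F (Suc i)) (b ! l + d)"
    "\<And>l. l < length b \<Longrightarrow> res_diff (*) F i (q l) = (\<lambda>k. if k < rk F i then P k l else 0)"
    by metis
  show ?thesis
  proof (intro exI conjI)
    show "homog_matrix d (degs F (Suc i)) b (\<lambda>k l. q l k)"
      using q(1) by (auto simp: homog_matrix_def graded_tuples_def algebra_simps)
    show "mat_eq (rk F i) (length b) (mat_prod (rk F (Suc i)) (mat F i) (\<lambda>k l. q l k)) P"
      using q(2) by (auto simp: mat_eq_def mat_prod_def res_diff_def fun_eq_iff split: if_splits) metis
  qed
qed

text \<open>
The column of index \<open>l\<close> is the image of a basis vector. Evaluating exactness on basis vectors turns it into
equations between matrices, which remain valid after tensoring with a module.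
\<close>

lemma differential_cycle:
  assumes H: "graded_module nmult H" and F: "graded_free_resolution nmult H F"
  shows "cycle_matrix nmult F i (rk F (Suc i)) (mat F i)"
proof -
  have cyc: "res_cycle nmult F i (\<lambda>k. if k < rk F i then mat F i k l else 0)"
    if l: "l < rk F (Suc i)" for l
  proof -
    let ?e = "\<lambda>m. if m = l then 1 else 0 :: 'r"
    have "?e \<in> free_tuples (degs F (Suc i))"
      using l by (auto simp: free_tuples_def)
    moreover have "(\<Sum>m<rk F (Suc i). mat F i k m * ?e m) = mat F i k l" for k
      using l by (simp add: if_distrib[of "\<lambda>c. _ * c"] cong: if_cong)
    then have "res_diff (*) F i ?e = (\<lambda>k. if k < rk F i then mat F i k l else 0)"
      by (auto simp: res_diff_def fun_eq_iff)
    moreover have "(\<lambda>k. if k < rk F i then mat F i k l else 0) \<in> free_tuples (degs F i)"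
      by (simp add: free_tuples_def)
    ultimately show ?thesis
      using resolution_exact[OF F] by metis
  qed
  show ?thesis
  proof (cases i)
    case 0
    then show ?thesis
      using cyc by (simp add: res_cycle_def cycle_matrix_def aug_row_def res_aug_def)
  next
    case (Suc i')
    have "(\<Sum>m<rk F (Suc i'). mat F i' k m * mat F i m l) = 0"
      if "k < rk F i'" "l < rk F (Suc i)" for k l
    proof -
      have "(\<Sum>m<rk F (Suc i'). mat F i' k m * mat F i m l)
          = res_diff (*) F i' (\<lambda>m. if m < rk F i then mat F i m l else 0) k"
        using that(1) Suc by (auto simp: res_diff_def intro!: sum.cong)
      also have "\<dots> = 0"
        using cyc[OF that(2)] Suc by (simp add: res_cycle_def)
      finally show ?thesis .
    qed
    then show ?thesis
      using Suc by (simp add: cycle_matrix_def mat_eq_def mat_prod_def)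
  qed
qed

definition free_complex :: "('r, 'n) free_res \<Rightarrow> bool" where
  "free_complex F \<longleftrightarrow> (\<forall>i. homog_matrix 0 (degs F i) (degs F (Suc i)) (mat F i)) \<and>
     (\<forall>i. mat_eq (rk F i) (rk F (Suc (Suc i))) (mat_prod (rk F (Suc i)) (mat F i) (mat F (Suc i))) 0)"

lemma resolution_complex:
  "graded_module nmult H \<Longrightarrow> graded_free_resolution nmult H F \<Longrightarrow> free_complex F"
  using differential_cycle[of nmult H F "Suc _"]
  by (auto simp: free_complex_def resolution_homog_matrix cycle_matrix_def)

lemma res_diff_res_diff:
  assumes "free_complex F" "module smult"
  shows "res_diff smult F i (res_diff smult F (Suc i) u) = 0"
proof -
  have "mat_act smult (rk F i) (rk F (Suc (Suc i)))
      (mat_prod (rk F (Suc i)) (mat F i) (mat F (Suc i))) u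
    = mat_act smult (rk F i) (rk F (Suc (Suc i))) 0 u"
    using assms(1) by (intro mat_act_cong) (simp add: free_complex_def)
  then show ?thesis
    by (simp add: res_diff_mat_act mat_act_mat_act[OF assms(2)] mat_act_matrix_zero[OF assms(2)])
qed

lemma res_diff_graded:
  assumes "free_complex F" "graded_family smult A" "u \<in> graded_tuples A (degs F (Suc i)) j"
  shows "res_diff smult F i u \<in> graded_tuples A (degs F i) j"
  using mat_act_graded[OF assms(2), of 0 "degs F i" "degs F (Suc i)" "mat F i" u j] assms(1,3)
  by (simp add: res_diff_mat_act free_complex_def)

definition chain_map ::
  "int \<Rightarrow> ('r, 'n) free_res \<Rightarrow> ('r, 'n) free_res \<Rightarrow> (nat \<Rightarrow> nat \<Rightarrow> nat \<Rightarrow> 'r) \<Rightarrow> bool" where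
  "chain_map d F F' f \<longleftrightarrow> (\<forall>i. homog_matrix d (degs F' i) (degs F i) (f i)) \<and>
     (\<forall>i. mat_eq (rk F' i) (rk F (Suc i))
        (mat_prod (rk F' (Suc i)) (mat F' i) (f (Suc i))) (mat_prod (rk F i) (f i) (mat F i)))"

text \<open>
The lift of the identity of the resolved module, built degree by degree. The invariant carried along is
that \<open>f\<^sub>i \<circ> \<partial>\<close> takes values in cycles; this is exactly what allows \<open>f\<^sub>i\<^sub>+\<^sub>1\<close> to be chosen with
\<open>\<partial> \<circ> f\<^sub>i\<^sub>+\<^sub>1 = f\<^sub>i \<circ> \<partial>\<close>.
\<close>

lemma comparison_chain_map:
  assumes H: "graded_module nmult H"
    and F: "graded_free_resolution nmult H F" and F': "graded_free_resolution nmult H F'"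
  shows "\<exists>f. chain_map 0 F F' f \<and> (\<forall>l<rk F 0. aug_row nmult F' (f 0) l = aug F l)"
proof -
  have mod: "module nmult" using H by (simp add: graded_module_def)
  let ?P = "\<lambda>i f. homog_matrix 0 (degs F' i) (degs F i) f
      \<and> cycle_matrix nmult F' i (rk F (Suc i)) (mat_prod (rk F i) f (mat F i))
      \<and> (i = 0 \<longrightarrow> (\<forall>l<rk F 0. aug_row nmult F' f l = aug F l))"
  let ?Q = "\<lambda>i f g. mat_eq (rk F' i) (rk F (Suc i))
      (mat_prod (rk F' (Suc i)) (mat F' i) g) (mat_prod (rk F i) f (mat F i))"
  have "\<exists>f. \<forall>i. ?P i (f i) \<and> ?Q i (f i) (f (Suc i))"
  proof (rule dependent_nat_choice)
    have "\<exists>u\<in>graded_tuples homog (degs F' 0) (degs F 0 ! l). res_aug nmult F' u = aug F l"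
      if "l < rk F 0" for l
      using resolution_aug_surj_graded[OF H F'] F that by (simp add: graded_free_resolution_def)
    then obtain q where q: "\<And>l. l < rk F 0 \<Longrightarrow> q l \<in> graded_tuples homog (degs F' 0) (degs F 0 ! l)"
      "\<And>l. l < rk F 0 \<Longrightarrow> res_aug nmult F' (q l) = aug F l"
      by metis
    have row: "aug_row nmult F' (\<lambda>k l. q l k) l = aug F l" if "l < rk F 0" for l
      using q(2)[OF that] by (simp add: aug_row_def res_aug_def)
    have "aug_row nmult F' (mat_prod (rk F 0) (\<lambda>k l. q l k) (mat F 0)) l = 0"
      if "l < rk F (Suc 0)" for l
    proof -
      have "aug_row nmult F' (mat_prod (rk F 0) (\<lambda>k l. q l k) (mat F 0)) l
          = aug_row nmult F (mat F 0) l"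
        unfolding aug_row_prod[OF mod] using row by (simp add: aug_row_def[of _ F])
      also have "\<dots> = 0"
        using differential_cycle[OF H F, of 0] that by (simp add: cycle_matrix_def)
      finally show ?thesis .
    qed
    then show "\<exists>f. ?P 0 f"
      using q(1) row
      by (intro exI[of _ "\<lambda>k l. q l k"]) (auto simp: homog_matrix_def graded_tuples_def cycle_matrix_def)
  next
    fix f i
    assume f: "?P i f"
    have "homog_matrix (0 + 0) (degs F' i) (degs F (Suc i)) (mat_prod (rk F i) f (mat F i))"
      using f resolution_homog_matrix[OF F] by (intro homog_matrix_prod) auto
    then obtain g where g: "homog_matrix 0 (degs F' (Suc i)) (degs F (Suc i)) g" "?Q i f g"
      using lift_matrix[OF F', of 0 i "degs F (Suc i)"] f by auto
    have "mat_eq (rk F' i) (rk F (Suc (Suc i)))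
        (mat_prod (rk F (Suc i)) (mat_prod (rk F' (Suc i)) (mat F' i) g) (mat F (Suc i)))
        (mat_prod (rk F (Suc i)) (mat_prod (rk F i) f (mat F i)) (mat F (Suc i)))"
      using g(2) by (intro mat_eq_prod mat_eq_refl)
    also have "mat_prod (rk F (Suc i)) (mat_prod (rk F i) f (mat F i)) (mat F (Suc i))
        = mat_prod (rk F i) f (mat_prod (rk F (Suc i)) (mat F i) (mat F (Suc i)))"
      by (rule mat_prod_assoc)
    also have "mat_eq (rk F' i) (rk F (Suc (Suc i))) \<dots> (mat_prod (rk F i) f 0)"
      using resolution_complex[OF H F] by (intro mat_eq_prod mat_eq_refl) (simp add: free_complex_def)
    finally have "cycle_matrix nmult F' (Suc i) (rk F (Suc (Suc i))) (mat_prod (rk F (Suc i)) g (mat F (Suc i)))"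
      by (simp add: cycle_matrix_def mat_prod_assoc mat_prod_zero_right)
    then show "\<exists>g. ?P (Suc i) g \<and> ?Q i f g"
      using g by auto
  qed
  then obtain f where "\<And>i. ?P i (f i) \<and> ?Q i (f i) (f (Suc i))"
    by blast
  then show ?thesis
    by (intro exI[of _ f]) (auto simp: chain_map_def)
qed

text \<open>
A chain map that induces zero on the resolved module is null-homotopic: \<open>h\<^sub>i\<^sub>+\<^sub>1\<close> is a lift of
\<open>f\<^sub>i\<^sub>+\<^sub>1 - h\<^sub>i \<circ> \<partial>\<close>, which takes values in cycles as soon as \<open>\<partial> \<circ> h\<^sub>i \<circ> \<partial> = f\<^sub>i \<circ> \<partial>\<close>. The degree \<open>d\<close> is kept
general: degree 0 serves the comparison of resolutions, and positive degree the action of the maximal ideal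
on \<open>Tor\<close>.
\<close>

lemma null_homotopy:
  assumes H: "graded_module nmult H"
    and F: "graded_free_resolution nmult H F" and F': "graded_free_resolution nmult H F'"
    and f: "chain_map d F F' f" "\<And>l. l < rk F 0 \<Longrightarrow> aug_row nmult F' (f 0) l = 0"
  shows "\<exists>h. (\<forall>i. homog_matrix d (degs F' (Suc i)) (degs F i) (h i)) \<and>
     mat_eq (rk F' 0) (rk F 0) (mat_prod (rk F' (Suc 0)) (mat F' 0) (h 0)) (f 0) \<and>
     (\<forall>i. mat_eq (rk F' (Suc i)) (rk F (Suc i))
        (mat_prod (rk F' (Suc (Suc i))) (mat F' (Suc i)) (h (Suc i)))
        (f (Suc i) - mat_prod (rk F i) (h i) (mat F i)))"
proof -
  let ?P = "\<lambda>i h. homog_matrix d (degs F' (Suc i)) (degs F i) h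
      \<and> mat_eq (rk F' i) (rk F (Suc i))
          (mat_prod (rk F i) (mat_prod (rk F' (Suc i)) (mat F' i) h) (mat F i))
          (mat_prod (rk F i) (f i) (mat F i))
      \<and> (i = 0 \<longrightarrow> mat_eq (rk F' 0) (rk F 0) (mat_prod (rk F' (Suc 0)) (mat F' 0) h) (f 0))"
  let ?Q = "\<lambda>i h g. mat_eq (rk F' (Suc i)) (rk F (Suc i))
      (mat_prod (rk F' (Suc (Suc i))) (mat F' (Suc i)) g) (f (Suc i) - mat_prod (rk F i) h (mat F i))"
  have f_homog: "homog_matrix d (degs F' i) (degs F i) (f i)" for i
    using f(1) by (simp add: chain_map_def)
  have "\<exists>h. \<forall>i. ?P i (h i) \<and> ?Q i (h i) (h (Suc i))"
  proof (rule dependent_nat_choice)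
    have "cycle_matrix nmult F' 0 (rk F 0) (f 0)"
      using f(2) by (simp add: cycle_matrix_def)
    from lift_matrix[OF F' f_homog this] obtain h
      where h: "homog_matrix d (degs F' (Suc 0)) (degs F 0) h"
        "mat_eq (rk F' 0) (rk F 0) (mat_prod (rk F' (Suc 0)) (mat F' 0) h) (f 0)"
      by blast
    then show "\<exists>h. ?P 0 h"
      by (intro exI[of _ h]) (simp add: mat_eq_prod mat_eq_refl)
  next
    fix h i
    assume h: "?P i h"
    let ?g = "f (Suc i) - mat_prod (rk F i) h (mat F i)"
    have "homog_matrix (d + 0) (degs F' (Suc i)) (degs F (Suc i)) (mat_prod (rk F i) h (mat F i))"
      using h resolution_homog_matrix[OF F] by (intro homog_matrix_prod) auto
    then have g_homog: "homog_matrix d (degs F' (Suc i)) (degs F (Suc i)) ?g"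
      using f_homog by (intro homog_matrix_diff) auto
    have "mat_eq (rk F' i) (rk F (Suc i)) (mat_prod (rk F' (Suc i)) (mat F' i) (f (Suc i)))
        (mat_prod (rk F i) (f i) (mat F i))"
      using f(1) by (simp add: chain_map_def)
    moreover have "mat_eq (rk F' i) (rk F (Suc i))
        (mat_prod (rk F' (Suc i)) (mat F' i) (mat_prod (rk F i) h (mat F i)))
        (mat_prod (rk F i) (f i) (mat F i))"
      using h by (simp add: mat_prod_assoc)
    ultimately have "cycle_matrix nmult F' (Suc i) (rk F (Suc i)) ?g"
      by (simp add: cycle_matrix_def mat_prod_diff_right mat_eq_def)
    from lift_matrix[OF F' g_homog this] obtain k
      where k: "homog_matrix d (degs F' (Suc (Suc i))) (degs F (Suc i)) k" "?Q i h k"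
      by blast
    have "mat_eq (rk F' (Suc i)) (rk F (Suc (Suc i)))
        (mat_prod (rk F (Suc i)) (mat_prod (rk F' (Suc (Suc i))) (mat F' (Suc i)) k) (mat F (Suc i)))
        (mat_prod (rk F (Suc i)) ?g (mat F (Suc i)))"
      using k(2) by (intro mat_eq_prod mat_eq_refl)
    also have "mat_prod (rk F (Suc i)) ?g (mat F (Suc i)) = mat_prod (rk F (Suc i)) (f (Suc i)) (mat F (Suc i))
        - mat_prod (rk F i) h (mat_prod (rk F (Suc i)) (mat F i) (mat F (Suc i)))"
      by (simp add: mat_prod_diff_left mat_prod_assoc)
    also have "mat_eq (rk F' (Suc i)) (rk F (Suc (Suc i))) \<dots>
        (mat_prod (rk F (Suc i)) (f (Suc i)) (mat F (Suc i)) - mat_prod (rk F i) h 0)"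
      using resolution_complex[OF H F] by (intro mat_eq_diff mat_eq_prod mat_eq_refl) (simp add: free_complex_def)
    finally show "\<exists>k. ?P (Suc i) k \<and> ?Q i h k"
      using k by (intro exI[of _ k]) (simp add: mat_prod_zero_right)
  qed
  then obtain h where "\<And>i. ?P i (h i) \<and> ?Q i (h i) (h (Suc i))"
    by blast
  then show ?thesis
    by (intro exI[of _ h]) auto
qed

section \<open>Tor of subquotients\<close>

text \<open>
For graded families \<open>B \<subseteq> A\<close>, a representative of a cycle of degree \<open>j\<close> in \<open>F\<^sub>i \<otimes> A/B\<close>.
\<close>

definition tor_cycle ::
  "('r \<Rightarrow> 'm::ab_group_add \<Rightarrow> 'm) \<Rightarrow> ('r, 'n) free_res \<Rightarrow> (int \<Rightarrow> 'm set) \<Rightarrow> (int \<Rightarrow> 'm set)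
     \<Rightarrow> nat \<Rightarrow> int \<Rightarrow> (nat \<Rightarrow> 'm) \<Rightarrow> bool" where
  "tor_cycle smult F A B i j u \<longleftrightarrow> u \<in> graded_tuples A (degs F i) j \<and>
     (\<forall>i'. i = Suc i' \<longrightarrow> res_diff smult F i' u \<in> graded_tuples B (degs F i') j)"

definition tor_vanishes ::
  "('r \<Rightarrow> 'm::ab_group_add \<Rightarrow> 'm) \<Rightarrow> ('r, 'n) free_res \<Rightarrow> (int \<Rightarrow> 'm set) \<Rightarrow> (int \<Rightarrow> 'm set)
     \<Rightarrow> nat \<Rightarrow> int \<Rightarrow> bool" where
  "tor_vanishes smult F A B i j \<longleftrightarrow> (\<forall>u. tor_cycle smult F A B i j u \<longrightarrow>
     (\<exists>v\<in>graded_tuples A (degs F (Suc i)) j. u - res_diff smult F i v \<in> graded_tuples B (degs F i) j))"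

text \<open>
The homotopy \<open>f = \<partial> \<circ> h + h \<circ> \<partial>\<close> is an identity of matrices, so it holds on tuples over any module; on a
cycle modulo \<open>B\<close> the term \<open>h \<circ> \<partial>\<close> takes values in \<open>B\<close>.
\<close>

lemma null_homotopic_boundary:
  assumes H: "graded_module nmult H"
    and F: "graded_free_resolution nmult H F" and F': "graded_free_resolution nmult H F'"
    and f: "chain_map d F F' f" "\<And>l. l < rk F 0 \<Longrightarrow> aug_row nmult F' (f 0) l = 0"
    and M: "module smult" "graded_family smult A" "graded_family smult B"
    and u: "tor_cycle smult F A B i j u"
  shows "\<exists>v\<in>graded_tuples A (degs F' (Suc i)) (j + d).
    mat_act smult (rk F' i) (rk F i) (f i) u - res_diff smult F' i v \<in> graded_tuples B (degs F' i) (j + d)"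
proof -
  obtain h where h: "\<And>i. homog_matrix d (degs F' (Suc i)) (degs F i) (h i)"
    and h0: "mat_eq (rk F' 0) (rk F 0) (mat_prod (rk F' (Suc 0)) (mat F' 0) (h 0)) (f 0)"
    and hS: "\<And>i. mat_eq (rk F' (Suc i)) (rk F (Suc i))
        (mat_prod (rk F' (Suc (Suc i))) (mat F' (Suc i)) (h (Suc i)))
        (f (Suc i) - mat_prod (rk F i) (h i) (mat F i))"
    using null_homotopy[OF H F F' f] by blast
  let ?v = "mat_act smult (rk F' (Suc i)) (rk F i) (h i) u"
  have v: "?v \<in> graded_tuples A (degs F' (Suc i)) (j + d)"
    using u by (intro mat_act_graded[OF M(2) h]) (simp add: tor_cycle_def)
  have Dv: "res_diff smult F' i ?v
      = mat_act smult (rk F' i) (rk F i) (mat_prod (rk F' (Suc i)) (mat F' i) (h i)) u"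
    by (simp add: res_diff_mat_act mat_act_mat_act[OF M(1)])
  have "mat_act smult (rk F' i) (rk F i) (f i) u - res_diff smult F' i ?v \<in> graded_tuples B (degs F' i) (j + d)"
  proof (cases i)
    case 0
    then show ?thesis
      unfolding Dv using mat_act_cong[OF h0, of smult u] tuples_zero[OF M(3)] by simp
  next
    case (Suc i')
    have "res_diff smult F' i ?v = mat_act smult (rk F' i) (rk F i) (f i) u
        - mat_act smult (rk F' i) (rk F i') (h i') (res_diff smult F i' u)"
      unfolding Dv using Suc mat_act_cong[OF hS[of i'], of smult u]
      by (simp add: mat_act_matrix_diff[OF M(1)] res_diff_mat_act mat_act_mat_act[OF M(1)])
    moreover have "mat_act smult (rk F' i) (rk F i') (h i') (res_diff smult F i' u)
        \<in> graded_tuples B (degs F' i) (j + d)"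
      using u Suc h[of i'] by (intro mat_act_graded[OF M(3)]) (auto simp: tor_cycle_def)
    ultimately show ?thesis
      by simp
  qed
  with v show ?thesis by blast
qed

lemma chain_map_cycle:
  assumes f: "chain_map d F F' f"
    and M: "module smult" "graded_family smult A" "graded_family smult B"
    and u: "tor_cycle smult F A B i j u"
  shows "tor_cycle smult F' A B i (j + d) (mat_act smult (rk F' i) (rk F i) (f i) u)"
  unfolding tor_cycle_def
proof (intro conjI allI impI)
  have h: "homog_matrix d (degs F' i) (degs F i) (f i)" for i
    using f by (simp add: chain_map_def)
  show "mat_act smult (rk F' i) (rk F i) (f i) u \<in> graded_tuples A (degs F' i) (j + d)"
    using u by (intro mat_act_graded[OF M(2) h]) (simp add: tor_cycle_def)
  fix i'
  assume i: "i = Suc i'"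
  have "mat_act smult (rk F' i') (rk F' i) (mat F' i') (mat_act smult (rk F' i) (rk F i) (f i) u)
      = mat_act smult (rk F' i') (rk F i) (mat_prod (rk F i') (f i') (mat F i')) u"
    unfolding mat_act_mat_act[OF M(1)] by (rule mat_act_cong) (use f i in \<open>simp add: chain_map_def\<close>)
  also have "\<dots> = mat_act smult (rk F' i') (rk F i') (f i') (res_diff smult F i' u)"
    by (simp add: res_diff_mat_act mat_act_mat_act[OF M(1)] i)
  also have "\<dots> \<in> graded_tuples B (degs F' i') (j + d)"
    using u i by (intro mat_act_graded[OF M(3) h]) (simp add: tor_cycle_def)
  finally show "res_diff smult F' i' (mat_act smult (rk F' i) (rk F i) (f i) u)
      \<in> graded_tuples B (degs F' i') (j + d)"
    by (simp add: res_diff_mat_act i)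
qed

text \<open>
Let \<open>f\<close> and \<open>g\<close> lift the identity between the two resolutions in either direction. For a cycle \<open>u\<close>, its image
\<open>f u\<close> is a boundary by hypothesis, hence so is \<open>g (f u)\<close>, and \<open>g \<circ> f - id\<close> is null-homotopic.
\<close>

lemma tor_vanishes_independent:
  assumes H: "graded_module nmult H"
    and F: "graded_free_resolution nmult H F" and F': "graded_free_resolution nmult H F'"
    and M: "module smult" "graded_family smult A" "graded_family smult B"
    and van: "tor_vanishes smult F' A B i j"
  shows "tor_vanishes smult F A B i j"
  unfolding tor_vanishes_def
proof (intro allI impI)
  fix u
  assume u: "tor_cycle smult F A B i j u"
  have N: "module nmult" using H by (simp add: graded_module_def)
  obtain f where f: "chain_map 0 F F' f" "\<And>l. l < rk F 0 \<Longrightarrow> aug_row nmult F' (f 0) l = aug F l"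
    using comparison_chain_map[OF H F F'] by blast
  obtain g where g: "chain_map 0 F' F g" "\<And>l. l < rk F' 0 \<Longrightarrow> aug_row nmult F (g 0) l = aug F' l"
    using comparison_chain_map[OF H F' F] by blast
  let ?one = "\<lambda>k l. if k = l then 1 else 0 :: 'r"
  let ?gf = "\<lambda>i. mat_prod (rk F' i) (g i) (f i) - ?one"
  have one_right: "mat_eq a b (mat_prod b P ?one) P" for a b P
    by (auto simp: mat_eq_def mat_prod_def if_distrib[of "\<lambda>c. _ * c"] cong: if_cong)
  have one_left: "mat_eq a b (mat_prod a ?one P) P" for a b P
    by (auto simp: mat_eq_def mat_prod_def if_distrib[of "\<lambda>c. c * _"] cong: if_cong)
  \<comment> \<open>The chain map \<open>g \<circ> f - id\<close> induces zero on the resolved module.\<close>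
  have gf: "chain_map 0 F F ?gf"
    unfolding chain_map_def
  proof (intro conjI allI)
    fix i
    have "homog_matrix (0 + 0) (degs F i) (degs F i) (mat_prod (rk F' i) (g i) (f i))"
      using f(1) g(1) by (intro homog_matrix_prod) (auto simp: chain_map_def)
    moreover have "homog_matrix 0 (degs F i) (degs F i) ?one"
      by (auto simp: homog_matrix_def one_homog zero_in_homog)
    ultimately show "homog_matrix 0 (degs F i) (degs F i) (?gf i)"
      using homog_matrix_diff by auto
    have "mat_eq (rk F i) (rk F (Suc i))
        (mat_prod (rk F' (Suc i)) (mat_prod (rk F (Suc i)) (mat F i) (g (Suc i))) (f (Suc i)))
        (mat_prod (rk F' (Suc i)) (mat_prod (rk F' i) (g i) (mat F' i)) (f (Suc i)))"
      using g(1) by (intro mat_eq_prod mat_eq_refl) (simp add: chain_map_def)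
    also have "mat_prod (rk F' (Suc i)) (mat_prod (rk F' i) (g i) (mat F' i)) (f (Suc i))
        = mat_prod (rk F' i) (g i) (mat_prod (rk F' (Suc i)) (mat F' i) (f (Suc i)))"
      by (rule mat_prod_assoc)
    also have "mat_eq (rk F i) (rk F (Suc i)) \<dots>
        (mat_prod (rk F' i) (g i) (mat_prod (rk F i) (f i) (mat F i)))"
      using f(1) by (intro mat_eq_prod mat_eq_refl) (simp add: chain_map_def)
    finally have 1: "mat_eq (rk F i) (rk F (Suc i))
        (mat_prod (rk F (Suc i)) (mat F i) (mat_prod (rk F' (Suc i)) (g (Suc i)) (f (Suc i))))
        (mat_prod (rk F i) (mat_prod (rk F' i) (g i) (f i)) (mat F i))"
      by (simp add: mat_prod_assoc)
    have "mat_eq (rk F i) (rk F (Suc i)) (mat_prod (rk F (Suc i)) (mat F i) ?one)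
        (mat_prod (rk F i) ?one (mat F i))"
      using mat_eq_trans[OF one_right mat_eq_sym[OF one_left]] .
    with 1 show "mat_eq (rk F i) (rk F (Suc i)) (mat_prod (rk F (Suc i)) (mat F i) (?gf (Suc i)))
        (mat_prod (rk F i) (?gf i) (mat F i))"
      unfolding mat_prod_diff_left mat_prod_diff_right by (rule mat_eq_diff)
  qed
  interpret N: module nmult by (rule N)
  have "aug_row nmult F (?gf 0) l = 0" if l: "l < rk F 0" for l
  proof -
    have 1: "aug_row nmult F (?gf 0) l
        = aug_row nmult F (mat_prod (rk F' 0) (g 0) (f 0)) l - aug_row nmult F ?one l"
      by (simp add: aug_row_def N.scale_left_diff_distrib sum_subtractf)
    have 2: "aug_row nmult F ?one l = aug F l"
      using l by (simp add: aug_row_def if_distrib[of "\<lambda>c. nmult c _"] cong: if_cong)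
    have 3: "aug_row nmult F (mat_prod (rk F' 0) (g 0) (f 0)) l = aug_row nmult F' (f 0) l"
      unfolding aug_row_prod[OF N] using g(2) by (simp add: aug_row_def[of _ F'])
    show ?thesis
      unfolding 1 2 3 using f(2)[OF l] by simp
  qed
  from null_homotopic_boundary[OF H F F gf this M u, unfolded add_0_right] obtain v
    where v: "v \<in> graded_tuples A (degs F (Suc i)) j"
      "mat_act smult (rk F i) (rk F i) (?gf i) u - res_diff smult F i v \<in> graded_tuples B (degs F i) j"
    by blast
  let ?fu = "mat_act smult (rk F' i) (rk F i) (f i) u"
  have "tor_cycle smult F' A B i j ?fu"
    using chain_map_cycle[OF f(1) M u] by simp
  then obtain w where w: "w \<in> graded_tuples A (degs F' (Suc i)) j"
      "?fu - res_diff smult F' i w \<in> graded_tuples B (degs F' i) j"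
    using van by (auto simp: tor_vanishes_def)
  let ?gw = "mat_act smult (rk F (Suc i)) (rk F' (Suc i)) (g (Suc i)) w"
  have ghomog: "homog_matrix 0 (degs F i) (degs F' i) (g i)" for i
    using g(1) by (simp add: chain_map_def)
  have gw: "?gw \<in> graded_tuples A (degs F (Suc i)) j"
    using mat_act_graded[OF M(2) ghomog w(1)] by simp
  have "mat_act smult (rk F i) (rk F' i) (g i) (?fu - res_diff smult F' i w) \<in> graded_tuples B (degs F i) j"
    using mat_act_graded[OF M(3) ghomog w(2)] by simp
  moreover have "mat_act smult (rk F i) (rk F' i) (g i) (res_diff smult F' i w) = res_diff smult F i ?gw"
    unfolding res_diff_mat_act mat_act_mat_act[OF M(1)]
    by (rule mat_act_cong) (use g(1) in \<open>simp add: chain_map_def mat_eq_def\<close>)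
  ultimately have B1: "mat_act smult (rk F i) (rk F' i) (g i) ?fu - res_diff smult F i ?gw
      \<in> graded_tuples B (degs F i) j"
    by (simp add: mat_act_diff[OF M(1)])
  interpret M: module smult by (rule M(1))
  have "u k = 0" if "k \<ge> rk F i" for k
    using u that by (simp add: tor_cycle_def graded_tuples_def free_tuples_def)
  then have "mat_act smult (rk F i) (rk F i) ?one u = u"
    by (auto simp: mat_act_def fun_eq_iff if_distrib[of "\<lambda>c. smult c _"] cong: if_cong)
  then have B2: "mat_act smult (rk F i) (rk F' i) (g i) ?fu - u - res_diff smult F i v
      \<in> graded_tuples B (degs F i) j"
    using v(2) by (simp add: mat_act_matrix_diff[OF M(1)] mat_act_mat_act[OF M(1)])
  have "u - res_diff smult F i (?gw - v) \<in> graded_tuples B (degs F i) j"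
    using tuples_diff[OF M(3) B1 B2]
    by (simp add: res_diff_mat_act mat_act_diff[OF M(1)] algebra_simps)
  then show "\<exists>v\<in>graded_tuples A (degs F (Suc i)) j.
      u - res_diff smult F i v \<in> graded_tuples B (degs F i) j"
    using tuples_diff[OF M(2) gw v(1)] by blast
qed

section \<open>Mapping cones and the Koszul complex\<close>

lemma sum_split: "(\<Sum>l<p + q. f l) = (\<Sum>l<p. f l) + (\<Sum>l<(q::nat). f (p + l))"
  for f :: "nat \<Rightarrow> 'b::comm_monoid_add"
  by (induction q) (simp_all add: add.assoc)

definition join :: "nat \<Rightarrow> (nat \<Rightarrow> 'b) \<Rightarrow> (nat \<Rightarrow> 'b) \<Rightarrow> nat \<Rightarrow> 'b" where
  "join p u v = (\<lambda>k. if k < p then u k else v (k - p))"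

text \<open>
The mapping cone of multiplication by \<open>x\<close>: its module in degree \<open>i + 1\<close> is \<open>F\<^sub>i\<^sub>+\<^sub>1 \<oplus> F\<^sub>i(-d)\<close>, with the basis of
\<open>F\<^sub>i\<^sub>+\<^sub>1\<close> listed first, and its differential is \<open>(a, b) \<mapsto> (\<partial>a + xb, -\<partial>b)\<close>.
\<close>

definition cone :: "'r \<Rightarrow> int \<Rightarrow> ('r, 'n) free_res \<Rightarrow> ('r, 'n) free_res" where
  "cone x d F = F\<lparr>
     degs := (\<lambda>i. case i of 0 \<Rightarrow> degs F 0 | Suc i' \<Rightarrow> degs F i @ map (\<lambda>a. a + d) (degs F i')),
     mat := (\<lambda>i k l.
       if l < rk F (Suc i) then (if k < rk F i then mat F i k l else 0)
       else if k < rk F i then (if k = l - rk F (Suc i) then x else 0)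
       else case i of 0 \<Rightarrow> 0 | Suc i' \<Rightarrow> - mat F i' (k - rk F i) (l - rk F (Suc i)))\<rparr>"

lemma degs_cone:
  "degs (cone x d F) 0 = degs F 0"
  "degs (cone x d F) (Suc i) = degs F (Suc i) @ map (\<lambda>a. a + d) (degs F i)"
  by (simp_all add: cone_def)

lemma join_free: "v \<in> free_tuples b \<Longrightarrow> join (length a) u v \<in> free_tuples (a @ map f b)"
  by (auto simp: join_def free_tuples_def)

lemma split_free:
  assumes "w \<in> free_tuples (a @ map f b)"
  obtains u v where "u \<in> free_tuples a" "v \<in> free_tuples b" "w = join (length a) u v"
proof
  show "(\<lambda>k. if k < length a then w k else 0) \<in> free_tuples a"
    by (simp add: free_tuples_def)
  show "(\<lambda>k. w (k + length a)) \<in> free_tuples b"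
    using assms by (simp add: free_tuples_def)
  show "w = join (length a) (\<lambda>k. if k < length a then w k else 0) (\<lambda>k. w (k + length a))"
    by (auto simp: join_def fun_eq_iff)
qed

lemma join_eq_0: "u \<in> free_tuples a \<Longrightarrow> join (length a) u v = 0 \<longleftrightarrow> u = 0 \<and> v = 0"
  for u v :: "nat \<Rightarrow> 'b::zero"
proof
  assume "u \<in> free_tuples a" and z: "join (length a) u v = 0"
  have "v k = 0" for k
    using fun_cong[OF z, of "k + length a"] by (simp add: join_def)
  moreover have "u k = 0" for k
    using fun_cong[OF z, of k] \<open>u \<in> free_tuples a\<close> by (cases "k < length a") (auto simp: join_def free_tuples_def)
  ultimately show "u = 0 \<and> v = 0" by (auto simp: fun_eq_iff)
qed (auto simp: join_def fun_eq_iff)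

lemma mat_act_scale:
  assumes "module smult"
  shows "mat_act smult a b P (\<lambda>k. smult x (u k)) = (\<lambda>k. smult x (mat_act smult a b P u k))"
proof -
  interpret module smult by fact
  show ?thesis
    by (auto simp: mat_act_def fun_eq_iff scale_sum_right mult.commute)
qed

text \<open>
The component of the differential in the first summand, common to all degrees of the cone.
\<close>

lemma res_diff_cone_upper:
  assumes "b \<in> free_tuples (degs F i)" "k < rk F i"
  shows "(\<Sum>l<rk F (Suc i) + rk F i. mat (cone x d F) i k l * join (rk F (Suc i)) a b l)
    = res_diff (*) F i a k + x * b k"
proof -
  have "(\<Sum>l<rk F i. (if k = l then x else 0) * b l) = x * b k"
    using assms(2) by (simp add: if_distrib[of "\<lambda>c. c * _"] cong: if_cong)
  moreover have "(\<Sum>l<rk F (Suc i). mat (cone x d F) i k l * join (rk F (Suc i)) a b l)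
      = res_diff (*) F i a k"
    using assms(2) by (auto simp: cone_def join_def res_diff_def intro!: sum.cong)
  moreover have "(\<Sum>l<rk F i. mat (cone x d F) i k (rk F (Suc i) + l) * join (rk F (Suc i)) a b (rk F (Suc i) + l))
      = (\<Sum>l<rk F i. (if k = l then x else 0) * b l)"
    using assms(2) by (intro sum.cong) (auto simp: cone_def join_def)
  ultimately show ?thesis
    unfolding sum_split by simp
qed

lemma res_diff_cone_0:
  assumes "b \<in> free_tuples (degs F 0)"
  shows "res_diff (*) (cone x d F) 0 (join (rk F (Suc 0)) a b) = res_diff (*) F 0 a + (\<lambda>k. x * b k)"
proof (rule ext)
  fix k
  show "res_diff (*) (cone x d F) 0 (join (rk F (Suc 0)) a b) k = (res_diff (*) F 0 a + (\<lambda>k. x * b k)) k"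
  proof (cases "k < rk F 0")
    case True
    have "res_diff (*) (cone x d F) 0 (join (rk F (Suc 0)) a b) k
        = (\<Sum>l<rk F (Suc 0) + rk F 0. mat (cone x d F) 0 k l * join (rk F (Suc 0)) a b l)"
      using True by (simp add: res_diff_def[of _ "cone x d F"] degs_cone)
    also have "\<dots> = res_diff (*) F 0 a k + x * b k"
      by (rule res_diff_cone_upper[OF assms True])
    finally show ?thesis by simp
  next
    case False
    then show ?thesis
      using assms by (simp add: res_diff_def degs_cone free_tuples_def)
  qed
qed

lemma res_diff_cone_Suc:
  assumes "b \<in> free_tuples (degs F (Suc i))"
  shows "res_diff (*) (cone x d F) (Suc i) (join (rk F (Suc (Suc i))) a b)
    = join (rk F (Suc i)) (res_diff (*) F (Suc i) a + (\<lambda>k. x * b k)) (- res_diff (*) F i b)"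
proof (rule ext)
  fix k
  let ?w = "join (rk F (Suc (Suc i))) a b"
  let ?C = "cone x d F"
  have D: "res_diff (*) ?C (Suc i) ?w k
      = (\<Sum>l<rk F (Suc (Suc i)) + rk F (Suc i). mat ?C (Suc i) k l * ?w l)"
    if "k < rk F (Suc i) + rk F i"
    using that by (simp add: res_diff_def degs_cone)
  consider "k < rk F (Suc i)" | "\<not> k < rk F (Suc i)" "k < rk F (Suc i) + rk F i"
    | "\<not> k < rk F (Suc i) + rk F i"
    by linarith
  then show "res_diff (*) ?C (Suc i) ?w k
    = join (rk F (Suc i)) (res_diff (*) F (Suc i) a + (\<lambda>k. x * b k)) (- res_diff (*) F i b) k"
  proof cases
    case 1
    then show ?thesis
      unfolding D[OF trans_less_add1[OF 1]] res_diff_cone_upper[OF assms 1] by (simp add: join_def)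
  next
    case 2
    have "(\<Sum>l<rk F (Suc (Suc i)). mat ?C (Suc i) k l * ?w l) = 0"
      using 2 by (intro sum.neutral) (simp add: cone_def)
    moreover have "(\<Sum>l<rk F (Suc i). mat ?C (Suc i) k (rk F (Suc (Suc i)) + l) * ?w (rk F (Suc (Suc i)) + l))
      = (\<Sum>l<rk F (Suc i). - (mat F i (k - rk F (Suc i)) l * b l))"
      using 2 by (intro sum.cong) (auto simp: cone_def join_def)
    ultimately show ?thesis
      using 2 unfolding D[OF 2(2)] sum_split by (simp add: join_def res_diff_def sum_negf less_diff_conv2)
  next
    case 3
    then show ?thesis
      by (auto simp: res_diff_def degs_cone join_def)
  qed
qed

text \<open>
A graded free resolution of \<open>R/J\<close> with \<open>F\<^sub>0 = R\<close>. Membership in \<open>J\<close> replaces vanishing in \<open>R/J\<close>, so no module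
structure on the quotient is needed.
\<close>

definition cyclic_resolution :: "('r, 'n) free_res \<Rightarrow> 'r set \<Rightarrow> bool" where
  "cyclic_resolution F J \<longleftrightarrow>
     degs F 0 = [0] \<and>
     (\<forall>i. homog_matrix 0 (degs F i) (degs F (Suc i)) (mat F i)) \<and>
     (\<forall>u\<in>free_tuples [0::int].
        u 0 \<in> J \<longleftrightarrow> (\<exists>v\<in>free_tuples (degs F (Suc 0)). res_diff (*) F 0 v = u)) \<and>
     (\<forall>i. \<forall>u\<in>free_tuples (degs F (Suc i)).
        res_diff (*) F i u = 0 \<longleftrightarrow>
        (\<exists>v\<in>free_tuples (degs F (Suc (Suc i))). res_diff (*) F (Suc i) v = u))"

lemma res_diff_free: "res_diff smult F i u \<in> free_tuples (degs F i)"
  by (simp add: res_diff_def free_tuples_def)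

lemma cone_homog:
  assumes F: "\<And>i. homog_matrix 0 (degs F i) (degs F (Suc i)) (mat F i)" and x: "x \<in> homog d"
  shows "homog_matrix 0 (degs (cone x d F) i) (degs (cone x d F) (Suc i)) (mat (cone x d F) i)"
proof (cases i)
  case 0
  then show ?thesis
    using F[of 0] x
    by (auto simp: homog_matrix_def cone_def nth_append zero_in_homog)
next
  case (Suc i')
  have neg: "- mat F i' k l \<in> homog (degs F (Suc i') ! l + d - (degs F i' ! k + d))"
    if "k < rk F i'" "l < rk F (Suc i')" for k l
    using F[of i'] that by (simp add: homog_matrix_def homog_minus)
  show ?thesis
    using F[of i] x neg Suc
    by (auto simp: homog_matrix_def cone_def nth_append zero_in_homog less_diff_conv2)
qed

text \<open>
For a cycle \<open>(a, b)\<close> of the cone, \<open>b\<close> is a cycle of \<open>F\<close>; in the lowest degree this means \<open>b \<in> J\<close> and follows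
from \<open>xb \<in> J\<close>, as \<open>x\<close> is a nonzerodivisor modulo \<open>J\<close>. So \<open>b = \<partial>b'\<close>, and then \<open>a + xb'\<close> is a cycle, say \<open>\<partial>a'\<close>;
thus \<open>(a, b)\<close> is the boundary of \<open>(a', -b')\<close>.
\<close>

lemma cone_resolution:
  assumes F: "cyclic_resolution F J" and x: "x \<in> homog d" and reg: "\<And>r. x * r \<in> J \<Longrightarrow> r \<in> J"
  shows "cyclic_resolution (cone x d F) {s + x * r |s r. s \<in> J}"
proof -
  note add = mat_act_add[OF module_ring] and diff = mat_act_diff[OF module_ring]
    and scale = mat_act_scale[OF module_ring] and zero = mat_act_zero[OF module_ring]
  have F0: "degs F 0 = [0]" and Fh: "\<And>i. homog_matrix 0 (degs F i) (degs F (Suc i)) (mat F i)"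
    using F by (simp_all add: cyclic_resolution_def)
  have ex0: "\<And>u. u \<in> free_tuples (degs F 0) \<Longrightarrow>
      u 0 \<in> J \<longleftrightarrow> (\<exists>v\<in>free_tuples (degs F (Suc 0)). res_diff (*) F 0 v = u)"
    using F by (simp add: cyclic_resolution_def)
  have ex: "\<And>i u. u \<in> free_tuples (degs F (Suc i)) \<Longrightarrow> res_diff (*) F i u = 0 \<longleftrightarrow>
        (\<exists>v\<in>free_tuples (degs F (Suc (Suc i))). res_diff (*) F (Suc i) v = u)"
    using F by (simp add: cyclic_resolution_def)
  let ?C = "cone x d F"
  have neg: "res_diff (*) F i (- u) = - res_diff (*) F i u" for i u
    using diff[of _ _ _ 0 u] zero by (simp add: res_diff_mat_act)
  have free_neg: "- u \<in> free_tuples a" if "u \<in> free_tuples a" for u :: "nat \<Rightarrow> 'r" and a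
    using that by (simp add: free_tuples_def)
  have free_scale: "(\<lambda>k. x * u k) \<in> free_tuples a" if "u \<in> free_tuples a" for u a
    using that by (simp add: free_tuples_def)
  have free_add: "u + v \<in> free_tuples a" if "u \<in> free_tuples a" "v \<in> free_tuples a"
    for u v :: "nat \<Rightarrow> 'r" and a
    using that by (simp add: free_tuples_def)
  have dd: "res_diff (*) F i (res_diff (*) F (Suc i) u) = 0" if "u \<in> free_tuples (degs F (Suc (Suc i)))" for i u
    using ex[of "res_diff (*) F (Suc i) u" i] res_diff_free that by blast
  show ?thesis
    unfolding cyclic_resolution_def
  proof (intro conjI allI ballI)
    show "degs ?C 0 = [0]"
      by (simp add: degs_cone F0)
    show "homog_matrix 0 (degs ?C i) (degs ?C (Suc i)) (mat ?C i)" for i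
      by (rule cone_homog[OF Fh x])
  next
    fix u :: "nat \<Rightarrow> 'r"
    assume u: "u \<in> free_tuples [0::int]"
    show "u 0 \<in> {s + x * r |s r. s \<in> J} \<longleftrightarrow> (\<exists>v\<in>free_tuples (degs ?C (Suc 0)). res_diff (*) ?C 0 v = u)"
    proof
      assume "u 0 \<in> {s + x * r |s r. s \<in> J}"
      then obtain s r where sr: "u 0 = s + x * r" "s \<in> J" by blast
      let ?b = "\<lambda>k. if k = 0 then r else 0"
      have "(\<lambda>k. if k = 0 then s else 0) \<in> free_tuples (degs F 0)"
        by (simp add: F0 free_tuples_def)
      from ex0[OF this] sr(2) obtain a where a: "a \<in> free_tuples (degs F (Suc 0))"
        "res_diff (*) F 0 a = (\<lambda>k. if k = 0 then s else 0)" by auto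
      have b: "?b \<in> free_tuples (degs F 0)"
        by (simp add: F0 free_tuples_def)
      have "res_diff (*) ?C 0 (join (rk F (Suc 0)) a ?b) = u"
        unfolding res_diff_cone_0[OF b] a(2)
        using u sr(1) by (auto simp: fun_eq_iff free_tuples_def)
      moreover have "join (rk F (Suc 0)) a ?b \<in> free_tuples (degs ?C (Suc 0))"
        unfolding degs_cone by (rule join_free[OF b])
      ultimately show "\<exists>v\<in>free_tuples (degs ?C (Suc 0)). res_diff (*) ?C 0 v = u" by blast
    next
      assume "\<exists>v\<in>free_tuples (degs ?C (Suc 0)). res_diff (*) ?C 0 v = u"
      then obtain w where w: "w \<in> free_tuples (degs ?C (Suc 0))" "res_diff (*) ?C 0 w = u" by blast
      from w(1) obtain a b where ab: "a \<in> free_tuples (degs F (Suc 0))" "b \<in> free_tuples (degs F 0)"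
        "w = join (rk F (Suc 0)) a b"
        unfolding degs_cone by (rule split_free)
      have "u 0 = res_diff (*) F 0 a 0 + x * b 0"
        using w(2) res_diff_cone_0[OF ab(2), of x d a] ab(3) by auto
      moreover have "res_diff (*) F 0 a 0 \<in> J"
        using ex0[OF res_diff_free] ab(1) by blast
      ultimately show "u 0 \<in> {s + x * r |s r. s \<in> J}" by blast
    qed
  next
    fix i and w :: "nat \<Rightarrow> 'r"
    assume "w \<in> free_tuples (degs ?C (Suc i))"
    then obtain a b where ab: "a \<in> free_tuples (degs F (Suc i))" "b \<in> free_tuples (degs F i)"
        "w = join (rk F (Suc i)) a b"
      unfolding degs_cone by (rule split_free)
    have ker: "res_diff (*) ?C i (join (rk F (Suc i)) a b) = 0 \<longleftrightarrow>
        res_diff (*) F i a + (\<lambda>k. x * b k) = 0 \<and> (\<forall>i'. i = Suc i' \<longrightarrow> res_diff (*) F i' b = 0)"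
      if ab: "b \<in> free_tuples (degs F i)" for a b
    proof (cases i)
      case 0
      then show ?thesis
        using res_diff_cone_0[of b F x d a] ab by simp
    next
      case (Suc i')
      have "res_diff (*) F i a + (\<lambda>k. x * b k) \<in> free_tuples (degs F i)"
        by (intro free_add free_scale res_diff_free ab)
      from join_eq_0[OF this] show ?thesis
        using res_diff_cone_Suc[of b F i' x d a] ab Suc by simp
    qed
    show "res_diff (*) ?C i w = 0 \<longleftrightarrow>
        (\<exists>v\<in>free_tuples (degs ?C (Suc (Suc i))). res_diff (*) ?C (Suc i) v = w)"
    proof
      assume "res_diff (*) ?C i w = 0"
      then have k1: "res_diff (*) F i a + (\<lambda>k. x * b k) = 0"
        and k2: "\<And>i'. i = Suc i' \<Longrightarrow> res_diff (*) F i' b = 0"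
        using ker[OF ab(2)] ab(3) by auto
      \<comment> \<open>At \<open>i = 0\<close> the nonzerodivisor property puts \<open>b\<close> into \<open>J\<close>; higher up \<open>b\<close> is a cycle outright.\<close>
      have "\<exists>b'\<in>free_tuples (degs F (Suc i)). res_diff (*) F i b' = b"
      proof (cases i)
        case 0
        have "(\<lambda>k. x * b k) = - res_diff (*) F 0 a"
          using k1 0 by (simp add: eq_neg_iff_add_eq_0 add.commute)
        then have "res_diff (*) F 0 (- a) = (\<lambda>k. x * b k)"
          by (simp add: neg)
        then have "x * b 0 \<in> J"
          using ex0[of "\<lambda>k. x * b k"] free_scale ab 0 free_neg by blast
        then show ?thesis
          using reg ex0 ab 0 by blast
      next
        case (Suc i')
        then show ?thesis
          using ex[of b i'] k2 ab by blast
      qed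
      then obtain b' where b': "b' \<in> free_tuples (degs F (Suc i))" "res_diff (*) F i b' = b" by blast
      have "res_diff (*) F i (a + (\<lambda>k. x * b' k)) = 0"
        using k1 b'(2) by (simp add: res_diff_mat_act add scale)
      then obtain a' where a': "a' \<in> free_tuples (degs F (Suc (Suc i)))"
        "res_diff (*) F (Suc i) a' = a + (\<lambda>k. x * b' k)"
        using ex[of "a + (\<lambda>k. x * b' k)" i] free_add free_scale ab b' by blast
      have D: "res_diff (*) ?C (Suc i) (join (rk F (Suc (Suc i))) a' (- b'))
          = join (rk F (Suc i)) (a + (\<lambda>k. x * b' k) + (\<lambda>k. x * (- b') k)) (- (- b))"
        unfolding res_diff_cone_Suc[OF free_neg[OF b'(1)]] by (simp add: a' neg b')
      have "a + (\<lambda>k. x * b' k) + (\<lambda>k. x * (- b') k) = a"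
        by (simp add: fun_eq_iff)
      then have "res_diff (*) ?C (Suc i) (join (rk F (Suc (Suc i))) a' (- b')) = w"
        unfolding D by (simp only: ab minus_minus)
      moreover have "join (rk F (Suc (Suc i))) a' (- b') \<in> free_tuples (degs ?C (Suc (Suc i)))"
        unfolding degs_cone by (rule join_free[OF free_neg[OF b'(1)]])
      ultimately show "\<exists>v\<in>free_tuples (degs ?C (Suc (Suc i))). res_diff (*) ?C (Suc i) v = w" by blast
    next
      assume "\<exists>v\<in>free_tuples (degs ?C (Suc (Suc i))). res_diff (*) ?C (Suc i) v = w"
      then obtain v where v: "v \<in> free_tuples (degs ?C (Suc (Suc i)))" "res_diff (*) ?C (Suc i) v = w"
        by blast
      from v(1) obtain a' b' where ab': "a' \<in> free_tuples (degs F (Suc (Suc i)))"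
          "b' \<in> free_tuples (degs F (Suc i))" "v = join (rk F (Suc (Suc i))) a' b'"
        unfolding degs_cone by (rule split_free)
      let ?a = "res_diff (*) F (Suc i) a' + (\<lambda>k. x * b' k)" and ?b = "- res_diff (*) F i b'"
      have w: "w = join (rk F (Suc i)) ?a ?b"
        using v(2) res_diff_cone_Suc[OF ab'(2), of x d a'] ab'(3) by simp
      have "res_diff (*) F i ?a = (\<lambda>k. x * res_diff (*) F i b' k)"
        using dd[OF ab'(1)] by (simp add: res_diff_mat_act add scale)
      then have "res_diff (*) F i ?a + (\<lambda>k. x * ?b k) = 0"
        by (simp add: fun_eq_iff)
      moreover have "res_diff (*) F i' ?b = 0" if "i = Suc i'" for i'
        using dd[of b' i'] ab'(2) that by (simp add: neg)
      ultimately show "res_diff (*) ?C i w = 0"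
        unfolding w using ker[of ?b ?a] free_neg[OF res_diff_free] by blast
    qed
  qed
qed

lemma ideal_gen_insert: "ideal_gen (insert x S) = {s + x * r |s r. s \<in> ideal_gen S}" for x :: 'r
proof -
  have "y \<in> ideal_gen (insert x S) \<longleftrightarrow> (\<exists>r. y - r * x \<in> ideal_gen S)" for y
    by (rule module.span_breakdown_eq[OF module_ring])
  moreover have "(\<exists>r. y - r * x \<in> ideal_gen S) \<longleftrightarrow> (\<exists>s r. y = s + x * r \<and> s \<in> ideal_gen S)" for y
    by (metis add_diff_cancel_right' diff_add_cancel mult.commute)
  ultimately show ?thesis
    by blast
qed

primrec koszul :: "nat \<Rightarrow> ('r, 'k) free_res" where
  "koszul 0 = \<lparr>degs = (\<lambda>i. if i = 0 then [0] else []), mat = (\<lambda>_ _ _. 0), aug = (\<lambda>_. 1)\<rparr>"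
| "koszul (Suc k) = cone (X k) 1 (koszul k)"

lemma koszul_cyclic_resolution:
  "k \<le> n \<Longrightarrow> cyclic_resolution (koszul k) (ideal_gen (X ` {..<k}))"
proof (induction k)
  case 0
  have "ideal_gen {} = ({0} :: 'r set)"
    by (rule module.span_empty[OF module_ring])
  moreover have "free_tuples [] = {0 :: nat \<Rightarrow> 'r}"
    by (auto simp: free_tuples_def fun_eq_iff)
  moreover have "u 0 = 0 \<longleftrightarrow> u = 0" if "u \<in> free_tuples [0::int]" for u :: "nat \<Rightarrow> 'r"
    using that by (auto simp: free_tuples_def fun_eq_iff) (metis not0_implies_Suc Suc_leI zero_less_Suc One_nat_def)
  ultimately show ?case
    by (auto simp: cyclic_resolution_def homog_matrix_def res_diff_def zero_fun_def)
next
  case (Suc k)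
  then have "cyclic_resolution (cone (X k) 1 (koszul k)) {s + X k * r |s r. s \<in> ideal_gen (X ` {..<k})}"
    by (intro cone_resolution variable_homog) (auto intro: X_regular)
  then show ?case
    by (simp add: lessThan_Suc ideal_gen_insert)
qed

text \<open>
The Koszul complex is linear: all generators of \<open>F\<^sub>i\<close> have degree \<open>i\<close>. The difference \<open>j - i\<close> that measures
regularity is therefore a degree in the module itself.
\<close>

lemma koszul_degs: "a \<in> set (degs (koszul k) i) \<Longrightarrow> a = int i"
proof (induction k arbitrary: i a)
  case 0
  then show ?case by (auto split: if_splits)
next
  case (Suc k)
  then show ?case by (cases i) (fastforce simp: degs_cone)+
qed

lemma koszul_beyond: "k < i \<Longrightarrow> degs (koszul k) i = []"
proof (induction k arbitrary: i)
  case (Suc k)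
  then show ?case by (cases i) (simp_all add: degs_cone)
qed simp

lemma koszul_top: "degs (koszul k) k = [int k]"
  by (induction k) (simp_all add: degs_cone koszul_beyond)

lemma koszul_entries:
  "mat (koszul k) i p q = 0 \<or> (\<exists>l<k. mat (koszul k) i p q = X l \<or> mat (koszul k) i p q = - X l)"
proof (induction k arbitrary: i p q)
  case (Suc k)
  show ?case
  proof (cases "q < rk (koszul k) (Suc i) \<or> \<not> p < rk (koszul k) i")
    case False
    then show ?thesis by (auto simp: cone_def)
  next
    case True
    have IH: "mat (koszul k) i p q = 0 \<or>
      (\<exists>l<Suc k. mat (koszul k) i p q = X l \<or> mat (koszul k) i p q = - X l)" for i p q
      using Suc[of i p q] less_SucI by blast
    have "- mat (koszul k) i p q = 0 \<or>
      (\<exists>l<Suc k. - mat (koszul k) i p q = X l \<or> - mat (koszul k) i p q = - X l)" for i p q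
      using IH[of i p q] by (metis minus_zero minus_minus)
    then show ?thesis
      using True IH by (cases i) (auto simp: cone_def)
  qed
qed simp

lemma koszul_aug: "aug (koszul k) = (\<lambda>_. 1)"
  by (induction k) (simp_all add: cone_def)

text \<open>
The augmentation is the constant coefficient, whose kernel is the ideal of all variables.
\<close>

lemma koszul_resolution: "graded_free_resolution K_scale K_grading (koszul n)"
proof -
  note C = koszul_cyclic_resolution[OF order_refl, unfolded cyclic_resolution_def]
  have deg0: "degs (koszul n) 0 = [0]"
    using C by blast
  have aug: "res_aug K_scale (koszul n) u = const_coeff (u 0)" for u
    by (simp add: res_aug_def deg0 K_scale_def koszul_aug)
  show ?thesis
    unfolding graded_free_resolution_def
  proof (intro conjI allI impI)
    show "mat (koszul n) i k l \<in> homog (degs (koszul n) (Suc i) ! l - degs (koszul n) i ! k)"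
      if "k < rk (koszul n) i" "l < rk (koszul n) (Suc i)" for i k l
    proof -
      have "homog_matrix 0 (degs (koszul n) i) (degs (koszul n) (Suc i)) (mat (koszul n) i)"
        using C by blast
      then show ?thesis
        using that by (simp add: homog_matrix_def)
    qed
    show "aug (koszul n) k \<in> K_grading (degs (koszul n) 0 ! k)" if "k < rk (koszul n) 0" for k
      using that by (simp add: deg0 K_grading_def)
    have "c \<in> res_aug K_scale (koszul n) ` free_tuples (degs (koszul n) 0)" for c
      by (rule image_eqI[of _ _ "\<lambda>k. if k = 0 then emb c else 0"])
        (simp_all add: aug const_coeff_emb deg0 free_tuples_def)
    then show "res_aug K_scale (koszul n) ` free_tuples (degs (koszul n) 0) = UNIV"
      by blast
    have "u \<in> free_tuples (degs (koszul n) 0) \<and> res_aug K_scale (koszul n) u = 0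
        \<longleftrightarrow> u \<in> res_diff (*) (koszul n) 0 ` free_tuples (degs (koszul n) (Suc 0))" for u
    proof (cases "u \<in> free_tuples (degs (koszul n) 0)")
      case True
      then have "u 0 \<in> ideal_gen (X ` {..<n}) \<longleftrightarrow>
          (\<exists>v\<in>free_tuples (degs (koszul n) (Suc 0)). res_diff (*) (koszul n) 0 v = u)"
        using C deg0 by simp
      then show ?thesis
        using True by (auto simp: aug const_coeff_zero_iff)
    next
      case False
      then show ?thesis
        using res_diff_free by blast
    qed
    then show "{u \<in> free_tuples (degs (koszul n) 0). res_aug K_scale (koszul n) u = 0}
        = res_diff (*) (koszul n) 0 ` free_tuples (degs (koszul n) (Suc 0))"
      by blast
    fix i
    have "u \<in> free_tuples (degs (koszul n) (Suc i)) \<and> res_diff (*) (koszul n) i u = 0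
        \<longleftrightarrow> u \<in> res_diff (*) (koszul n) (Suc i) ` free_tuples (degs (koszul n) (Suc (Suc i)))" for u
    proof (cases "u \<in> free_tuples (degs (koszul n) (Suc i))")
      case True
      then have "res_diff (*) (koszul n) i u = 0 \<longleftrightarrow>
          (\<exists>v\<in>free_tuples (degs (koszul n) (Suc (Suc i))). res_diff (*) (koszul n) (Suc i) v = u)"
        using C by blast
      then show ?thesis
        using True by auto
    next
      case False
      then show ?thesis
        using res_diff_free by blast
    qed
    then show "{u \<in> free_tuples (degs (koszul n) (Suc i)). res_diff (*) (koszul n) i u = (\<lambda>_. 0)}
        = res_diff (*) (koszul n) (Suc i) ` free_tuples (degs (koszul n) (Suc (Suc i)))"
      unfolding zero_fun_def[symmetric] by blast
  qed
qed

section \<open>Long exact sequences\<close>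

lemma koszul_complex: "free_complex (koszul n)"
  by (rule resolution_complex[OF graded_module_K koszul_resolution])

lemma family_trivial: "module smult \<Longrightarrow> graded_family smult (\<lambda>_. {0})"
  by (simp add: graded_family_def module.scale_zero_right)

lemma tuples_trivial: "graded_tuples (\<lambda>_. {0}) a j = {0}"
  by (auto simp: graded_tuples_def free_tuples_def fun_eq_iff) (metis not_le)

text \<open>
The segment \<open>Tor\<^sub>i(A/C) \<rightarrow> Tor\<^sub>i(A/B) \<rightarrow> Tor\<^sub>i\<^sub>-\<^sub>1(B/C)\<close> of the long exact sequence of
\<open>0 \<rightarrow> B/C \<rightarrow> A/C \<rightarrow> A/B \<rightarrow> 0\<close>: for a cycle \<open>u\<close> of \<open>A/B\<close>, the cycle \<open>\<partial>u\<close> of \<open>B/C\<close> is a boundary, so \<open>u\<close> may be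
corrected by a tuple in \<open>B\<close> to a cycle of \<open>A/C\<close>.
\<close>

lemma tor_vanishes_quotient:
  assumes F: "free_complex F" and M: "module smult"
    and A: "graded_family smult A" and B: "graded_family smult B" and C: "graded_family smult C"
    and BA: "\<And>j. B j \<subseteq> A j" and CB: "\<And>j. C j \<subseteq> B j"
    and van_AC: "tor_vanishes smult F A C i j"
    and van_BC: "\<And>i'. i = Suc i' \<Longrightarrow> tor_vanishes smult F B C i' j"
  shows "tor_vanishes smult F A B i j"
  unfolding tor_vanishes_def
proof (intro allI impI)
  note diff = mat_act_diff[OF M] and dd = res_diff_res_diff[OF F M]
  note BA' = subsetD[OF tuples_mono[of B A, OF BA]] and CB' = subsetD[OF tuples_mono[of C B, OF CB]]
  fix u
  assume "tor_cycle smult F A B i j u"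
  then have u: "u \<in> graded_tuples A (degs F i) j"
    and Du: "\<And>i'. i = Suc i' \<Longrightarrow> res_diff smult F i' u \<in> graded_tuples B (degs F i') j"
    by (auto simp: tor_cycle_def)
  \<comment> \<open>The correction of \<open>u\<close> to a cycle of \<open>A/C\<close>; at \<open>i = 0\<close> every tuple is a cycle.\<close>
  have "\<exists>v\<in>graded_tuples B (degs F i) j. tor_cycle smult F A C i j (u - v)"
  proof (cases i)
    case 0
    then show ?thesis
      using u by (intro bexI[OF _ tuples_zero[OF B]]) (simp add: tor_cycle_def)
  next
    case (Suc i')
    have "tor_cycle smult F B C i' j (res_diff smult F i' u)"
      unfolding tor_cycle_def using Du[OF Suc] Suc dd tuples_zero[OF C] by auto
    then obtain v where v: "v \<in> graded_tuples B (degs F i) j"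
      "res_diff smult F i' u - res_diff smult F i' v \<in> graded_tuples C (degs F i') j"
      using van_BC[OF Suc] Suc by (auto simp: tor_vanishes_def)
    have "u - v \<in> graded_tuples A (degs F i) j"
      by (rule tuples_diff[OF A u BA'[OF v(1)]])
    with v Suc show ?thesis
      by (intro bexI[OF _ v(1)]) (auto simp: tor_cycle_def res_diff_mat_act diff)
  qed
  then obtain v w where v: "v \<in> graded_tuples B (degs F i) j"
    and w: "w \<in> graded_tuples A (degs F (Suc i)) j" "u - v - res_diff smult F i w \<in> graded_tuples C (degs F i) j"
    using van_AC unfolding tor_vanishes_def by blast
  have "u - v - res_diff smult F i w + v \<in> graded_tuples B (degs F i) j"
    by (intro tuples_add[OF B] CB' w v)
  then have "u - res_diff smult F i w \<in> graded_tuples B (degs F i) j"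
    by (simp add: algebra_simps)
  with w(1) show "\<exists>v\<in>graded_tuples A (degs F (Suc i)) j. u - res_diff smult F i v \<in> graded_tuples B (degs F i) j"
    by blast
qed

text \<open>
The segment \<open>Tor\<^sub>i\<^sub>+\<^sub>1(A/B) \<rightarrow> Tor\<^sub>i(B/C) \<rightarrow> Tor\<^sub>i(A/C)\<close> of the same sequence: a cycle of \<open>B/C\<close> is \<open>\<partial>v\<close> modulo \<open>C\<close>
with \<open>v\<close> in \<open>A\<close>, and \<open>v\<close> is a cycle of \<open>A/B\<close>, which differs from a boundary by a tuple in \<open>B\<close>.
\<close>

lemma tor_vanishes_sub:
  assumes F: "free_complex F" and M: "module smult"
    and A: "graded_family smult A" and B: "graded_family smult B"
    and BA: "\<And>j. B j \<subseteq> A j" and CB: "\<And>j. C j \<subseteq> B j"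
    and van_AC: "tor_vanishes smult F A C i j" and van_AB: "tor_vanishes smult F A B (Suc i) j"
  shows "tor_vanishes smult F B C i j"
  unfolding tor_vanishes_def
proof (intro allI impI)
  note diff = mat_act_diff[OF M] and dd = res_diff_res_diff[OF F M]
  note BA' = subsetD[OF tuples_mono[of B A, OF BA]] and CB' = subsetD[OF tuples_mono[of C B, OF CB]]
  fix u
  assume u: "tor_cycle smult F B C i j u"
  then have uB: "u \<in> graded_tuples B (degs F i) j" and "tor_cycle smult F A C i j u"
    using BA' by (auto simp: tor_cycle_def)
  then obtain v where v: "v \<in> graded_tuples A (degs F (Suc i)) j"
    "u - res_diff smult F i v \<in> graded_tuples C (degs F i) j"
    using van_AC unfolding tor_vanishes_def by blast
  have "u - (u - res_diff smult F i v) \<in> graded_tuples B (degs F i) j"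
    by (rule tuples_diff[OF B uB CB'[OF v(2)]])
  then have "tor_cycle smult F A B (Suc i) j v"
    using v(1) by (simp add: tor_cycle_def)
  then obtain w where w: "w \<in> graded_tuples A (degs F (Suc (Suc i))) j"
    "v - res_diff smult F (Suc i) w \<in> graded_tuples B (degs F (Suc i)) j"
    using van_AB unfolding tor_vanishes_def by blast
  have "res_diff smult F i (v - res_diff smult F (Suc i) w) = res_diff smult F i v"
    using dd[of i w] by (simp add: res_diff_mat_act diff)
  then show "\<exists>v\<in>graded_tuples B (degs F (Suc i)) j. u - res_diff smult F i v \<in> graded_tuples C (degs F i) j"
    using v(2) w(2) by metis
qed

lemma tuples_image:
  assumes "u \<in> graded_tuples (\<lambda>j. {smult x a + b |a b. a \<in> A (j - d) \<and> b \<in> B j}) e j"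
    and M: "module smult"
  obtains a b where "a \<in> graded_tuples A e (j - d)" "b \<in> graded_tuples B e j"
    "u = (\<lambda>k. smult x (a k)) + b"
proof -
  have "\<forall>k. \<exists>p. k < length e \<longrightarrow> u k = smult x (fst p) + snd p \<and> fst p \<in> A (j - e ! k - d) \<and> snd p \<in> B (j - e ! k)"
    using assms(1) by (fastforce simp: graded_tuples_def)
  then obtain p where p: "\<And>k. k < length e \<Longrightarrow> u k = smult x (fst (p k)) + snd (p k)"
    "\<And>k. k < length e \<Longrightarrow> fst (p k) \<in> A (j - e ! k - d)" "\<And>k. k < length e \<Longrightarrow> snd (p k) \<in> B (j - e ! k)"
    by metis
  show thesis
  proof
    show "(\<lambda>k. if k < length e then fst (p k) else 0) \<in> graded_tuples A e (j - d)"
      using p(2) by (auto simp: graded_tuples_def free_tuples_def algebra_simps)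
    show "(\<lambda>k. if k < length e then snd (p k) else 0) \<in> graded_tuples B e j"
      using p(3) by (auto simp: graded_tuples_def free_tuples_def algebra_simps)
    show "u = (\<lambda>k. smult x (if k < length e then fst (p k) else 0)) + (\<lambda>k. if k < length e then snd (p k) else 0)"
      using p(1) assms(1)
      by (auto simp: fun_eq_iff graded_tuples_def free_tuples_def module.scale_zero_right[OF M])
  qed
qed

text \<open>
Multiplication by \<open>x\<close> is an isomorphism from \<open>A/(B' : x)\<close>, shifted by \<open>d\<close>, onto \<open>(xA + B')/B'\<close>.
\<close>

lemma tor_vanishes_shift:
  assumes F: "free_complex F" and M: "module smult"
    and A: "graded_family smult A" and B': "graded_family smult B'"
    and van: "tor_vanishes smult F A (\<lambda>j. {a \<in> A j. smult x a \<in> B' (j + d)}) i (j - d)"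
  shows "tor_vanishes smult F (\<lambda>j. {smult x a + b |a b. a \<in> A (j - d) \<and> b \<in> B' j}) B' i j"
  unfolding tor_vanishes_def
proof (intro allI impI)
  interpret module smult by (rule M)
  let ?B = "\<lambda>j. {a \<in> A j. smult x a \<in> B' (j + d)}"
  let ?A' = "\<lambda>j. {smult x a + b |a b. a \<in> A (j - d) \<and> b \<in> B' j}"
  have B_iff: "u \<in> graded_tuples ?B e (j - d) \<longleftrightarrow>
      u \<in> graded_tuples A e (j - d) \<and> (\<lambda>k. smult x (u k)) \<in> graded_tuples B' e j" for u e
    by (auto simp: graded_tuples_def free_tuples_def algebra_simps)
  have linear: "res_diff smult F i ((\<lambda>k. smult x (a k)) + b)
      = (\<lambda>k. smult x (res_diff smult F i a k)) + res_diff smult F i b" for i a b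
    by (simp add: res_diff_mat_act mat_act_add[OF M] mat_act_scale[OF M])
  fix u'
  assume u': "tor_cycle smult F ?A' B' i j u'"
  then have "u' \<in> graded_tuples ?A' (degs F i) j"
    by (simp add: tor_cycle_def)
  then obtain u b where u: "u \<in> graded_tuples A (degs F i) (j - d)" and b: "b \<in> graded_tuples B' (degs F i) j"
    and ub: "u' = (\<lambda>k. smult x (u k)) + b"
    by (rule tuples_image[OF _ M])
  have "res_diff smult F i' u \<in> graded_tuples ?B (degs F i') (j - d)" if i: "i = Suc i'" for i'
  proof -
    have "res_diff smult F i' u' \<in> graded_tuples B' (degs F i') j"
      using u' i by (simp add: tor_cycle_def)
    then have "res_diff smult F i' u' - res_diff smult F i' b \<in> graded_tuples B' (degs F i') j"
      by (rule tuples_diff[OF B' _ res_diff_graded[OF F B']]) (use i b in simp)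
    then have "(\<lambda>k. smult x (res_diff smult F i' u k)) \<in> graded_tuples B' (degs F i') j"
      unfolding ub linear by simp
    then show ?thesis
      unfolding B_iff using res_diff_graded[OF F A] u i by blast
  qed
  then have "tor_cycle smult F A ?B i (j - d) u"
    using u by (simp add: tor_cycle_def)
  then obtain v where v: "v \<in> graded_tuples A (degs F (Suc i)) (j - d)"
      "u - res_diff smult F i v \<in> graded_tuples ?B (degs F i) (j - d)"
    using van unfolding tor_vanishes_def by blast
  let ?v = "(\<lambda>k. smult x (v k))"
  have "v k \<in> A (j - degs F (Suc i) ! k - d)" if "k < rk F (Suc i)" for k
    using v(1) that by (auto simp: graded_tuples_def algebra_simps)
  then have "\<exists>a b. smult x (v k) = smult x a + b \<and> a \<in> A (j - degs F (Suc i) ! k - d)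
      \<and> b \<in> B' (j - degs F (Suc i) ! k)" if "k < rk F (Suc i)" for k
    using that by (intro exI[of _ "v k"] exI[of _ 0]) (simp add: family_zero[OF B'])
  then have v': "?v \<in> graded_tuples ?A' (degs F (Suc i)) j"
    using v(1) by (simp add: graded_tuples_def free_tuples_def)
  have "res_diff smult F i ?v = (\<lambda>k. smult x (res_diff smult F i v k))"
    by (simp add: res_diff_mat_act mat_act_scale[OF M])
  then have "u' - res_diff smult F i ?v = (\<lambda>k. smult x ((u - res_diff smult F i v) k)) + b"
    unfolding ub by (auto simp: fun_eq_iff scale_right_diff_distrib)
  also have "\<dots> \<in> graded_tuples B' (degs F i) j"
    using v(2) b unfolding B_iff by (blast intro: tuples_add[OF B'])
  finally show "\<exists>v\<in>graded_tuples ?A' (degs F (Suc i)) j.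
      u' - res_diff smult F i v \<in> graded_tuples B' (degs F i) j"
    using v' by blast
qed

section \<open>Koszul homology in extreme degrees\<close>

text \<open>
Since the Koszul complex is linear, the degree \<open>j\<close> part of \<open>F\<^sub>i \<otimes> A/B\<close> consists of copies of the component of
degree \<open>j - i\<close>.
\<close>

lemma tor_vanishes_concentrated:
  assumes "A (j - int i) \<subseteq> B (j - int i)" "graded_family smult A" "module smult"
  shows "tor_vanishes smult (koszul n) A B i j"
  unfolding tor_vanishes_def
proof (intro allI impI bexI)
  fix u
  assume u: "tor_cycle smult (koszul n) A B i j u"
  have "u k \<in> B (j - degs (koszul n) i ! k)" if "k < rk (koszul n) i" for k
  proof -
    have "u k \<in> A (j - degs (koszul n) i ! k)"
      using u that by (simp add: tor_cycle_def graded_tuples_def)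
    then show ?thesis
      using assms(1) koszul_degs[OF nth_mem[OF that]] by auto
  qed
  then have "u \<in> graded_tuples B (degs (koszul n) i) j"
    using u by (auto simp: tor_cycle_def graded_tuples_def)
  then show "u - res_diff smult (koszul n) i 0 \<in> graded_tuples B (degs (koszul n) i) j"
    using mat_act_zero[OF assms(3)] by (simp add: res_diff_mat_act)
  show "0 \<in> graded_tuples A (degs (koszul n) (Suc i)) j"
    by (rule tuples_zero[OF assms(2)])
qed

text \<open>
An element killed by all variables is a cycle on the last module of the Koszul complex, because the matrix
entries are \<open>0\<close> or variables up to sign, and no boundaries exist there. So such an element survives in
\<open>Tor\<^sub>n\<close>.
\<close>

lemma socle_vanishes:
  assumes M: "module smult" and A: "graded_family smult A" and B: "graded_family smult B"
    and van: "tor_vanishes smult (koszul n) A B n (j + int n)"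
    and u: "u \<in> A j" "\<And>k. k < n \<Longrightarrow> smult (X k) u \<in> B (j + 1)"
  shows "u \<in> B j"
proof -
  interpret module smult by (rule M)
  let ?u = "\<lambda>k. if k = 0 then u else 0"
  have "tor_cycle smult (koszul n) A B n (j + int n) ?u"
    unfolding tor_cycle_def
  proof (intro conjI allI impI)
    show "?u \<in> graded_tuples A (degs (koszul n) n) (j + int n)"
      using u(1) by (simp add: graded_tuples_def free_tuples_def koszul_top)
    fix i
    assume n: "n = Suc i"
    have "smult (mat (koszul n) i k 0) u \<in> B (j + 1)" for k
      using koszul_entries[of n i k 0] u(2) family_zero[OF B] family_minus[OF B]
      by auto
    moreover have "degs (koszul n) i ! k = int i" if "k < rk (koszul n) i" for k
      using koszul_degs[OF nth_mem[OF that]] .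
    moreover have "rk (koszul n) (Suc i) = 1"
      using koszul_top[of n] n by simp
    ultimately show "res_diff smult (koszul n) i ?u \<in> graded_tuples B (degs (koszul n) i) (j + int n)"
      using n by (simp add: graded_tuples_def free_tuples_def res_diff_def algebra_simps)
  qed
  then obtain v where "?u - res_diff smult (koszul n) n v \<in> graded_tuples B (degs (koszul n) n) (j + int n)"
    using van unfolding tor_vanishes_def by blast
  moreover have "res_diff smult (koszul n) n v 0 = 0"
    by (simp add: res_diff_def koszul_beyond)
  ultimately show ?thesis
    by (simp add: graded_tuples_def koszul_top)
qed

section \<open>Vanishing of Tor and regularity\<close>

lemma tor_homology_trivial_iff:
  assumes F: "free_complex F" and M: "module smult" and A: "graded_family smult A"
  shows "tor_homology smult A F i j = {tor_boundaries smult A F i j}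
    \<longleftrightarrow> tor_vanishes smult F A (\<lambda>_. {0}) i j"
proof -
  let ?Z = "tor_cycles smult A F i j" and ?B = "tor_boundaries smult A F i j"
  let ?r = "{(u, v). u \<in> ?Z \<and> v \<in> ?Z \<and> (\<lambda>k. u k - v k) \<in> ?B}"
  note zero = mat_act_zero[OF M]
  have Z: "u \<in> ?Z \<longleftrightarrow> tor_cycle smult F A (\<lambda>_. {0}) i j u" for u
    by (cases i) (auto simp: tor_cycles_def tor_cycle_def tuples_trivial zero_fun_def)
  have van: "tor_vanishes smult F A (\<lambda>_. {0}) i j \<longleftrightarrow> ?Z \<subseteq> ?B"
    unfolding tor_vanishes_def Z[symmetric] tor_boundaries_def tuples_trivial by (auto simp: eq_diff_eq)
  have B0: "0 \<in> ?B"
    using image_eqI[of 0 "res_diff smult F i" 0] tuples_zero[OF A] zero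
    by (simp add: tor_boundaries_def res_diff_mat_act)
  have B_diff: "u - v \<in> ?B" if "u \<in> ?B" "v \<in> ?B" for u v
  proof -
    obtain a b where "u = res_diff smult F i a" "v = res_diff smult F i b"
      "a \<in> graded_tuples A (degs F (Suc i)) j" "b \<in> graded_tuples A (degs F (Suc i)) j"
      using \<open>u \<in> ?B\<close> \<open>v \<in> ?B\<close> by (auto simp: tor_boundaries_def)
    then show ?thesis
      using tuples_diff[OF A]
      by (auto simp: tor_boundaries_def res_diff_mat_act mat_act_diff[OF M, symmetric] simp del: minus_apply)
  qed
  have BZ: "?B \<subseteq> ?Z"
    unfolding tor_boundaries_def Z
    by (auto simp: Z tor_cycle_def res_diff_res_diff[OF F M] tuples_trivial intro: res_diff_graded[OF F A])
  have rel: "(u, v) \<in> ?r \<longleftrightarrow> u \<in> ?Z \<and> v \<in> ?Z \<and> u - v \<in> ?B" for u v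
    by (simp add: fun_diff_def)
  have "?Z // ?r = {?B} \<longleftrightarrow> ?Z \<subseteq> ?B"
  proof
    assume eq: "?Z // ?r = {?B}"
    show "?Z \<subseteq> ?B"
    proof
      fix u
      assume u: "u \<in> ?Z"
      then have "?r `` {u} = ?B"
        using eq quotientI[of u ?Z ?r] by blast
      moreover have "u \<in> ?r `` {u}"
        unfolding Image_singleton_iff rel using u B0 by simp
      ultimately show "u \<in> ?B" by blast
    qed
  next
    assume "?Z \<subseteq> ?B"
    then have ZB: "?Z = ?B"
      using BZ by blast
    have "?r `` {u} = ?B" if u: "u \<in> ?Z" for u
    proof (rule set_eqI)
      fix v
      show "v \<in> ?r `` {u} \<longleftrightarrow> v \<in> ?B"
        unfolding Image_singleton_iff rel using u B_diff[of u v] ZB by metis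
    qed
    then show "?Z // ?r = {?B}"
      unfolding quotient_def using ZB B0 by blast
  qed
  then show ?thesis
    by (simp add: van tor_homology_def)
qed

text \<open>
The Koszul complex shows that a resolution of \<open>K\<close> exists, so the chosen one is a resolution, and it may then be
replaced by the Koszul complex.
\<close>

lemma Tor_nonzero_iff:
  assumes M: "module smult" and A: "graded_family smult A"
  shows "Tor_nonzero smult A K_scale K_grading i j
    \<longleftrightarrow> \<not> tor_vanishes smult (koszul n) A (\<lambda>_. {0}) i j"
proof -
  let ?F = "chosen_resolution K_scale K_grading"
  have F: "graded_free_resolution K_scale K_grading ?F"
    unfolding chosen_resolution_def by (rule someI, rule koszul_resolution)
  note independent = tor_vanishes_independent[OF graded_module_K _ _ M A family_trivial[OF M]]
  show ?thesis
    unfolding Tor_nonzero_def Tor_def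
      tor_homology_trivial_iff[OF resolution_complex[OF graded_module_K F] M A]
    using independent[OF F koszul_resolution] independent[OF koszul_resolution F] by blast
qed

lemma Tor_nonzero_le_reg:
  assumes "Tor_nonzero smult A K_scale K_grading i j"
  shows "ereal (real_of_int (j - int i)) \<le> reg smult A"
proof -
  have "ereal (of_int j) \<le> tor_max_degree smult A i"
    unfolding tor_max_degree_def using assms by (intro Sup_upper) blast
  then have "ereal (of_int j) - ereal (real i) \<le> tor_max_degree smult A i - ereal (real i)"
    by (rule ereal_minus_mono) simp
  also have "\<dots> \<le> reg smult A"
    unfolding reg_def by (rule SUP_upper) simp
  finally show ?thesis by simp
qed

lemma reg_leI:
  assumes "\<And>i j. Tor_nonzero smult A K_scale K_grading i j \<Longrightarrow> ereal (real_of_int (j - int i)) \<le> R"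
  shows "reg smult A \<le> R"
  unfolding reg_def
proof (rule SUP_least)
  fix i
  have "ereal (of_int j) \<le> R + ereal (real i)" if "Tor_nonzero smult A K_scale K_grading i j" for j
  proof -
    have "ereal (real_of_int (j - int i)) + ereal (real i) \<le> R + ereal (real i)"
      using assms[OF that] by (rule add_right_mono)
    then show ?thesis by simp
  qed
  then have "tor_max_degree smult A i \<le> R + ereal (real i)"
    unfolding tor_max_degree_def by (intro Sup_least) blast
  then show "tor_max_degree smult A i - ereal (real i) \<le> R"
    by (simp add: ereal_minus_le)
qed

text \<open>
An upper bound on the regularity of \<open>A/B\<close>. It is an integer, so that chains of estimates stay clear of
infinite values.
\<close>

definition reg_bound ::
  "('r \<Rightarrow> 'm::ab_group_add \<Rightarrow> 'm) \<Rightarrow> (int \<Rightarrow> 'm set) \<Rightarrow> (int \<Rightarrow> 'm set) \<Rightarrow> int \<Rightarrow> bool" where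
  "reg_bound smult A B r \<longleftrightarrow> (\<forall>i j. r < j - int i \<longrightarrow> tor_vanishes smult (koszul n) A B i j)"

text \<open>
Since \<open>j - i\<close> takes integer values, bounding the regularity of \<open>A\<close> by integers suffices. This also covers the
case that \<open>A\<close> has regularity \<open>-\<infinity>\<close>, in which all integers are bounds, and the case \<open>\<infinity>\<close>, in which none is.
\<close>

lemma reg_le_reg_plus:
  assumes M: "module smult" and A: "graded_family smult A" and B: "graded_family smult B"
    and bound: "\<And>r. reg_bound smult A (\<lambda>_. {0}) r \<Longrightarrow> reg_bound smult B (\<lambda>_. {0}) (r + c)"
  shows "reg smult B \<le> reg smult A + ereal (of_int c)"
proof (rule reg_leI, rule ccontr)
  fix i j
  assume B_nz: "Tor_nonzero smult B K_scale K_grading i j"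
    and "\<not> ereal (real_of_int (j - int i)) \<le> reg smult A + ereal (of_int c)"
  then have lt: "reg smult A + ereal (of_int c) < ereal (real_of_int (j - int i))"
    by simp
  have "b - int a \<le> j - int i - c - 1" if "Tor_nonzero smult A K_scale K_grading a b" for a b
  proof -
    have "ereal (real_of_int (b - int a)) + ereal (of_int c) \<le> reg smult A + ereal (of_int c)"
      by (intro add_right_mono Tor_nonzero_le_reg that)
    from this lt have "ereal (real_of_int (b - int a)) + ereal (of_int c) < ereal (real_of_int (j - int i))"
      by (rule le_less_trans)
    then have "real_of_int (b - int a + c) < real_of_int (j - int i)"
      by simp
    then have "b - int a + c < j - int i"
      by (simp only: of_int_less_iff)
    then show ?thesis by simp
  qed
  then have "reg_bound smult A (\<lambda>_. {0}) (j - int i - c - 1)"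
    unfolding reg_bound_def using Tor_nonzero_iff[OF M A] by (meson not_le)
  then have "reg_bound smult B (\<lambda>_. {0}) (j - int i - c - 1 + c)"
    by (rule bound)
  then show False
    using B_nz Tor_nonzero_iff[OF M B] by (simp add: reg_bound_def)
qed

section \<open>Submodules generated by a homogeneous sequence\<close>

lemma ideal_mult_generators:
  assumes "module smult"
  shows "ideal_mult smult (ideal_gen S) = module.span smult {smult s u |s u. s \<in> S}"
proof -
  interpret module smult by fact
  show ?thesis
    unfolding ideal_mult_def
  proof (rule antisym)
    have "smult a u \<in> span {smult s u |s u. s \<in> S}" if "a \<in> ideal_gen S" for a u
      using that
    proof (induction rule: module.span_induct_alt[OF module_ring, consumes 1, case_names base step])
      case base
      then show ?case by (simp add: span_zero)
    next
      case (step c s y)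
      have "smult s u \<in> span {smult s u |s u. s \<in> S}"
        using step(1) by (intro span_base) blast
      then have "smult c (smult s u) + smult y u \<in> span {smult s u |s u. s \<in> S}"
        using step(2) by (intro span_add[OF span_scale])
      then show ?case by (simp add: scale_left_distrib)
    qed
    then show "span {smult a u |a u. a \<in> ideal_gen S} \<subseteq> span {smult s u |s u. s \<in> S}"
      by (intro span_minimal subspace_span) blast
    show "span {smult s u |s u. s \<in> S} \<subseteq> span {smult a u |a u. a \<in> ideal_gen S}"
      using module.span_base[OF module_ring] by (intro span_mono) blast
  qed
qed

lemma ideal_mult_insert:
  assumes "module smult"
  shows "ideal_mult smult (ideal_gen (insert x S))
    = {smult x u + v |u v. v \<in> ideal_mult smult (ideal_gen S)}"
proof -
  interpret module smult by fact
  have gens: "{smult s u |s u. s \<in> insert x S} = range (smult x) \<union> {smult s u |s u. s \<in> S}"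
    by auto
  have "subspace (range (smult x))"
    unfolding subspace_def
  proof (intro conjI ballI allI)
    show "0 \<in> range (smult x)"
      by (rule range_eqI[of _ _ 0]) simp
    show "u + v \<in> range (smult x)" if "u \<in> range (smult x)" "v \<in> range (smult x)" for u v
      using that by (auto simp: scale_right_distrib[symmetric])
    show "smult c u \<in> range (smult x)" if "u \<in> range (smult x)" for c u
    proof -
      obtain w where "u = smult x w" using \<open>u \<in> range (smult x)\<close> by blast
      then have "smult c u = smult x (smult c w)"
        by (simp add: mult.commute)
      then show ?thesis by (metis rangeI)
    qed
  qed
  then have image: "span (range (smult x)) = range (smult x)"
    by (simp add: span_eq_iff)
  show ?thesis
    unfolding ideal_mult_generators[OF assms] gens span_Un image by blast
qed

lemma ideal_mult_empty: "module smult \<Longrightarrow> ideal_mult smult (ideal_gen {}) = {0}"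
  by (simp add: ideal_mult_generators module.span_empty)

lemma ideal_mult_ring: "ideal_mult (*) (ideal_gen S) = ideal_gen S" for S :: "'r set"
proof -
  interpret module "(*) :: 'r \<Rightarrow> 'r \<Rightarrow> 'r" by (rule module_ring)
  have "a * u \<in> span S" if "a \<in> span S" for a u
    using span_scale[OF that, of u] by (simp only: mult.commute)
  then have "span {a * u |a u. a \<in> span S} \<subseteq> span S"
    by (intro span_minimal subspace_span) blast
  moreover have "span S \<subseteq> span {a * u |a u. a \<in> span S}"
  proof
    fix a
    assume "a \<in> span S"
    then have "a * 1 \<in> {a * u |a u. a \<in> span S}" by blast
    then show "a \<in> span {a * u |a u. a \<in> span S}"
      unfolding mult_1_right by (rule span_base)
  qed
  ultimately show ?thesis
    unfolding ideal_mult_def by blast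
qed

lemma component_mult_add:
  assumes "graded_module smult G" "x \<in> homog d"
  shows "component G j (smult x u + v) = smult x (component G (j - d) u) + component G j v"
  by (simp add: component_add[OF assms(1)] component_smult_homog_left[OF assms])

lemma ideal_mult_component:
  assumes G: "graded_module smult G" and "finite S" "\<And>x. x \<in> S \<Longrightarrow> \<exists>d. x \<in> homog d"
    and "u \<in> ideal_mult smult (ideal_gen S)"
  shows "component G j u \<in> ideal_mult smult (ideal_gen S)"
  using assms(2-)
proof (induction S arbitrary: u j rule: finite_induct)
  have M: "module smult" using G by (simp add: graded_module_def)
  case empty
  then show ?case
    by (simp add: ideal_mult_empty[OF M] component_zero[OF G])
next
  have M: "module smult" using G by (simp add: graded_module_def)
  case (insert x S)
  obtain d where d: "x \<in> homog d"
    using insert.prems(1) by blast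
  obtain w v where "u = smult x w + v" "v \<in> ideal_mult smult (ideal_gen S)"
    using insert.prems(2) unfolding ideal_mult_insert[OF M] by blast
  then show ?case
    unfolding ideal_mult_insert[OF M] using component_mult_add[OF G d] insert by blast
qed

text \<open>
The part of degree \<open>j\<close> of \<open>xM + N\<close>: passing to components in a sum \<open>xu + v\<close> makes both summands homogeneous.
\<close>

lemma ideal_mult_insert_graded:
  assumes G: "graded_module smult G" and "finite S" "\<And>x. x \<in> S \<Longrightarrow> \<exists>d. x \<in> homog d"
    and x: "x \<in> homog d"
  shows "ideal_mult smult (ideal_gen (insert x S)) \<inter> G j
    = {smult x a + b |a b. a \<in> G (j - d) \<and> b \<in> ideal_mult smult (ideal_gen S) \<inter> G j}"
proof -
  have M: "module smult" using G by (simp add: graded_module_def)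
  note fam = graded_module_family[OF G]
  show ?thesis
    unfolding ideal_mult_insert[OF M]
  proof (intro set_eqI iffI)
    fix w
    assume w: "w \<in> {smult x u + v |u v. v \<in> ideal_mult smult (ideal_gen S)} \<inter> G j"
    then obtain u v where uv: "w = smult x u + v" "v \<in> ideal_mult smult (ideal_gen S)" by blast
    have "w = component G j w"
      using w component_of_homog[OF G, of w j j] by simp
    also have "\<dots> = smult x (component G (j - d) u) + component G j v"
      unfolding uv(1) by (rule component_mult_add[OF G x])
    finally show "w \<in> {smult x a + b |a b. a \<in> G (j - d) \<and> b \<in> ideal_mult smult (ideal_gen S) \<inter> G j}"
      using component_decomposition(1)[OF G] ideal_mult_component[OF G assms(2,3) uv(2)] by blast
  next
    fix w
    assume "w \<in> {smult x a + b |a b. a \<in> G (j - d) \<and> b \<in> ideal_mult smult (ideal_gen S) \<inter> G j}"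
    then obtain a b where ab: "w = smult x a + b" "a \<in> G (j - d)" "b \<in> ideal_mult smult (ideal_gen S) \<inter> G j"
      by blast
    have "smult x a \<in> G j"
      using family_smult[OF fam x ab(2), of j] by simp
    then have "w \<in> G j"
      using ab family_add[OF fam] by blast
    then show "w \<in> {smult x u + v |u v. v \<in> ideal_mult smult (ideal_gen S)} \<inter> G j"
      using ab by blast
  qed
qed

lemma ideal_mult_family:
  assumes "graded_module smult G"
  shows "graded_family smult (\<lambda>j. ideal_mult smult I \<inter> G j)"
proof -
  interpret module smult using assms by (simp add: graded_module_def)
  show ?thesis
    using graded_module_family[OF assms]
    by (auto simp: graded_family_def ideal_mult_def intro: span_zero span_diff span_scale)
qed

lemma image_family:
  assumes M: "module smult" and A: "graded_family smult A" and B: "graded_family smult B"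
  shows "graded_family smult (\<lambda>j. {smult x a + b |a b. a \<in> A (j - d) \<and> b \<in> B j})"
proof -
  interpret module smult by (rule M)
  show ?thesis
    unfolding graded_family_def
  proof (intro conjI allI ballI)
    fix j
    have "0 = smult x 0 + 0" by simp
    then show "0 \<in> {smult x a + b |a b. a \<in> A (j - d) \<and> b \<in> B j}"
      using family_zero[OF A] family_zero[OF B] by blast
  next
    fix j u v
    assume "u \<in> {smult x a + b |a b. a \<in> A (j - d) \<and> b \<in> B j}"
      and "v \<in> {smult x a + b |a b. a \<in> A (j - d) \<and> b \<in> B j}"
    then obtain a b a' b' where *: "u = smult x a + b" "a \<in> A (j - d)" "b \<in> B j"
      "v = smult x a' + b'" "a' \<in> A (j - d)" "b' \<in> B j"
      by blast
    then have "u - v = smult x (a - a') + (b - b')"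
      by (simp add: scale_right_diff_distrib)
    then show "u - v \<in> {smult x a + b |a b. a \<in> A (j - d) \<and> b \<in> B j}"
      using * family_diff[OF A] family_diff[OF B] by blast
  next
    fix e j r u
    assume r: "r \<in> homog e" and "u \<in> {smult x a + b |a b. a \<in> A (j - d) \<and> b \<in> B j}"
    then obtain a b where *: "u = smult x a + b" "a \<in> A (j - d)" "b \<in> B j"
      by blast
    then have "smult r u = smult x (smult r a) + smult r b"
      by (simp add: scale_right_distrib mult.commute)
    moreover have "smult r a \<in> A (e + j - d)"
      by (rule family_smult[OF A r *(2)]) simp
    moreover have "smult r b \<in> B (e + j)"
      by (rule family_smult[OF B r *(3)]) simp
    ultimately show "smult r u \<in> {smult x a + b |a b. a \<in> A (e + j - d) \<and> b \<in> B (e + j)}"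
      by blast
  qed
qed

section \<open>The upper bound\<close>

text \<open>
Above the regularity of \<open>G/B\<close>, the annihilator of \<open>x\<close> on \<open>G/B\<close> is zero. It is zero in high degrees by almost
regularity. Descending, if it is zero in degree \<open>j + 1\<close>, all variables kill its elements \<open>u\<close> of degree \<open>j\<close>,
and such a \<open>u\<close> is zero by \<open>socle_vanishes\<close>.
\<close>

lemma colon_vanishes_above_reg:
  assumes M: "module smult" and G: "graded_family smult G" and B: "graded_family smult B"
    and almost: "\<And>i u. i0 \<le> i \<Longrightarrow> u \<in> G (i - d) \<Longrightarrow> smult x u \<in> B i \<Longrightarrow> u \<in> B (i - d)"
    and bound: "reg_bound smult G B s"
    and j: "s < j" and u: "u \<in> G j" "smult x u \<in> B (j + d)"
  shows "u \<in> B j"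
proof -
  interpret module smult by (rule M)
  \<comment> \<open>Induction on the distance of \<open>j\<close> from \<open>i0 - d\<close>, where almost regularity takes over.\<close>
  have "u \<in> B j" if "i0 - d - j \<le> int m" "s < j" "u \<in> G j" "smult x u \<in> B (j + d)" for m j u
    using that
  proof (induction m arbitrary: j u)
    case 0
    then show ?case using almost[of "j + d" u] by simp
  next
    case (Suc m)
    show ?case
    proof (rule socle_vanishes[OF M G B])
      show "tor_vanishes smult (koszul n) G B n (j + int n)"
        using bound Suc.prems by (simp add: reg_bound_def)
      show "u \<in> G j" by fact
      fix k
      assume k: "k < n"
      have "smult (X k) (smult x u) \<in> B (j + 1 + d)"
        by (rule family_smult[OF B variable_homog[OF k] Suc.prems(4)]) simp
      then have "smult x (smult (X k) u) \<in> B (j + 1 + d)"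
        by (simp add: mult.commute)
      moreover have "smult (X k) u \<in> G (j + 1)"
        by (rule family_smult[OF G variable_homog[OF k] Suc.prems(3)]) simp
      ultimately show "smult (X k) u \<in> B (j + 1)"
        using Suc.IH[of "j + 1"] Suc.prems by simp
    qed
  qed
  from this[of j "nat (i0 - d - j)" u] show ?thesis
    using j u by simp
qed

text \<open>
Write \<open>P = G/B\<close>. The annihilator of \<open>x\<close> on \<open>P\<close> has regularity at most \<open>s\<close>, hence so has its quotient
\<open>P/(0 : x)\<close>, which is \<open>xP\<close> up to a shift by \<open>d\<close>. So \<open>xP\<close> has regularity at most \<open>s + d\<close>, and passing to \<open>P/xP\<close>
lowers the homological degree by one.
\<close>

lemma reg_bound_almost_regular:
  assumes M: "module smult" and G: "graded_family smult G" and B: "graded_family smult B"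
    and BG: "\<And>j. B j \<subseteq> G j" and x: "x \<in> homog d" and d: "1 \<le> d"
    and almost: "\<And>i u. i0 \<le> i \<Longrightarrow> u \<in> G (i - d) \<Longrightarrow> smult x u \<in> B i \<Longrightarrow> u \<in> B (i - d)"
    and bound: "reg_bound smult G B s"
  shows "reg_bound smult G (\<lambda>j. {smult x a + b |a b. a \<in> G (j - d) \<and> b \<in> B j}) (s + d - 1)"
proof -
  interpret module smult by (rule M)
  let ?A = "\<lambda>j. {a \<in> G j. smult x a \<in> B (j + d)}"
  let ?B' = "\<lambda>j. {smult x a + b |a b. a \<in> G (j - d) \<and> b \<in> B j}"
  have A: "graded_family smult ?A"
    unfolding graded_family_def
  proof (intro conjI allI ballI)
    show "0 \<in> ?A j" for j
      by (simp add: family_zero[OF G] family_zero[OF B])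
    show "u - v \<in> ?A j" if "u \<in> ?A j" "v \<in> ?A j" for u v j
      using that family_diff[OF G] family_diff[OF B] by (simp add: scale_right_diff_distrib)
    show "smult r u \<in> ?A (e + j)" if "r \<in> homog e" "u \<in> ?A j" for r u e j
    proof -
      have "smult r (smult x u) \<in> B (e + j + d)"
        using family_smult[OF B that(1), of "smult x u" "j + d"] that(2) by (simp add: add.assoc)
      then show ?thesis
        using that family_smult[OF G] by (simp add: mult.commute)
    qed
  qed
  have BA: "B j \<subseteq> ?A j" for j
    using BG family_smult[OF B x, of _ j "j + d"] by auto
  have AG: "?A j \<subseteq> G j" for j
    by blast
  have van_G: "tor_vanishes smult (koszul n) G B i j" if "s < j - int i" for i j
    using bound that by (simp add: reg_bound_def)
  \<comment> \<open>\<open>?A/B\<close> is the annihilator of \<open>x\<close> on \<open>G/B\<close>, and \<open>?B'/B\<close> is the image of \<open>x\<close>.\<close>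
  have "?A j \<subseteq> B j" if "s < j" for j
    using colon_vanishes_above_reg[OF M G B almost bound that] by blast
  then have van_A: "tor_vanishes smult (koszul n) ?A B i j" if "s < j - int i" for i j
    using that A M by (intro tor_vanishes_concentrated) simp_all
  have van_GA: "tor_vanishes smult (koszul n) G ?A i j" if "s < j - int i" for i j
    by (rule tor_vanishes_quotient[OF koszul_complex M G A B AG BA van_G[OF that]])
      (use that in \<open>simp add: van_A\<close>)
  have van_B': "tor_vanishes smult (koszul n) ?B' B i j" if "s + d < j - int i" for i j
    using that by (intro tor_vanishes_shift[OF koszul_complex M G B] van_GA) simp
  have B': "graded_family smult ?B'"
    by (rule image_family[OF M G B])
  have B'G: "?B' j \<subseteq> G j" for j
  proof
    fix u
    assume "u \<in> ?B' j"
    then obtain a b where u: "u = smult x a + b" "a \<in> G (j - d)" "b \<in> G j"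
      using BG by blast
    show "u \<in> G j"
      unfolding u(1) using family_smult[OF G x u(2)] by (intro family_add[OF G] u(3)) simp
  qed
  have BB': "B j \<subseteq> ?B' j" for j
  proof
    fix b
    assume "b \<in> B j"
    moreover have "b = smult x 0 + b" by simp
    ultimately show "b \<in> ?B' j"
      using family_zero[OF G] by blast
  qed
  show ?thesis
    unfolding reg_bound_def
  proof (intro allI impI)
    fix i j
    assume ij: "s + d - 1 < j - int i"
    then have "s < j - int i"
      using d by simp
    from van_G[OF this] show "tor_vanishes smult (koszul n) G ?B' i j"
      by (rule tor_vanishes_quotient[OF koszul_complex M G B' B B'G BB'])
        (use ij in \<open>simp add: van_B'\<close>)
  qed
qed

lemma reg_bound_sequence:
  assumes G: "graded_module smult G"
    and xs: "\<And>i. i < length xs \<Longrightarrow> xs ! i \<in> homog (ds i)" "\<And>i. i < length xs \<Longrightarrow> 1 \<le> ds i"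
    and almost: "\<And>i. i < length xs \<Longrightarrow> \<exists>j0. \<forall>j\<ge>j0. \<forall>u\<in>G (j - ds i).
      smult (xs ! i) u \<in> ideal_mult smult (ideal_gen (set (take i xs))) \<longrightarrow>
      u \<in> ideal_mult smult (ideal_gen (set (take i xs)))"
    and bound: "reg_bound smult G (\<lambda>_. {0}) r"
  shows "k \<le> length xs \<Longrightarrow> reg_bound smult G
    (\<lambda>j. ideal_mult smult (ideal_gen (set (take k xs))) \<inter> G j) (r + (\<Sum>i<k. ds i - 1))"
proof (induction k)
  have M: "module smult" using G by (simp add: graded_module_def)
  case 0
  have "{0} \<inter> G j = {0}" for j
    using family_zero[OF graded_module_family[OF G]] by blast
  then show ?case
    using bound by (simp add: ideal_mult_empty[OF M])
next
  have M: "module smult" using G by (simp add: graded_module_def)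
  note fam = graded_module_family[OF G]
  case (Suc k)
  then have k: "k < length xs" by simp
  let ?N = "ideal_mult smult (ideal_gen (set (take k xs)))"
  have S: "set (take (Suc k) xs) = insert (xs ! k) (set (take k xs))"
    using k by (simp add: take_Suc_conv_app_nth)
  have hom: "\<exists>d. x \<in> homog d" if "x \<in> set (take k xs)" for x
  proof -
    obtain i where "i < k" "x = xs ! i"
      using \<open>x \<in> set (take k xs)\<close> k by (auto simp: in_set_conv_nth)
    then show ?thesis
      using xs(1)[of i] k by auto
  qed
  obtain j0 where j0: "\<And>j u. j0 \<le> j \<Longrightarrow> u \<in> G (j - ds k) \<Longrightarrow> smult (xs ! k) u \<in> ?N \<Longrightarrow> u \<in> ?N"
    using almost[OF k] by blast
  have "reg_bound smult G
      (\<lambda>j. {smult (xs ! k) a + b |a b. a \<in> G (j - ds k) \<and> b \<in> ?N \<inter> G j})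
      (r + (\<Sum>i<k. ds i - 1) + ds k - 1)"
    by (rule reg_bound_almost_regular[OF M fam ideal_mult_family[OF G] _ xs(1)[OF k] xs(2)[OF k], of _ j0])
      (use j0 Suc in auto)
  moreover have "ideal_mult smult (ideal_gen (set (take (Suc k) xs))) \<inter> G j
      = {smult (xs ! k) a + b |a b. a \<in> G (j - ds k) \<and> b \<in> ?N \<inter> G j}" for j
    using ideal_mult_insert_graded[OF G finite_set hom xs(1)[OF k], of "take k xs" j] by (simp add: S)
  ultimately show ?case
    by (simp add: algebra_simps)
qed

text \<open>
Passing from \<open>M/IM\<close> to the submodule \<open>IM\<close> raises the bound by one.
\<close>

lemma reg_bound_ideal_mult:
  assumes G: "graded_module smult G"
    and xs: "\<And>i. i < length xs \<Longrightarrow> xs ! i \<in> homog (ds i)" "\<And>i. i < length xs \<Longrightarrow> 1 \<le> ds i"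
    and almost: "\<And>i. i < length xs \<Longrightarrow> \<exists>j0. \<forall>j\<ge>j0. \<forall>u\<in>G (j - ds i).
      smult (xs ! i) u \<in> ideal_mult smult (ideal_gen (set (take i xs))) \<longrightarrow>
      u \<in> ideal_mult smult (ideal_gen (set (take i xs)))"
    and bound: "reg_bound smult G (\<lambda>_. {0}) r"
  shows "reg_bound smult (\<lambda>j. ideal_mult smult (ideal_gen (set xs)) \<inter> G j) (\<lambda>_. {0})
    (r + ((\<Sum>i<length xs. ds i - 1) + 1))"
  unfolding reg_bound_def
proof (intro allI impI)
  have M: "module smult" using G by (simp add: graded_module_def)
  note fam = graded_module_family[OF G] and sub = ideal_mult_family[OF G]
  fix i j
  assume ij: "r + ((\<Sum>i<length xs. ds i - 1) + 1) < j - int i"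
  have "0 \<le> (\<Sum>i<length xs. ds i - 1)"
    using xs(2) by (intro sum_nonneg) fastforce
  then have "tor_vanishes smult (koszul n) G (\<lambda>_. {0}) i j"
    using bound ij by (simp add: reg_bound_def)
  moreover have "tor_vanishes smult (koszul n) G
      (\<lambda>j. ideal_mult smult (ideal_gen (set xs)) \<inter> G j) (Suc i) j"
    using reg_bound_sequence[OF G xs almost bound order_refl] ij by (simp add: reg_bound_def)
  ultimately show "tor_vanishes smult (koszul n)
      (\<lambda>j. ideal_mult smult (ideal_gen (set xs)) \<inter> G j) (\<lambda>_. {0}) i j"
    using family_zero[OF sub] by (intro tor_vanishes_sub[OF koszul_complex M fam sub]) auto
qed

section \<open>The lower bound\<close>

lemma tor_ring_vanishes: "tor_vanishes (*) (koszul n) homog (\<lambda>_. {0}) (Suc i) j"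
  unfolding tor_vanishes_def
proof (intro allI impI)
  fix u
  assume "tor_cycle (*) (koszul n) homog (\<lambda>_. {0}) (Suc i) j u"
  then have "u \<in> graded_tuples homog (degs (koszul n) (Suc i)) j" "res_cycle K_scale (koszul n) (Suc i) u"
    by (simp_all add: tor_cycle_def tuples_trivial res_cycle_def)
  from resolution_exact_graded[OF koszul_resolution this]
  show "\<exists>v\<in>graded_tuples homog (degs (koszul n) (Suc (Suc i))) j.
      u - res_diff (*) (koszul n) (Suc i) v \<in> graded_tuples (\<lambda>_. {0}) (degs (koszul n) (Suc i)) j"
    by (auto simp: tuples_trivial)
qed

lemma tor_ring_nonzero: "\<not> tor_vanishes (*) (koszul n) homog (\<lambda>_. {0}) 0 0"
proof
  note C = koszul_cyclic_resolution[OF order_refl, unfolded cyclic_resolution_def]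
  have deg0: "degs (koszul n) 0 = [0]"
    using C by blast
  let ?e = "\<lambda>k. if k = 0 then 1 else 0 :: 'r"
  have e: "?e \<in> graded_tuples homog (degs (koszul n) 0) 0"
    by (simp add: graded_tuples_def free_tuples_def deg0 one_homog)
  assume "tor_vanishes (*) (koszul n) homog (\<lambda>_. {0}) 0 0"
  then obtain v where "v \<in> graded_tuples homog (degs (koszul n) (Suc 0)) 0"
    "?e - res_diff (*) (koszul n) 0 v = 0"
    using e by (auto simp: tor_vanishes_def tor_cycle_def tuples_trivial)
  then have boundary: "\<exists>v\<in>free_tuples (degs (koszul n) (Suc 0)). res_diff (*) (koszul n) 0 v = ?e"
    by (auto simp: graded_tuples_def)
  have free: "?e \<in> free_tuples [0::int]"
    by (simp add: free_tuples_def)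
  have "\<And>u. u \<in> free_tuples [0::int] \<Longrightarrow>
      \<exists>v\<in>free_tuples (degs (koszul n) (Suc 0)). res_diff (*) (koszul n) 0 v = u \<Longrightarrow>
      u 0 \<in> ideal_gen (X ` {..<n})"
    using C by blast
  from this[OF free boundary] have "(1 :: 'r) \<in> ideal_gen (X ` {..<n})"
    by simp
  then show False
    by (simp add: maximal_ideal_iff coeff_one)
qed

text \<open>
Multiplication by \<open>x\<close> on the Koszul complex lifts the zero map of \<open>K\<close>, so it is null-homotopic.
\<close>

lemma maximal_ideal_kills_tor:
  assumes M: "module smult" and A: "graded_family smult A" and B: "graded_family smult B"
    and x: "x \<in> homog d" "x \<in> ideal_gen (X ` {..<n})"
    and u: "tor_cycle smult (koszul n) A B i j u"
  shows "\<exists>v\<in>graded_tuples A (degs (koszul n) (Suc i)) (j + d).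
    (\<lambda>k. smult x (u k)) - res_diff smult (koszul n) i v \<in> graded_tuples B (degs (koszul n) i) (j + d)"
proof -
  interpret module smult by (rule M)
  let ?f = "\<lambda>_ k l. if k = l then x else 0 :: 'r"
  have left: "mat_prod b P (?f i) k l = (if l < b then P k l * x else 0)" for b P i k l
    by (simp add: mat_prod_def if_distrib[of "\<lambda>c. _ * c"] cong: if_cong)
  have right: "mat_prod b (?f i) P k l = (if k < b then x * P k l else 0)" for b P i k l
    by (simp add: mat_prod_def if_distrib[of "\<lambda>c. c * _"] cong: if_cong)
  have f: "chain_map d (koszul n) (koszul n) ?f"
    unfolding chain_map_def mat_eq_def left right
    using x(1) by (auto simp: homog_matrix_def zero_in_homog mult.commute)
  have "aug_row K_scale (koszul n) (?f 0) l = 0" if "l < rk (koszul n) 0" for l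
    using x(2) const_coeff_zero_iff[of x] const_coeff_zero_iff[of 0] module.span_zero[OF module_ring]
    by (auto simp: aug_row_def K_scale_def koszul_aug intro!: sum.neutral)
  from null_homotopic_boundary[OF graded_module_K koszul_resolution koszul_resolution f this M A B u]
  obtain v where v: "v \<in> graded_tuples A (degs (koszul n) (Suc i)) (j + d)"
    "mat_act smult (rk (koszul n) i) (rk (koszul n) i) (?f i) u - res_diff smult (koszul n) i v
      \<in> graded_tuples B (degs (koszul n) i) (j + d)"
    by blast
  have "u k = 0" if "k \<ge> rk (koszul n) i" for k
    using u that by (simp add: tor_cycle_def graded_tuples_def free_tuples_def)
  then have "mat_act smult (rk (koszul n) i) (rk (koszul n) i) (?f i) u = (\<lambda>k. smult x (u k))"
    by (auto simp: mat_act_def fun_eq_iff if_distrib[of "\<lambda>c. smult c _"] cong: if_cong)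
  with v show ?thesis by auto
qed

text \<open>
The contrapositive of the step \<open>Tor\<^sub>i(G/B)\<^sub>j \<noteq> 0 \<Longrightarrow> Tor\<^sub>i\<^sub>+\<^sub>1(G/(xG + B))\<^sub>j\<^sub>+\<^sub>d \<noteq> 0\<close>. For a cycle \<open>u\<close> of \<open>G/B\<close>, the
multiple \<open>xu\<close> is a boundary \<open>\<partial>w\<close> modulo \<open>B\<close>. Then \<open>w\<close> is a cycle modulo \<open>xG + B\<close>; if it
differs from a boundary by \<open>xy\<close> modulo \<open>B\<close>, applying \<open>\<partial>\<close> gives \<open>xu = x \<partial>y\<close> modulo \<open>B\<close>, and \<open>x\<close> cancels.
\<close>

lemma tor_vanishes_regular_quotient:
  assumes M: "module smult" and G: "graded_family smult G" and B: "graded_family smult B"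
    and x: "x \<in> homog d" "1 \<le> d"
    and reg: "\<And>i a. a \<in> G i \<Longrightarrow> smult x a \<in> B (i + d) \<Longrightarrow> a \<in> B i"
    and van: "tor_vanishes smult (koszul n) G
      (\<lambda>j. {smult x a + b |a b. a \<in> G (j - d) \<and> b \<in> B j}) (Suc i) (j + d)"
  shows "tor_vanishes smult (koszul n) G B i j"
  unfolding tor_vanishes_def
proof (intro allI impI)
  interpret module smult by (rule M)
  let ?F = "koszul n"
  let ?B' = "\<lambda>j. {smult x a + b |a b. a \<in> G (j - d) \<and> b \<in> B j}"
  fix u
  assume u: "tor_cycle smult ?F G B i j u"
  have "x \<in> ideal_gen (X ` {..<n})"
    using homog_positive_in_maximal x by simp
  from maximal_ideal_kills_tor[OF M G B x(1) this u] obtain w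
    where w: "w \<in> graded_tuples G (degs ?F (Suc i)) (j + d)"
      "(\<lambda>k. smult x (u k)) - res_diff smult ?F i w \<in> graded_tuples B (degs ?F i) (j + d)"
    by blast
  let ?c = "(\<lambda>k. smult x (u k)) - res_diff smult ?F i w"
  have "res_diff smult ?F i w \<in> graded_tuples ?B' (degs ?F i) (j + d)"
    unfolding graded_tuples_def
  proof (rule CollectI, intro conjI allI impI)
    show "res_diff smult ?F i w \<in> free_tuples (degs ?F i)"
      by (rule res_diff_free)
    fix k
    assume k: "k < rk ?F i"
    have "u k \<in> G (j + d - degs ?F i ! k - d)"
      using u k by (simp add: tor_cycle_def graded_tuples_def algebra_simps)
    moreover have "- ?c k \<in> B (j + d - degs ?F i ! k)"
      using w(2) k by (intro family_minus[OF B]) (simp add: graded_tuples_def)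
    moreover have "res_diff smult ?F i w k = smult x (u k) + - ?c k"
      by simp
    ultimately show "res_diff smult ?F i w k \<in> ?B' (j + d - degs ?F i ! k)"
      by blast
  qed
  then have "tor_cycle smult ?F G ?B' (Suc i) (j + d) w"
    using w(1) by (simp add: tor_cycle_def)
  then obtain v where v: "w - res_diff smult ?F (Suc i) v \<in> graded_tuples ?B' (degs ?F (Suc i)) (j + d)"
    using van unfolding tor_vanishes_def by blast
  then obtain y b where y: "y \<in> graded_tuples G (degs ?F (Suc i)) (j + d - d)"
    and b: "b \<in> graded_tuples B (degs ?F (Suc i)) (j + d)"
    and eq: "w - res_diff smult ?F (Suc i) v = (\<lambda>k. smult x (y k)) + b"
    by (rule tuples_image[OF _ M])
  have y': "y \<in> graded_tuples G (degs ?F (Suc i)) j"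
    using y by simp
  have "res_diff smult ?F i w = res_diff smult ?F i (w - res_diff smult ?F (Suc i) v)"
    using res_diff_res_diff[OF koszul_complex M, of i v]
    by (simp add: res_diff_mat_act mat_act_diff[OF M])
  also have "\<dots> = (\<lambda>k. smult x (res_diff smult ?F i y k)) + res_diff smult ?F i b"
    unfolding eq by (simp add: res_diff_mat_act mat_act_add[OF M] mat_act_scale[OF M])
  finally have "(\<lambda>k. smult x ((u - res_diff smult ?F i y) k)) = ?c + res_diff smult ?F i b"
    by (auto simp: fun_eq_iff scale_right_diff_distrib algebra_simps)
  also have "\<dots> \<in> graded_tuples B (degs ?F i) (j + d)"
    by (intro tuples_add[OF B] w(2) res_diff_graded[OF koszul_complex B b])
  finally have xB: "(\<lambda>k. smult x ((u - res_diff smult ?F i y) k)) \<in> graded_tuples B (degs ?F i) (j + d)" .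
  have "u - res_diff smult ?F i y \<in> graded_tuples G (degs ?F i) j"
    using u by (intro tuples_diff[OF G] res_diff_graded[OF koszul_complex G y'])
      (simp add: tor_cycle_def)
  then have "u - res_diff smult ?F i y \<in> graded_tuples B (degs ?F i) j"
    using xB reg by (auto simp: graded_tuples_def algebra_simps)
  with y' show "\<exists>v\<in>graded_tuples G (degs ?F (Suc i)) j. u - res_diff smult ?F i v \<in> graded_tuples B (degs ?F i) j"
    by blast
qed

lemma tor_quotient_nonzero:
  assumes xs: "\<And>i. i < length xs \<Longrightarrow> xs ! i \<in> homog (ds i)" "\<And>i. i < length xs \<Longrightarrow> 1 \<le> ds i"
    and reg: "regular_sequence xs"
  shows "k \<le> length xs \<Longrightarrow> \<not> tor_vanishes (*) (koszul n) homog
    (\<lambda>j. ideal_gen (set (take k xs)) \<inter> homog j) k (\<Sum>i<k. ds i)"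
proof (induction k)
  case 0
  have "ideal_gen {} \<inter> homog j = {0}" for j
    using module.span_empty[OF module_ring] zero_in_homog by auto
  then show ?case
    using tor_ring_nonzero by simp
next
  note R = graded_module_ring
  case (Suc k)
  then have k: "k < length xs" by simp
  let ?J = "ideal_gen (set (take k xs))"
  have S: "set (take (Suc k) xs) = insert (xs ! k) (set (take k xs))"
    using k by (simp add: take_Suc_conv_app_nth)
  have hom: "\<exists>d. x \<in> homog d" if "x \<in> set (take k xs)" for x
  proof -
    obtain i where "i < k" "x = xs ! i"
      using \<open>x \<in> set (take k xs)\<close> k by (auto simp: in_set_conv_nth)
    then show ?thesis
      using xs(1)[of i] k by auto
  qed
  have J: "graded_family (*) (\<lambda>j. ?J \<inter> homog j)"
    using ideal_mult_family[OF R, of ?J] by (simp add: ideal_mult_ring)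
  have J': "ideal_gen (set (take (Suc k) xs)) \<inter> homog j
      = {xs ! k * a + b |a b. a \<in> homog (j - ds k) \<and> b \<in> ?J \<inter> homog j}" for j
    using ideal_mult_insert_graded[OF R finite_set hom xs(1)[OF k], of "take k xs" j]
    by (simp add: ideal_mult_ring S)
  have "a \<in> ?J \<inter> homog i" if "a \<in> homog i" "xs ! k * a \<in> ?J \<inter> homog (i + ds k)" for a i
    using that reg k by (auto simp: regular_sequence_def)
  from tor_vanishes_regular_quotient[OF module_ring graded_module_family[OF R] J xs(1)[OF k] xs(2)[OF k] this]
  show ?case
    using Suc unfolding J' by auto
qed

text \<open>
The class of \<open>tor_quotient_nonzero\<close> for the whole sequence lives in \<open>Tor\<^sub>m(R/I)\<close> with \<open>m \<ge> 1\<close>, where \<open>R\<close> itself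
has no \<open>Tor\<close>, so it injects into \<open>Tor\<^sub>m\<^sub>-\<^sub>1(I)\<close>.
\<close>

lemma reg_regular_ideal:
  assumes xs: "\<And>i. i < length xs \<Longrightarrow> xs ! i \<in> homog (ds i)" "\<And>i. i < length xs \<Longrightarrow> 1 \<le> ds i"
    and reg: "regular_sequence xs" and "xs \<noteq> []"
  shows "ereal (real_of_int ((\<Sum>i<length xs. ds i - 1) + 1))
    \<le> polynomial_ring.reg emb n X (*) (\<lambda>j. ideal_gen (set xs) \<inter> homog j)"
proof -
  note R = graded_module_ring
  let ?I = "\<lambda>j. ideal_gen (set xs) \<inter> homog j"
  let ?d = "\<Sum>i<length xs. ds i"
  obtain m where m: "length xs = Suc m"
    using \<open>xs \<noteq> []\<close> by (cases xs) auto
  have I: "graded_family (*) ?I"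
    using ideal_mult_family[OF R, of "ideal_gen (set xs)"] by (simp add: ideal_mult_ring)
  have "\<not> tor_vanishes (*) (koszul n) homog ?I (Suc m) ?d"
    using tor_quotient_nonzero[OF xs reg order_refl] m by simp
  then have "\<not> tor_vanishes (*) (koszul n) ?I (\<lambda>_. {0}) m ?d"
    using tor_vanishes_quotient[OF koszul_complex module_ring graded_module_family[OF R] I
        family_trivial[OF module_ring] _ _ tor_ring_vanishes, of m ?d] family_zero[OF I]
    by blast
  then have "Tor_nonzero (*) ?I K_scale K_grading m ?d"
    by (simp add: Tor_nonzero_iff[OF module_ring I])
  then have "ereal (real_of_int (?d - int m)) \<le> reg (*) ?I"
    by (rule Tor_nonzero_le_reg)
  moreover have "(\<Sum>i<length xs. ds i - 1) + 1 = ?d - int m"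
    by (simp add: sum_subtractf m)
  ultimately show ?thesis
    by simp
qed

text \<open>
A nonzero homogeneous element of degree at most 0 is a unit, which cannot lie in the proper ideal, and a zero
entry would put \<open>1\<close> into the ideal of its predecessors.
\<close>

lemma regular_sequence_degree_pos:
  assumes "regular_sequence xs" "i < length xs" "xs ! i \<in> homog d"
  shows "1 \<le> d"
proof (rule ccontr)
  assume "\<not> 1 \<le> d"
  have proper: "1 \<notin> ideal_gen (set xs)"
    using assms(1) ideal_gen_1 by (auto simp: regular_sequence_def)
  have "\<exists>c. xs ! i = emb c"
  proof (cases "d = 0")
    case True
    then show ?thesis using assms(3) homog_zero_degree by simp
  next
    case False
    then have "xs ! i = emb 0"
      using assms(3) \<open>\<not> 1 \<le> d\<close> homog_negative[of "xs ! i" d] by (simp add: emb_zero)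
    then show ?thesis by blast
  qed
  then obtain c where c: "xs ! i = emb c" by blast
  show False
  proof (cases "c = 0")
    case True
    then have "xs ! i * 1 \<in> ideal_gen (set (take i xs))"
      using c module.span_zero[OF module_ring] by (simp add: emb_zero)
    then have "1 \<in> ideal_gen (set (take i xs))"
      using assms(1,2) unfolding regular_sequence_def by blast
    moreover have "ideal_gen (set (take i xs)) \<subseteq> ideal_gen (set xs)"
      by (intro module.span_mono[OF module_ring] set_take_subset)
    ultimately show False
      using proper by blast
  next
    case False
    have "xs ! i \<in> ideal_gen (set xs)"
      using assms(2) by (intro module.span_base[OF module_ring]) simp
    then have "emb (inverse c) * xs ! i \<in> ideal_gen (set xs)"
      by (rule ideal_gen_mult)
    then show False
      using proper False by (simp add: c emb_one flip: emb_mult)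
  qed
qed

section \<open>The inequality\<close>

lemma reg_trivial: "module smult \<Longrightarrow> reg smult (\<lambda>_. {0}) = - \<infinity>"
proof -
  assume M: "module smult"
  have "tor_vanishes smult (koszul n) (\<lambda>_. {0}) (\<lambda>_. {0}) i j" for i j
    by (rule tor_vanishes_concentrated) (simp_all add: family_trivial[OF M] M)
  then have "reg smult (\<lambda>_. {0}) \<le> - \<infinity>"
    by (intro reg_leI) (simp add: Tor_nonzero_iff[OF M family_trivial[OF M]])
  then show ?thesis by simp
qed

end

theorem corollary2p3:
  fixes emb :: "'k::field \<Rightarrow> 'r::comm_ring_1" and n :: nat and X :: "nat \<Rightarrow> 'r"
    and smult :: "'r \<Rightarrow> 'm::ab_group_add \<Rightarrow> 'm" and G :: "int \<Rightarrow> 'm set"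
    and xs :: "'r list" and I :: "'r set"
  assumes "polynomial_ring emb n X"
    and "polynomial_ring.graded_module emb n X smult G"
    and "finitely_generated smult"
    and "\<forall>x\<in>set xs. \<exists>d. x \<in> polynomial_ring.homog emb n X d"
    and "I = ideal_gen (set xs)"
    and "polynomial_ring.almost_regular_sequence emb n X smult G xs"
    and "regular_sequence xs"
  shows "polynomial_ring.reg emb n X smult (\<lambda>j. ideal_mult smult I \<inter> G j)
       \<le> polynomial_ring.reg emb n X smult G
         + polynomial_ring.reg emb n X (*) (\<lambda>j. I \<inter> polynomial_ring.homog emb n X j)"
proof -
  interpret polynomial_ring emb n X by fact
  note G = assms(2) and I = assms(5) and regular = assms(7)
  have M: "module smult"
    using G by (simp add: graded_module_def)
  show ?thesis
  \<comment> \<open>For the empty sequence \<open>reg I = -\<infinity>\<close>, so the lower bound fails, but \<open>IM = 0\<close>.\<close>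
  proof (cases "xs = []")
    case True
    have "ideal_mult smult I \<inter> G j = {0}" for j
      using family_zero[OF graded_module_family[OF G]] True I by (auto simp: ideal_mult_empty[OF M])
    then show ?thesis
      by (simp add: reg_trivial[OF M])
  next
    case False
    \<comment> \<open>Both bounds have to refer to the same degrees; those witnessing almost regularity serve for both.\<close>
    have "\<exists>d. \<forall>i<length xs. xs ! i \<in> homog (d i) \<and>
      (\<exists>j0. \<forall>j\<ge>j0. \<forall>u\<in>G (j - d i).
        smult (xs ! i) u \<in> ideal_mult smult (ideal_gen (set (take i xs))) \<longrightarrow>
        u \<in> ideal_mult smult (ideal_gen (set (take i xs))))"
      using assms(6) unfolding almost_regular_sequence_def almost_regular_mod_def by metis
    then obtain d where hom: "\<And>i. i < length xs \<Longrightarrow> xs ! i \<in> homog (d i)"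
      and almost: "\<And>i. i < length xs \<Longrightarrow> \<exists>j0. \<forall>j\<ge>j0. \<forall>u\<in>G (j - d i).
        smult (xs ! i) u \<in> ideal_mult smult (ideal_gen (set (take i xs))) \<longrightarrow>
        u \<in> ideal_mult smult (ideal_gen (set (take i xs)))"
      by blast
    have pos: "\<And>i. i < length xs \<Longrightarrow> 1 \<le> d i"
      using regular_sequence_degree_pos[OF regular _ hom] by blast
    let ?c = "(\<Sum>i<length xs. d i - 1) + 1"
    have "reg smult (\<lambda>j. ideal_mult smult I \<inter> G j) \<le> reg smult G + ereal (real_of_int ?c)"
      unfolding I
      by (rule reg_le_reg_plus[OF M graded_module_family[OF G] ideal_mult_family[OF G]
            reg_bound_ideal_mult[OF G hom pos almost]])
    also have "\<dots> \<le> reg smult G + reg (*) (\<lambda>j. I \<inter> homog j)"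
      unfolding I by (intro add_left_mono reg_regular_ideal hom pos regular False)
    finally show ?thesis .
  qed
qed

end
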